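(* Let $k$ be an algebraically closed field with $\operatorname{char}(k)\neq 2$, fix a square root $\sqrt{-1}\in k$, let $B$ be a $k$-superscheme and $X$ a $B$-superscheme, and let $(S,\phi)$ and $(S',\phi')$ be $\Pi$-invertible sheaves on $X$. Then, as subsheaves of $S\otimes S'$, the product $S\boxtimes S'$ equals the $\sqrt{-1}$-eigensheaf of $\phi\otimes\phi'$, and the product $S\boxtimes_o S'$ equals the $(-\sqrt{-1})$-eigensheaf of $\phi\otimes\phi'$. (These eigensheaves are, by definition, the composition of $(S,\phi)$ and $(S',\phi')$ in the sense of Voronov, Manin and Penkov.)
   Context: A $\Pi$-invertible sheaf on $X$ is a pair $(S,\phi)$ with $S$ a locally free sheaf of $\mathcal{O}_X$-modules of rank $1|1$ and $\phi$ a global odd endomorphism of $S$ with $\phi^2=1$. $S\otimes S'$ is the tensor product over $\mathcal{O}_X$, and $(\phi\otimes\phi')(s\otimes s')=(-1)^{|s|}\phi(s)\otimes\phi'(s')$ for homogeneous $s$, an even endomorphism of square $-1$. The $\lambda$-eigensheaf of $\phi\otimes\phi'$ is the subsheaf of sections $w$ with $(\phi\otimes\phi')(w)=\lambda w$. $\mathbb{D}:=k[\theta]$ is the $k$-superalgebra with $\theta$ odd, $\theta^2=-1$; $\underline{\mathbb{D}}=\underline{\mathbb{D}}_X$ is the sheaf $\mathbb{D}\otimes_k\mathcal{O}_X$ of superalgebras on $X$, and $\underline{\mathbb{D}}^o$ its opposite (product $a\cdot_ob=(-1)^{|a||b|}ba$, so $\theta\cdot_o\theta=1$). An odd endomorphism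 $\chi$ makes a sheaf of $\mathcal{O}_X$-modules a left $\underline{\mathbb{D}}$-module (if $\chi^2=-1$) or a left $\underline{\mathbb{D}}^o$-module (if $\chi^2=1$) by $\theta\cdot s=\chi(s)$; it makes it a right $\underline{\mathbb{D}}$-module (if $\chi^2=1$) or a right $\underline{\mathbb{D}}^o$-module (if $\chi^2=-1$) by $s\cdot\theta=(-1)^{|s|}\chi(s)$. If $M$ is a left and $N$ a right $\mathcal{A}$-module, $M\otimes N$ is an $(\mathcal{A},\mathcal{A})$-bimodule by $a_1\cdot(m\otimes n)\cdot a_2=(a_1m)\otimes(na_2)$. The supercommutant $P^{\mathcal{A}}$ of an $(\mathcal{A},\mathcal{A})$-bimodule $P$ is the submodule generated by the homogeneous $p$ with $ap=(-1)^{|a||p|}pa$ for all homogeneous $a\in\mathcal{A}$. The products are $$S\boxtimes S' := (S\otimes S')^{\underline{\mathbb{D}}},$$ where $S$ is a left $\underline{\mathbb{D}}$-module via $\sqrt{-1}\,\phi$ and $S'$ a right $\underline{\mathbb{D}}$-module via $\phi'$; and $$S\boxtimes_oS' := (S\otimes S')^{\underline{\mathbb{D}}^o},$$ where $S$ is a left $\underline{\mathbb{D}}^o$-module via $\phi$ and $S'$ a right $\underline{\mathbb{D}}^o$-module via $\sqrt{-1}\,\phi'$. *)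

theory Defs
  imports
    "HOL-Analysis.Function_Topology"
    "HOL-Algebra.Algebraic_Closure"
    "HOL-Algebra.Free_Abelian_Groups"
    "HOL-Library.Z2"
begin

section \<open>Superrings and supermodules\<close>

text \<open>
  Parities are elements of the two-element field \<^typ>\<open>bit\<close>, so that the parity of a product is a sum
  of parities and the exponent in a Koszul sign is a product of parities. As usual, \<open>0\<close> is homogeneous of
  both parities.
\<close>

record 'a superring = "'a ring" +
  grade :: "bit \<Rightarrow> 'a set"

record ('a, 'm) supermodule = "('a, 'm) module" +
  mgrade :: "bit \<Rightarrow> 'm set"

definition z2_graded :: "('m, 'r) ring_scheme \<Rightarrow> (bit \<Rightarrow> 'm set) \<Rightarrow> bool" where
  "z2_graded G gr \<longleftrightarrow>
     (\<forall>i. subgroup (gr i) (add_monoid G)) \<and>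
     (\<forall>x\<in>carrier G. \<exists>!(y, z). y \<in> gr 0 \<and> z \<in> gr 1 \<and> x = y \<oplus>\<^bsub>G\<^esub> z)"

definition hpart :: "('m, 'r) ring_scheme \<Rightarrow> (bit \<Rightarrow> 'm set) \<Rightarrow> bit \<Rightarrow> 'm \<Rightarrow> 'm" where
  "hpart G gr i x = (THE y. y \<in> gr i \<and> (\<exists>z\<in>gr (i + 1). x = y \<oplus>\<^bsub>G\<^esub> z))"

text \<open>\<open>ksign G e x\<close> is \<open>(-1)\<^sup>e x\<close>.\<close>

definition ksign :: "('m, 'r) ring_scheme \<Rightarrow> bit \<Rightarrow> 'm \<Rightarrow> 'm" where
  "ksign G e x = (if e = 1 then \<ominus>\<^bsub>G\<^esub> x else x)"

text \<open>The additive extension of \<open>x \<mapsto> (-1)\<^bsup>|x|\<^esup> x\<close> from homogeneous to all elements.\<close>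

definition twist :: "('m, 'r) ring_scheme \<Rightarrow> (bit \<Rightarrow> 'm set) \<Rightarrow> 'm \<Rightarrow> 'm" where
  "twist G gr x = hpart G gr 0 x \<oplus>\<^bsub>G\<^esub> ksign G 1 (hpart G gr 1 x)"

locale superring = ring R for R :: "('a, 'r) superring_scheme" (structure) +
  assumes graded: "z2_graded R (grade R)"
    and one_even: "\<one> \<in> grade R 0"
    and grade_mult: "\<lbrakk>a \<in> grade R i; b \<in> grade R j\<rbrakk> \<Longrightarrow> a \<otimes> b \<in> grade R (i + j)"

text \<open>
  Below, all superrings are algebras over a field of characteristic other than 2, so that
  supercommutativity already forces odd elements to have square \<open>0\<close>.
\<close>

locale supercommutative_ring = superring R for R :: "('a, 'r) superring_scheme" (structure) +
  assumes supercomm: "\<lbrakk>a \<in> grade R i; b \<in> grade R j\<rbrakk> \<Longrightarrow> a \<otimes> b = ksign R (i * j) (b \<otimes> a)"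

locale local_superring = supercommutative_ring R for R :: "('a, 'r) superring_scheme" (structure) +
  assumes unique_maximal: "\<exists>!M. maximalideal M R"

definition superring_hom ::
    "('a, 'r) superring_scheme \<Rightarrow> ('b, 's) superring_scheme \<Rightarrow> ('a \<Rightarrow> 'b) set" where
  "superring_hom R S = {h \<in> ring_hom R S. \<forall>i. h ` grade R i \<subseteq> grade S i}"

locale super_module = R?: supercommutative_ring R + M?: abelian_group M
  for R :: "('a, 'r) superring_scheme" (structure)
    and M :: "('a, 'm, 's) supermodule_scheme" (structure) +
  assumes M_graded: "z2_graded M (mgrade M)"
    and smult_grade: "\<lbrakk>a \<in> grade R i; x \<in> mgrade M j\<rbrakk> \<Longrightarrow> a \<odot>\<^bsub>M\<^esub> x \<in> mgrade M (i + j)"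
    and smult_closed: "\<lbrakk>a \<in> carrier R; x \<in> carrier M\<rbrakk> \<Longrightarrow> a \<odot>\<^bsub>M\<^esub> x \<in> carrier M"
    and smult_l_distr: "\<lbrakk>a \<in> carrier R; b \<in> carrier R; x \<in> carrier M\<rbrakk> \<Longrightarrow>
          (a \<oplus>\<^bsub>R\<^esub> b) \<odot>\<^bsub>M\<^esub> x = a \<odot>\<^bsub>M\<^esub> x \<oplus>\<^bsub>M\<^esub> b \<odot>\<^bsub>M\<^esub> x"
    and smult_r_distr: "\<lbrakk>a \<in> carrier R; x \<in> carrier M; y \<in> carrier M\<rbrakk> \<Longrightarrow>
          a \<odot>\<^bsub>M\<^esub> (x \<oplus>\<^bsub>M\<^esub> y) = a \<odot>\<^bsub>M\<^esub> x \<oplus>\<^bsub>M\<^esub> a \<odot>\<^bsub>M\<^esub> y"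
    and smult_assoc: "\<lbrakk>a \<in> carrier R; b \<in> carrier R; x \<in> carrier M\<rbrakk> \<Longrightarrow>
          (a \<otimes>\<^bsub>R\<^esub> b) \<odot>\<^bsub>M\<^esub> x = a \<odot>\<^bsub>M\<^esub> (b \<odot>\<^bsub>M\<^esub> x)"
    and smult_one: "x \<in> carrier M \<Longrightarrow> \<one>\<^bsub>R\<^esub> \<odot>\<^bsub>M\<^esub> x = x"

text \<open>
  The right action attached to a left module over a supercommutative ring: the biadditive extension of
  \<open>x \<cdot> f = (-1)\<^bsup>|f||x|\<^esup> f x\<close>.
\<close>

definition rsmult ::
    "('a, 'r) superring_scheme \<Rightarrow> ('a, 'm, 's) supermodule_scheme \<Rightarrow> 'm \<Rightarrow> 'a \<Rightarrow> 'm" where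
  "rsmult R M x f =
     hpart R (grade R) 0 f \<odot>\<^bsub>M\<^esub> x \<oplus>\<^bsub>M\<^esub> hpart R (grade R) 1 f \<odot>\<^bsub>M\<^esub> twist M (mgrade M) x"


section \<open>Tensor products over a supercommutative ring\<close>

text \<open>
  The quotient of the free abelian group on pairs by biadditivity and by
  \<open>(x \<cdot> f) \<otimes> y = x \<otimes> (f y)\<close>; its elements are cosets. The components \<open>mult\<close> and \<open>one\<close> of a module
  record carry no information.
\<close>

definition tensor_free :: "('a, 'm, 's) supermodule_scheme \<Rightarrow> ('a, 'n, 't) supermodule_scheme
    \<Rightarrow> ('m \<times> 'n \<Rightarrow>\<^sub>0 int) monoid" where
  "tensor_free M N = free_Abelian_group (carrier M \<times> carrier N)"

definition tensor_relations :: "('a, 'r) superring_scheme \<Rightarrow> ('a, 'm, 's) supermodule_scheme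
    \<Rightarrow> ('a, 'n, 't) supermodule_scheme \<Rightarrow> ('m \<times> 'n \<Rightarrow>\<^sub>0 int) set" where
  "tensor_relations R M N =
     {frag_of (x \<oplus>\<^bsub>M\<^esub> x', y) - frag_of (x, y) - frag_of (x', y) | x x' y.
        x \<in> carrier M \<and> x' \<in> carrier M \<and> y \<in> carrier N} \<union>
     {frag_of (x, y \<oplus>\<^bsub>N\<^esub> y') - frag_of (x, y) - frag_of (x, y') | x y y'.
        x \<in> carrier M \<and> y \<in> carrier N \<and> y' \<in> carrier N} \<union>
     {frag_of (rsmult R M x f, y) - frag_of (x, f \<odot>\<^bsub>N\<^esub> y) | x f y.
        x \<in> carrier M \<and> f \<in> carrier R \<and> y \<in> carrier N}"

definition tensor_kernel :: "('a, 'r) superring_scheme \<Rightarrow> ('a, 'm, 's) supermodule_scheme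
    \<Rightarrow> ('a, 'n, 't) supermodule_scheme \<Rightarrow> ('m \<times> 'n \<Rightarrow>\<^sub>0 int) set" where
  "tensor_kernel R M N = generate (tensor_free M N) (tensor_relations R M N)"

definition tensor_class :: "('a, 'r) superring_scheme \<Rightarrow> ('a, 'm, 's) supermodule_scheme
    \<Rightarrow> ('a, 'n, 't) supermodule_scheme \<Rightarrow> ('m \<times> 'n \<Rightarrow>\<^sub>0 int) \<Rightarrow> ('m \<times> 'n \<Rightarrow>\<^sub>0 int) set" where
  "tensor_class R M N c = tensor_kernel R M N #>\<^bsub>tensor_free M N\<^esub> c"

text \<open>
  The additive map \<open>M \<otimes> N \<rightarrow> M' \<otimes> N'\<close> with \<open>x \<otimes> y \<mapsto> g x \<otimes> h y\<close> (no sign), meaningful for additive \<open>g\<close>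
  and \<open>h\<close> such that \<open>(x, y) \<mapsto> g x \<otimes> h y\<close> is balanced.
\<close>

definition tensor_map where
  "tensor_map R M N R' M' N' g h Z =
     (\<Union>c\<in>Z. tensor_class R' M' N' (frag_extend (\<lambda>(x, y). frag_of (g x, h y)) c))"

definition tensor_module :: "('a, 'r) superring_scheme \<Rightarrow> ('a, 'm, 's) supermodule_scheme
    \<Rightarrow> ('a, 'n, 't) supermodule_scheme \<Rightarrow> ('a, ('m \<times> 'n \<Rightarrow>\<^sub>0 int) set) supermodule" where
  "tensor_module R M N =
     \<lparr>carrier = carrier (tensor_free M N Mod tensor_kernel R M N),
      monoid.mult = undefined, monoid.one = undefined,
      ring.zero = \<one>\<^bsub>tensor_free M N Mod tensor_kernel R M N\<^esub>,
      ring.add = (\<otimes>\<^bsub>tensor_free M N Mod tensor_kernel R M N\<^esub>),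
      module.smult = (\<lambda>f. tensor_map R M N R M N (\<lambda>x. f \<odot>\<^bsub>M\<^esub> x) (\<lambda>y. y)),
      mgrade = (\<lambda>d. tensor_class R M N ` generate (tensor_free M N)
        {frag_of (x, y) | x y i j. x \<in> mgrade M i \<and> y \<in> mgrade N j \<and> i + j = d})\<rparr>"


section \<open>Sheaves and germs\<close>

text \<open>
  A presheaf is given by its sets of sections \<open>F U\<close>, all contained in one type, and its restriction maps
  \<open>r U V\<close> from \<open>U\<close> to \<open>V\<close>. Only open \<open>V \<subseteq> U\<close> matter.
\<close>

definition presheaf :: "'x topology \<Rightarrow> ('x set \<Rightarrow> 's set) \<Rightarrow> ('x set \<Rightarrow> 'x set \<Rightarrow> 's \<Rightarrow> 's) \<Rightarrow> bool" where
  "presheaf T F r \<longleftrightarrow>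
     (\<forall>U V. openin T U \<and> openin T V \<and> V \<subseteq> U \<longrightarrow> r U V \<in> F U \<rightarrow> F V) \<and>
     (\<forall>U. openin T U \<longrightarrow> (\<forall>s\<in>F U. r U U s = s)) \<and>
     (\<forall>U V W. openin T U \<and> openin T V \<and> openin T W \<and> W \<subseteq> V \<and> V \<subseteq> U \<longrightarrow>
        (\<forall>s\<in>F U. r V W (r U V s) = r U W s))"

definition sheaf :: "'x topology \<Rightarrow> ('x set \<Rightarrow> 's set) \<Rightarrow> ('x set \<Rightarrow> 'x set \<Rightarrow> 's \<Rightarrow> 's) \<Rightarrow> bool" where
  "sheaf T F r \<longleftrightarrow> presheaf T F r \<and>
     (\<forall>\<V> s. (\<forall>V\<in>\<V>. openin T V \<and> s V \<in> F V) \<and>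
        (\<forall>V\<in>\<V>. \<forall>W\<in>\<V>. r V (V \<inter> W) (s V) = r W (V \<inter> W) (s W)) \<longrightarrow>
        (\<exists>!t. t \<in> F (\<Union>\<V>) \<and> (\<forall>V\<in>\<V>. r (\<Union>\<V>) V t = s V)))"

definition germ :: "'x topology \<Rightarrow> ('x set \<Rightarrow> 's set) \<Rightarrow> ('x set \<Rightarrow> 'x set \<Rightarrow> 's \<Rightarrow> 's)
    \<Rightarrow> 'x \<Rightarrow> 'x set \<Rightarrow> 's \<Rightarrow> ('x set \<times> 's) set" where
  "germ T F r x U s = {(V, t). openin T V \<and> x \<in> V \<and> t \<in> F V \<and>
     (\<exists>W. openin T W \<and> x \<in> W \<and> W \<subseteq> U \<inter> V \<and> r U W s = r V W t)}"

definition germs_at :: "'x topology \<Rightarrow> ('x set \<Rightarrow> 's set) \<Rightarrow> ('x set \<Rightarrow> 'x set \<Rightarrow> 's \<Rightarrow> 's)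
    \<Rightarrow> ('x set \<Rightarrow> 's set) \<Rightarrow> 'x \<Rightarrow> ('x set \<times> 's) set set" where
  "germs_at T F r G x = {germ T F r x U s | U s. openin T U \<and> x \<in> U \<and> s \<in> G U}"

definition germ_binop where
  "germ_binop T F r x opn G H = (\<Union>(U, s)\<in>G. \<Union>(V, t)\<in>H.
     germ T F r x (U \<inter> V) (opn (U \<inter> V) (r U (U \<inter> V) s) (r V (U \<inter> V) t)))"


section \<open>Superschemes\<close>

record ('x, 'a) superspace =
  topo :: "'x topology"
  sec :: "'x set \<Rightarrow> 'a superring"
  res :: "'x set \<Rightarrow> 'x set \<Rightarrow> 'a \<Rightarrow> 'a"

definition sheaf_of_superrings :: "('x, 'a) superspace \<Rightarrow> bool" where
  "sheaf_of_superrings \<X> \<longleftrightarrow>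
     sheaf (topo \<X>) (\<lambda>U. carrier (sec \<X> U)) (res \<X>) \<and>
     (\<forall>U. openin (topo \<X>) U \<longrightarrow> superring (sec \<X> U)) \<and>
     (\<forall>U V. openin (topo \<X>) U \<and> openin (topo \<X>) V \<and> V \<subseteq> U \<longrightarrow>
        res \<X> U V \<in> superring_hom (sec \<X> U) (sec \<X> V))"

definition stalk :: "('x, 'a) superspace \<Rightarrow> 'x \<Rightarrow> ('x set \<times> 'a) set superring" where
  "stalk \<X> x =
     (let T = topo \<X>; F = (\<lambda>U. carrier (sec \<X> U)); r = res \<X> in
      \<lparr>carrier = germs_at T F r F x,
       monoid.mult = germ_binop T F r x (\<lambda>U. (\<otimes>\<^bsub>sec \<X> U\<^esub>)),
       monoid.one = germ T F r x (topspace T) \<one>\<^bsub>sec \<X> (topspace T)\<^esub>,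
       ring.zero = germ T F r x (topspace T) \<zero>\<^bsub>sec \<X> (topspace T)\<^esub>,
       ring.add = germ_binop T F r x (\<lambda>U. (\<oplus>\<^bsub>sec \<X> U\<^esub>)),
       grade = (\<lambda>i. germs_at T F r (\<lambda>U. grade (sec \<X> U) i) x)\<rparr>)"

definition locally_superringed :: "('x, 'a) superspace \<Rightarrow> bool" where
  "locally_superringed \<X> \<longleftrightarrow> sheaf_of_superrings \<X> \<and>
     (\<forall>U. openin (topo \<X>) U \<longrightarrow> supercommutative_ring (sec \<X> U)) \<and>
     (\<forall>x\<in>topspace (topo \<X>). local_superring (stalk \<X> x))"

definition open_subspace :: "('x, 'a) superspace \<Rightarrow> 'x set \<Rightarrow> ('x, 'a) superspace" where
  "open_subspace \<X> U = \<X>\<lparr>topo := subtopology (topo \<X>) U\<rparr>"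

text \<open>A morphism \<open>\<X> \<rightarrow> Y\<close> is a map \<open>f\<close> with comorphisms \<open>c V : O\<^sub>Y(V) \<rightarrow> O\<^sub>\<X>(f\<^sup>-\<^sup>1 V)\<close>.\<close>

definition preimage :: "('x, 'a) superspace \<Rightarrow> ('x \<Rightarrow> 'y) \<Rightarrow> 'y set \<Rightarrow> 'x set" where
  "preimage \<X> f V = {x \<in> topspace (topo \<X>). f x \<in> V}"

definition superspace_morphism :: "('x, 'a) superspace \<Rightarrow> ('y, 'b) superspace
    \<Rightarrow> ('x \<Rightarrow> 'y) \<Rightarrow> ('y set \<Rightarrow> 'b \<Rightarrow> 'a) \<Rightarrow> bool" where
  "superspace_morphism \<X> Y f c \<longleftrightarrow>
     continuous_map (topo \<X>) (topo Y) f \<and>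
     (\<forall>V. openin (topo Y) V \<longrightarrow> c V \<in> superring_hom (sec Y V) (sec \<X> (preimage \<X> f V))) \<and>
     (\<forall>V W. openin (topo Y) V \<and> openin (topo Y) W \<and> W \<subseteq> V \<longrightarrow>
        (\<forall>t\<in>carrier (sec Y V).
           c W (res Y V W t) = res \<X> (preimage \<X> f V) (preimage \<X> f W) (c V t)))"

definition superspace_iso :: "('x, 'a) superspace \<Rightarrow> ('y, 'b) superspace
    \<Rightarrow> ('x \<Rightarrow> 'y) \<Rightarrow> ('y set \<Rightarrow> 'b \<Rightarrow> 'a) \<Rightarrow> bool" where
  "superspace_iso \<X> Y f c \<longleftrightarrow>
     superspace_morphism \<X> Y f c \<and> homeomorphic_map (topo \<X>) (topo Y) f \<and>
     (\<forall>V. openin (topo Y) V \<longrightarrow>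
        bij_betw (c V) (carrier (sec Y V)) (carrier (sec \<X> (preimage \<X> f V))))"

definition stalk_map :: "('x, 'a) superspace \<Rightarrow> ('x \<Rightarrow> 'y) \<Rightarrow> ('y set \<Rightarrow> 'b \<Rightarrow> 'a)
    \<Rightarrow> 'x \<Rightarrow> ('y set \<times> 'b) set \<Rightarrow> ('x set \<times> 'a) set" where
  "stalk_map \<X> f c x G =
     (\<Union>(V, t)\<in>G. germ (topo \<X>) (\<lambda>U. carrier (sec \<X> U)) (res \<X>) x (preimage \<X> f V) (c V t))"

definition superscheme_morphism :: "('x, 'a) superspace \<Rightarrow> ('y, 'b) superspace
    \<Rightarrow> ('x \<Rightarrow> 'y) \<Rightarrow> ('y set \<Rightarrow> 'b \<Rightarrow> 'a) \<Rightarrow> bool" where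
  "superscheme_morphism \<X> Y f c \<longleftrightarrow> superspace_morphism \<X> Y f c \<and>
     (\<forall>x\<in>topspace (topo \<X>). \<forall>M N.
        maximalideal M (stalk Y (f x)) \<and> maximalideal N (stalk \<X> x) \<longrightarrow> stalk_map \<X> f c x ` M \<subseteq> N)"

text \<open>
  The spectrum of a supercommutative ring \<open>A\<close>: its points are the prime ideals of the even part, and its
  structure sheaf is the sheaf associated with \<open>A\<close> as a module over the even part.
\<close>

definition even_part :: "'a superring \<Rightarrow> 'a ring" where
  "even_part A = \<lparr>carrier = grade A 0, monoid.mult = (\<otimes>\<^bsub>A\<^esub>), monoid.one = \<one>\<^bsub>A\<^esub>, ring.zero = \<zero>\<^bsub>A\<^esub>, ring.add = (\<oplus>\<^bsub>A\<^esub>)\<rparr>"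

definition spec_topology :: "'a superring \<Rightarrow> 'a set topology" where
  "spec_topology A =
     topology_generated_by {{p. primeideal p (even_part A) \<and> f \<notin> p} | f. f \<in> grade A 0}"

definition fraction :: "'a superring \<Rightarrow> 'a set \<Rightarrow> 'a \<Rightarrow> 'a \<Rightarrow> ('a \<times> 'a) set" where
  "fraction A p a f = {(b, g). b \<in> carrier A \<and> g \<in> grade A 0 - p \<and>
     (\<exists>h\<in>grade A 0 - p. h \<otimes>\<^bsub>A\<^esub> (g \<otimes>\<^bsub>A\<^esub> a) = h \<otimes>\<^bsub>A\<^esub> (f \<otimes>\<^bsub>A\<^esub> b))}"

definition localization :: "'a superring \<Rightarrow> 'a set \<Rightarrow> ('a \<times> 'a) set superring" where
  "localization A p =
     \<lparr>carrier = {fraction A p a f | a f. a \<in> carrier A \<and> f \<in> grade A 0 - p},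
      monoid.mult = (\<lambda>Y Z. \<Union>(a, f)\<in>Y. \<Union>(b, g)\<in>Z. fraction A p (a \<otimes>\<^bsub>A\<^esub> b) (f \<otimes>\<^bsub>A\<^esub> g)),
      monoid.one = fraction A p \<one>\<^bsub>A\<^esub> \<one>\<^bsub>A\<^esub>,
      ring.zero = fraction A p \<zero>\<^bsub>A\<^esub> \<one>\<^bsub>A\<^esub>,
      ring.add = (\<lambda>Y Z. \<Union>(a, f)\<in>Y. \<Union>(b, g)\<in>Z.
               fraction A p (g \<otimes>\<^bsub>A\<^esub> a \<oplus>\<^bsub>A\<^esub> f \<otimes>\<^bsub>A\<^esub> b) (f \<otimes>\<^bsub>A\<^esub> g)),
      grade = (\<lambda>i. {fraction A p a f | a f. a \<in> grade A i \<and> f \<in> grade A 0 - p})\<rparr>"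

definition spec_sections :: "'a superring \<Rightarrow> 'a set set \<Rightarrow> ('a set \<Rightarrow> ('a \<times> 'a) set) set" where
  "spec_sections A U = {s \<in> (\<Pi>\<^sub>E p\<in>U. carrier (localization A p)).
     \<forall>p\<in>U. \<exists>V a f. openin (spec_topology A) V \<and> p \<in> V \<and> V \<subseteq> U \<and> a \<in> carrier A \<and> f \<in> grade A 0 \<and>
       (\<forall>q\<in>V. f \<notin> q \<and> s q = fraction A q a f)}"

definition Spec :: "'a superring \<Rightarrow> ('a set, 'a set \<Rightarrow> ('a \<times> 'a) set) superspace" where
  "Spec A =
     \<lparr>topo = spec_topology A,
      sec = (\<lambda>U.
        \<lparr>carrier = spec_sections A U,
         monoid.mult = (\<lambda>s t. \<lambda>p\<in>U. s p \<otimes>\<^bsub>localization A p\<^esub> t p),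
         monoid.one = (\<lambda>p\<in>U. \<one>\<^bsub>localization A p\<^esub>),
         ring.zero = (\<lambda>p\<in>U. \<zero>\<^bsub>localization A p\<^esub>),
         ring.add = (\<lambda>s t. \<lambda>p\<in>U. s p \<oplus>\<^bsub>localization A p\<^esub> t p),
         grade = (\<lambda>i. {s \<in> spec_sections A U. \<forall>p\<in>U. s p \<in> grade (localization A p) i})\<rparr>),
      res = (\<lambda>U V s. restrict s V)\<rparr>"

text \<open>
  If \<open>U\<close> is isomorphic to \<open>Spec A\<close>, then \<open>A\<close> is isomorphic to \<open>O\<^sub>\<X>(U)\<close>; hence letting \<open>A\<close> range over
  superrings with elements in the type of sections of \<open>\<X>\<close> is no restriction.
\<close>

definition superscheme :: "('x, 'a) superspace \<Rightarrow> bool" where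
  "superscheme \<X> \<longleftrightarrow> locally_superringed \<X> \<and>
     (\<forall>x\<in>topspace (topo \<X>). \<exists>U. openin (topo \<X>) U \<and> x \<in> U \<and>
        (\<exists>(A :: 'a superring) f c.
           supercommutative_ring A \<and> superspace_iso (open_subspace \<X> U) (Spec A) f c))"

text \<open>
  A \<open>k\<close>-superscheme is a superscheme whose structure sheaf is a sheaf of \<open>k\<close>-superalgebras. The algebra
  structure is given by \<open>\<iota> : k \<rightarrow> O\<^sub>B(B)\<close> into the even global functions, since the structure map on an
  open \<open>U\<close> is forced to be \<open>\<iota>\<close> followed by restriction to \<open>U\<close>.
\<close>

definition superscheme_over_field ::
    "('k, 'r) ring_scheme \<Rightarrow> ('y, 'b) superspace \<Rightarrow> ('k \<Rightarrow> 'b) \<Rightarrow> bool" where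
  "superscheme_over_field k B \<iota> \<longleftrightarrow> superscheme B \<and>
     \<iota> \<in> ring_hom k (sec B (topspace (topo B))) \<and>
     \<iota> ` carrier k \<subseteq> grade (sec B (topspace (topo B))) 0"


section \<open>Sheaves of modules and \<open>\<Pi>\<close>-invertible sheaves\<close>

record ('x, 'a, 'm) msheaf =
  msec :: "'x set \<Rightarrow> ('a, 'm) supermodule"
  mres :: "'x set \<Rightarrow> 'x set \<Rightarrow> 'm \<Rightarrow> 'm"

definition sheaf_of_modules :: "('x, 'a) superspace \<Rightarrow> ('x, 'a, 'm) msheaf \<Rightarrow> bool" where
  "sheaf_of_modules \<X> S \<longleftrightarrow>
     sheaf (topo \<X>) (\<lambda>U. carrier (msec S U)) (mres S) \<and>
     (\<forall>U. openin (topo \<X>) U \<longrightarrow> super_module (sec \<X> U) (msec S U)) \<and>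
     (\<forall>U V. openin (topo \<X>) U \<and> openin (topo \<X>) V \<and> V \<subseteq> U \<longrightarrow>
        (\<forall>s\<in>carrier (msec S U). \<forall>t\<in>carrier (msec S U).
           mres S U V (s \<oplus>\<^bsub>msec S U\<^esub> t) = mres S U V s \<oplus>\<^bsub>msec S V\<^esub> mres S U V t) \<and>
        (\<forall>f\<in>carrier (sec \<X> U). \<forall>s\<in>carrier (msec S U).
           mres S U V (f \<odot>\<^bsub>msec S U\<^esub> s) = res \<X> U V f \<odot>\<^bsub>msec S V\<^esub> mres S U V s) \<and>
        (\<forall>i. mres S U V ` mgrade (msec S U) i \<subseteq> mgrade (msec S V) i))"

definition locally_free_1_1 :: "('x, 'a) superspace \<Rightarrow> ('x, 'a, 'm) msheaf \<Rightarrow> bool" where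
  "locally_free_1_1 \<X> S \<longleftrightarrow> sheaf_of_modules \<X> S \<and>
     (\<forall>x\<in>topspace (topo \<X>). \<exists>U. openin (topo \<X>) U \<and> x \<in> U \<and>
        (\<exists>e\<in>mgrade (msec S U) 0. \<exists>\<epsilon>\<in>mgrade (msec S U) 1.
           \<forall>V. openin (topo \<X>) V \<and> V \<subseteq> U \<longrightarrow>
             (\<forall>s\<in>carrier (msec S V). \<exists>!(f, g).
                f \<in> carrier (sec \<X> V) \<and> g \<in> carrier (sec \<X> V) \<and>
                s = f \<odot>\<^bsub>msec S V\<^esub> mres S U V e \<oplus>\<^bsub>msec S V\<^esub> g \<odot>\<^bsub>msec S V\<^esub> mres S U V \<epsilon>)))"

text \<open>
  Odd endomorphisms obey the sign rule \<open>\<phi>(f s) = (-1)\<^bsup>|f|\<^esup> f \<phi>(s)\<close>, which is what makes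
  \<open>\<phi> \<otimes> \<phi>'\<close> well defined on the tensor product over \<open>O\<^sub>\<X>\<close>.
\<close>

definition odd_endomorphism ::
    "('x, 'a) superspace \<Rightarrow> ('x, 'a, 'm) msheaf \<Rightarrow> ('x set \<Rightarrow> 'm \<Rightarrow> 'm) \<Rightarrow> bool" where
  "odd_endomorphism \<X> S \<phi> \<longleftrightarrow>
     (\<forall>U. openin (topo \<X>) U \<longrightarrow>
        \<phi> U \<in> carrier (msec S U) \<rightarrow> carrier (msec S U) \<and>
        (\<forall>s\<in>carrier (msec S U). \<forall>t\<in>carrier (msec S U).
           \<phi> U (s \<oplus>\<^bsub>msec S U\<^esub> t) = \<phi> U s \<oplus>\<^bsub>msec S U\<^esub> \<phi> U t) \<and>
        (\<forall>i. \<forall>f\<in>grade (sec \<X> U) i. \<forall>s\<in>carrier (msec S U).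
           \<phi> U (f \<odot>\<^bsub>msec S U\<^esub> s) = ksign (msec S U) i (f \<odot>\<^bsub>msec S U\<^esub> \<phi> U s)) \<and>
        (\<forall>i. \<phi> U ` mgrade (msec S U) i \<subseteq> mgrade (msec S U) (i + 1))) \<and>
     (\<forall>U V. openin (topo \<X>) U \<and> openin (topo \<X>) V \<and> V \<subseteq> U \<longrightarrow>
        (\<forall>s\<in>carrier (msec S U). \<phi> V (mres S U V s) = mres S U V (\<phi> U s)))"

definition Pi_invertible ::
    "('x, 'a) superspace \<Rightarrow> ('x, 'a, 'm) msheaf \<Rightarrow> ('x set \<Rightarrow> 'm \<Rightarrow> 'm) \<Rightarrow> bool" where
  "Pi_invertible \<X> S \<phi> \<longleftrightarrow> locally_free_1_1 \<X> S \<and> odd_endomorphism \<X> S \<phi> \<and>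
     (\<forall>U. openin (topo \<X>) U \<longrightarrow> (\<forall>s\<in>carrier (msec S U). \<phi> U (\<phi> U s) = s))"


section \<open>The tensor product sheaf\<close>

abbreviation pgerm :: "('x, 'a) superspace \<Rightarrow> ('x, 'a, 'm) msheaf
    \<Rightarrow> 'x \<Rightarrow> 'x set \<Rightarrow> 'm \<Rightarrow> ('x set \<times> 'm) set" where
  "pgerm \<X> P \<equiv> germ (topo \<X>) (\<lambda>U. carrier (msec P U)) (mres P)"

text \<open>
  The map of sheafifications over \<open>U\<close> induced by maps \<open>u V : P(V) \<rightarrow> P(V)\<close>, for \<open>V \<subseteq> U\<close>, that are
  compatible with restriction.
\<close>

definition sheafify_map :: "('x, 'a) superspace \<Rightarrow> ('x, 'a, 'm) msheaf \<Rightarrow> ('x set \<Rightarrow> 'm \<Rightarrow> 'm)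
    \<Rightarrow> 'x set \<Rightarrow> ('x \<Rightarrow> ('x set \<times> 'm) set) \<Rightarrow> ('x \<Rightarrow> ('x set \<times> 'm) set)" where
  "sheafify_map \<X> P u U w =
     (\<lambda>x\<in>U. \<Union>(V, t)\<in>w x. pgerm \<X> P x (U \<inter> V) (u (U \<inter> V) (mres P V (U \<inter> V) t)))"

definition sheafify_sections :: "('x, 'a) superspace \<Rightarrow> ('x, 'a, 'm) msheaf
    \<Rightarrow> 'x set \<Rightarrow> ('x \<Rightarrow> ('x set \<times> 'm) set) set" where
  "sheafify_sections \<X> P U = {w \<in> extensional U.
     \<forall>x\<in>U. \<exists>V t. openin (topo \<X>) V \<and> x \<in> V \<and> V \<subseteq> U \<and> t \<in> carrier (msec P V) \<and>
       (\<forall>y\<in>V. w y = pgerm \<X> P y V t)}"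

definition sheafify :: "('x, 'a) superspace \<Rightarrow> ('x, 'a, 'm) msheaf
    \<Rightarrow> ('x, 'a, 'x \<Rightarrow> ('x set \<times> 'm) set) msheaf" where
  "sheafify \<X> P =
     \<lparr>msec = (\<lambda>U.
        \<lparr>carrier = sheafify_sections \<X> P U,
         monoid.mult = undefined, monoid.one = undefined,
         ring.zero = (\<lambda>x\<in>U. pgerm \<X> P x U \<zero>\<^bsub>msec P U\<^esub>),
         ring.add = (\<lambda>w v. \<lambda>x\<in>U. germ_binop (topo \<X>) (\<lambda>V. carrier (msec P V)) (mres P) x
                  (\<lambda>V. (\<oplus>\<^bsub>msec P V\<^esub>)) (w x) (v x)),
         module.smult = (\<lambda>f. sheafify_map \<X> P (\<lambda>V t. res \<X> U V f \<odot>\<^bsub>msec P V\<^esub> t) U),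
         mgrade = (\<lambda>d. {w \<in> sheafify_sections \<X> P U. \<forall>x\<in>U. w x \<in>
                    germs_at (topo \<X>) (\<lambda>V. carrier (msec P V)) (mres P) (\<lambda>V. mgrade (msec P V) d) x})\<rparr>),
      mres = (\<lambda>U V w. restrict w V)\<rparr>"

definition tensor_presheaf :: "('x, 'a) superspace \<Rightarrow> ('x, 'a, 'm) msheaf \<Rightarrow> ('x, 'a, 'n) msheaf
    \<Rightarrow> ('x, 'a, ('m \<times> 'n \<Rightarrow>\<^sub>0 int) set) msheaf" where
  "tensor_presheaf \<X> S S' =
     \<lparr>msec = (\<lambda>U. tensor_module (sec \<X> U) (msec S U) (msec S' U)),
      mres = (\<lambda>U V. tensor_map (sec \<X> U) (msec S U) (msec S' U) (sec \<X> V) (msec S V) (msec S' V)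
                (mres S U V) (mres S' U V))\<rparr>"

definition tensor_sheaf :: "('x, 'a) superspace \<Rightarrow> ('x, 'a, 'm) msheaf \<Rightarrow> ('x, 'a, 'n) msheaf
    \<Rightarrow> ('x, 'a, 'x \<Rightarrow> ('x set \<times> ('m \<times> 'n \<Rightarrow>\<^sub>0 int) set) set) msheaf" where
  "tensor_sheaf \<X> S S' = sheafify \<X> (tensor_presheaf \<X> S S')"

text \<open>The operator \<open>s \<otimes> s' \<mapsto> g s \<otimes> h s'\<close> on \<open>(S \<otimes> S')(U)\<close>, without sign.\<close>

definition tensor_op where
  "tensor_op \<X> S S' g h = sheafify_map \<X> (tensor_presheaf \<X> S S')
     (\<lambda>V. tensor_map (sec \<X> V) (msec S V) (msec S' V) (sec \<X> V) (msec S V) (msec S' V) (g V) (h V))"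

definition tensor_endo :: "('x, 'a) superspace \<Rightarrow> ('x, 'a, 'm) msheaf \<Rightarrow> ('x, 'a, 'n) msheaf
    \<Rightarrow> ('x set \<Rightarrow> 'm \<Rightarrow> 'm) \<Rightarrow> ('x set \<Rightarrow> 'n \<Rightarrow> 'n) \<Rightarrow> 'x set
    \<Rightarrow> ('x \<Rightarrow> ('x set \<times> ('m \<times> 'n \<Rightarrow>\<^sub>0 int) set) set)
    \<Rightarrow> ('x \<Rightarrow> ('x set \<times> ('m \<times> 'n \<Rightarrow>\<^sub>0 int) set) set)" where
  "tensor_endo \<X> S S' \<phi> \<phi>' =
     tensor_op \<X> S S' (\<lambda>V s. \<phi> V (twist (msec S V) (mgrade (msec S V)) s)) \<phi>'"

text \<open>For a global function \<open>\<lambda>\<close>, the sections \<open>w\<close> with \<open>\<Phi>(w) = \<lambda> w\<close>.\<close>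

definition eigensheaf :: "('x, 'a) superspace \<Rightarrow> ('x, 'a, 'p) msheaf \<Rightarrow> ('x set \<Rightarrow> 'p \<Rightarrow> 'p)
    \<Rightarrow> 'a \<Rightarrow> 'x set \<Rightarrow> 'p set" where
  "eigensheaf \<X> P \<Phi> l U =
     {w \<in> carrier (msec P U). \<Phi> U w = res \<X> (topspace (topo \<X>)) U l \<odot>\<^bsub>msec P U\<^esub> w}"


section \<open>The sheaf of superalgebras \<open>D \<otimes>\<^sub>k O\<^sub>\<X>\<close> and its opposite\<close>

text \<open>
  \<open>D = k[\<theta>]\<close> is free over \<open>k\<close> on \<open>1, \<theta>\<close>. So for a \<open>k\<close>-superalgebra \<open>A\<close>, the tensor product
  \<open>D \<otimes>\<^sub>k A\<close> is \<open>A \<oplus> \<theta> A\<close>, where the pair \<open>(f, g)\<close> stands for \<open>1 \<otimes> f + \<theta> \<otimes> g\<close>. The product comes from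
  \<open>(d \<otimes> f)(d' \<otimes> f') = (-1)\<^bsup>|f||d'|\<^esup> dd' \<otimes> ff'\<close> and \<open>\<theta>\<^sup>2 = -1\<close>. In particular \<open>D\<close> itself is the case \<open>A = k\<close>.
\<close>

definition adjoin_theta :: "'a superring \<Rightarrow> ('a \<times> 'a) superring" where
  "adjoin_theta A =
     \<lparr>carrier = carrier A \<times> carrier A,
      monoid.mult = (\<lambda>(f, g) (f', g').
        (f \<otimes>\<^bsub>A\<^esub> f' \<ominus>\<^bsub>A\<^esub> twist A (grade A) g \<otimes>\<^bsub>A\<^esub> g', twist A (grade A) f \<otimes>\<^bsub>A\<^esub> g' \<oplus>\<^bsub>A\<^esub> g \<otimes>\<^bsub>A\<^esub> f')),
      monoid.one = (\<one>\<^bsub>A\<^esub>, \<zero>\<^bsub>A\<^esub>),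
      ring.zero = (\<zero>\<^bsub>A\<^esub>, \<zero>\<^bsub>A\<^esub>),
      ring.add = (\<lambda>(f, g) (f', g'). (f \<oplus>\<^bsub>A\<^esub> f', g \<oplus>\<^bsub>A\<^esub> g')),
      grade = (\<lambda>i. grade A i \<times> grade A (i + 1))\<rparr>"

text \<open>The biadditive extension of \<open>a \<cdot>\<^sub>o b = (-1)\<^bsup>|a||b|\<^esup> b a\<close>.\<close>

definition opposite :: "'a superring \<Rightarrow> 'a superring" where
  "opposite A = A\<lparr>monoid.mult := (\<lambda>a b.
     b \<otimes>\<^bsub>A\<^esub> hpart A (grade A) 0 a \<oplus>\<^bsub>A\<^esub> twist A (grade A) b \<otimes>\<^bsub>A\<^esub> hpart A (grade A) 1 a)\<rparr>"

definition D_sheaf :: "('x, 'a) superspace \<Rightarrow> ('x, 'a \<times> 'a) superspace" where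
  "D_sheaf \<X> = \<lparr>topo = topo \<X>, sec = (\<lambda>U. adjoin_theta (sec \<X> U)),
     res = (\<lambda>U V (f, g). (res \<X> U V f, res \<X> U V g))\<rparr>"

definition D_op_sheaf :: "('x, 'a) superspace \<Rightarrow> ('x, 'a \<times> 'a) superspace" where
  "D_op_sheaf \<X> = (D_sheaf \<X>)\<lparr>sec := (\<lambda>U. opposite (adjoin_theta (sec \<X> U)))\<rparr>"

text \<open>
  The left action with \<open>\<theta> \<cdot> s = \<chi>(s)\<close> and the right action with \<open>s \<cdot> \<theta> = (-1)\<^bsup>|s|\<^esup> \<chi>(s)\<close>. In the opposite
  algebra too, \<open>1 \<otimes> f + \<theta> \<otimes> g\<close> equals \<open>f + \<theta> \<cdot>\<^sub>o g\<close>, so the same formulas give the actions of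
  \<open>D \<otimes>\<^sub>k O\<^sub>\<X>\<close> and of its opposite; which of the two acts depends only on \<open>\<chi>\<^sup>2\<close>.
\<close>

definition left_action :: "('x, 'a, 'm) msheaf \<Rightarrow> ('x set \<Rightarrow> 'm \<Rightarrow> 'm) \<Rightarrow> 'x set \<Rightarrow> 'a \<times> 'a \<Rightarrow> 'm \<Rightarrow> 'm"
  where "left_action S \<chi> U a s =
    (case a of (f, g) \<Rightarrow> f \<odot>\<^bsub>msec S U\<^esub> s \<oplus>\<^bsub>msec S U\<^esub> \<chi> U (g \<odot>\<^bsub>msec S U\<^esub> s))"

definition right_action :: "('x, 'a) superspace \<Rightarrow> ('x, 'a, 'm) msheaf \<Rightarrow> ('x set \<Rightarrow> 'm \<Rightarrow> 'm)
    \<Rightarrow> 'x set \<Rightarrow> 'm \<Rightarrow> 'a \<times> 'a \<Rightarrow> 'm" where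
  "right_action \<X> S \<chi> U s a =
    (case a of (f, g) \<Rightarrow> rsmult (sec \<X> U) (msec S U) s f \<oplus>\<^bsub>msec S U\<^esub>
       rsmult (sec \<X> U) (msec S U) (\<chi> U (twist (msec S U) (mgrade (msec S U)) s)) g)"

definition tensor_left_action where
  "tensor_left_action \<X> S S' \<chi> U a =
     tensor_op \<X> S S' (\<lambda>V. left_action S \<chi> V (res (D_sheaf \<X>) U V a)) (\<lambda>V s'. s') U"

definition tensor_right_action where
  "tensor_right_action \<X> S S' \<chi> U w a =
     tensor_op \<X> S S' (\<lambda>V s. s) (\<lambda>V s'. right_action \<X> S' \<chi> V s' (res (D_sheaf \<X>) U V a)) U w"


section \<open>Supercommutants and the two products\<close>

definition submodule_sheaf ::
    "('x, 'a) superspace \<Rightarrow> ('x, 'a, 'p) msheaf \<Rightarrow> ('x set \<Rightarrow> 'p set) \<Rightarrow> bool" where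
  "submodule_sheaf \<X> P N \<longleftrightarrow>
     (\<forall>U. openin (topo \<X>) U \<longrightarrow> submodule (N U) (sec \<X> U) (msec P U)) \<and>
     (\<forall>U V. openin (topo \<X>) U \<and> openin (topo \<X>) V \<and> V \<subseteq> U \<longrightarrow> mres P U V ` N U \<subseteq> N V) \<and>
     (\<forall>\<V>. (\<forall>V\<in>\<V>. openin (topo \<X>) V) \<longrightarrow>
        (\<forall>p\<in>carrier (msec P (\<Union>\<V>)). (\<forall>V\<in>\<V>. mres P (\<Union>\<V>) V p \<in> N V) \<longrightarrow> p \<in> N (\<Union>\<V>)))"

definition generated_submodule_sheaf ::
    "('x, 'a) superspace \<Rightarrow> ('x, 'a, 'p) msheaf \<Rightarrow> ('x set \<Rightarrow> 'p set) \<Rightarrow> 'x set \<Rightarrow> 'p set" where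
  "generated_submodule_sheaf \<X> P G U =
     \<Inter>{N U | N. submodule_sheaf \<X> P N \<and> (\<forall>V. openin (topo \<X>) V \<longrightarrow> G V \<subseteq> N V)}"

text \<open>The homogeneous \<open>p\<close> over \<open>U\<close> with \<open>a p = (-1)\<^bsup>|a||p|\<^esup> p a\<close> for all homogeneous local sections \<open>a\<close>.\<close>

definition supercommuting :: "('x, 'b) superspace \<Rightarrow> ('x, 'a, 'p) msheaf
    \<Rightarrow> ('x set \<Rightarrow> 'b \<Rightarrow> 'p \<Rightarrow> 'p) \<Rightarrow> ('x set \<Rightarrow> 'p \<Rightarrow> 'b \<Rightarrow> 'p) \<Rightarrow> 'x set \<Rightarrow> 'p set" where
  "supercommuting \<A> P la ra U = {p. \<exists>d. p \<in> mgrade (msec P U) d \<and>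
     (\<forall>V. openin (topo \<A>) V \<and> V \<subseteq> U \<longrightarrow> (\<forall>e. \<forall>a\<in>grade (sec \<A> V) e.
        la V a (mres P U V p) = ksign (msec P V) (e * d) (ra V (mres P U V p) a)))}"

definition supercommutant :: "('x, 'a) superspace \<Rightarrow> ('x, 'b) superspace \<Rightarrow> ('x, 'a, 'p) msheaf
    \<Rightarrow> ('x set \<Rightarrow> 'b \<Rightarrow> 'p \<Rightarrow> 'p) \<Rightarrow> ('x set \<Rightarrow> 'p \<Rightarrow> 'b \<Rightarrow> 'p) \<Rightarrow> 'x set \<Rightarrow> 'p set" where
  "supercommutant \<X> \<A> P la ra = generated_submodule_sheaf \<X> P (supercommuting \<A> P la ra)"

definition scaled_endo :: "('x, 'a) superspace \<Rightarrow> ('x, 'a, 'm) msheaf \<Rightarrow> 'a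
    \<Rightarrow> ('x set \<Rightarrow> 'm \<Rightarrow> 'm) \<Rightarrow> 'x set \<Rightarrow> 'm \<Rightarrow> 'm" where
  "scaled_endo \<X> S l \<phi> U s = res \<X> (topspace (topo \<X>)) U l \<odot>\<^bsub>msec S U\<^esub> \<phi> U s"

text \<open>In both products, \<open>j\<close> is the image of the chosen square root of \<open>-1\<close> in the global functions on \<open>\<X>\<close>.\<close>

definition box_product where
  "box_product \<X> j S \<phi> S' \<phi>' =
     supercommutant \<X> (D_sheaf \<X>) (tensor_sheaf \<X> S S')
       (tensor_left_action \<X> S S' (scaled_endo \<X> S j \<phi>))
       (tensor_right_action \<X> S S' \<phi>')"

definition box_product_o where
  "box_product_o \<X> j S \<phi> S' \<phi>' =
     supercommutant \<X> (D_op_sheaf \<X>) (tensor_sheaf \<X> S S')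
       (tensor_left_action \<X> S S' \<phi>)
       (tensor_right_action \<X> S S' (scaled_endo \<X> S' j \<phi>'))"

end

theory Submission
  imports Defs
begin

text \<open>
  Let \<open>\<psi>\<close> and \<open>\<psi>'\<close> be odd endomorphisms of \<open>S\<close> and \<open>S'\<close>, let \<open>\<tau>\<close> be the operator \<open>(-1)\<^sup>d\<close> on elements of
  degree \<open>d\<close>, and let \<open>\<theta>\<close> act on \<open>S \<otimes> S'\<close> on the left through \<open>\<psi>\<close> and on the right through \<open>\<psi>'\<close>. A section
  of \<open>\<O>\<close> can be moved from the right of \<open>S \<otimes> S'\<close> to the left with the usual sign, so every homogeneous
  section supercommutes with \<open>\<O>\<close>. It supercommutes with \<open>\<theta>\<close> if and only if the operators
  \<open>A = \<psi> \<otimes> 1\<close> and \<open>B = \<tau> \<otimes> \<psi>'\<close> agree on it: the sign \<open>(-1)\<^sup>d\<close> in the definition of the supercommutant and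
  the sign in \<open>s' \<theta> = (-1)\<^bsup>|s'|\<^esup> \<psi>'(s')\<close> combine to \<open>(-1)\<^bsup>|s|\<^esup>\<close> on \<open>s \<otimes> s'\<close>
  (lemma \<open>homogeneous_supercommutes_iff\<close>).

  The sections on which \<open>A\<close> and \<open>B\<close> agree form a sheaf of submodules, since \<open>A\<close> and \<open>B\<close> are semilinear over the
  same sign automorphism of \<open>\<O>\<close>. Both anticommute with \<open>T = \<tau> \<otimes> \<tau>\<close>, so this sheaf is stable under \<open>T\<close>. As
  \<open>2\<close> is invertible, it contains the homogeneous parts \<open>(w \<plusminus> T w)/2\<close> of each of its sections \<open>w\<close>. Hence the
  supercommutant, which its homogeneous sections generate, is all of it (theorem
  \<open>supercommutant_eq_equalizer\<close>).

  For \<open>\<Pi>\<close>-invertible sheaves, \<open>A = \<phi> \<otimes> 1\<close> is an involution and \<open>A B = \<phi> \<otimes> \<phi>'\<close>. Applying \<open>A\<close> turns the equations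
  \<open>\<surd>-1 A w = B w\<close> and \<open>A w = \<surd>-1 B w\<close> of the two products into the two eigenvalue equations
  (theorem \<open>box_products_eq_eigensheaves\<close>).

  Each operator is a map of tensor products, well defined by semilinearity of its factors
  (\<open>tensor_map_class\<close>). Identities between operators are verified on pure tensors (\<open>additive_eqI\<close>), first in the
  tensor product presheaf and then, through local representatives, on sections of its sheafification
  (\<open>sections_eqI_rep\<close>).
\<close>

section \<open>Graded abelian groups\<close>

lemma bit_add_self [simp]: "i + i = (0::bit)" "i + (i + j) = (j::bit)"
  by (cases i; cases j; simp)+

locale graded_group = abelian_group G for G :: "('m, 'r) ring_scheme" (structure) +
  fixes gr :: "bit \<Rightarrow> 'm set"
  assumes z2_graded: "z2_graded G gr"
begin

lemma gr_subgroup: "subgroup (gr i) (add_monoid G)"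
  using z2_graded by (simp add: z2_graded_def)

lemma gr_closed: "x \<in> gr i \<Longrightarrow> x \<in> carrier G"
  using subgroup.subset[OF gr_subgroup] by auto

lemma gr_zero: "\<zero> \<in> gr i"
  using subgroup.one_closed[OF gr_subgroup] by simp

lemma gr_add: "x \<in> gr i \<Longrightarrow> y \<in> gr i \<Longrightarrow> x \<oplus> y \<in> gr i"
  using subgroup.m_closed[OF gr_subgroup] by simp

lemma gr_minus: "x \<in> gr i \<Longrightarrow> \<ominus> x \<in> gr i"
  using subgroup.m_inv_closed[OF gr_subgroup] by (simp add: a_inv_def)

lemma ksign_closed: "x \<in> carrier G \<Longrightarrow> ksign G e x \<in> carrier G"
  by (simp add: ksign_def)

lemma ksign_gr: "x \<in> gr i \<Longrightarrow> ksign G e x \<in> gr i"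
  by (simp add: ksign_def gr_minus)

lemma decompose:
  assumes "x \<in> carrier G"
  obtains y z where "y \<in> gr 0" "z \<in> gr 1" "x = y \<oplus> z"
proof -
  from assms z2_graded have "\<exists>!p. case p of (y, z) \<Rightarrow> y \<in> gr 0 \<and> z \<in> gr 1 \<and> x = y \<oplus> z"
    by (simp add: z2_graded_def)
  from ex1_implies_ex[OF this] show ?thesis using that by fastforce
qed

lemma decompose_unique:
  assumes "y \<in> gr 0" "z \<in> gr 1" "y' \<in> gr 0" "z' \<in> gr 1" "y \<oplus> z = y' \<oplus> z'"
  shows "y = y'" "z = z'"
proof -
  have "y \<oplus> z \<in> carrier G" using assms gr_closed by auto
  with z2_graded have "\<exists>!p. case p of (u, v) \<Rightarrow> u \<in> gr 0 \<and> v \<in> gr 1 \<and> y \<oplus> z = u \<oplus> v"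
    by (simp add: z2_graded_def)
  then obtain p where "\<forall>q. (case q of (u, v) \<Rightarrow> u \<in> gr 0 \<and> v \<in> gr 1 \<and> y \<oplus> z = u \<oplus> v) \<longrightarrow> q = p"
    by (elim ex1E) blast
  from this[rule_format, of "(y, z)"] this[rule_format, of "(y', z')"]
  have "(y, z) = (y', z')"
    using assms by simp
  then show "y = y'" "z = z'" by auto
qed

lemma hpart_sum:
  assumes y: "y \<in> gr 0" and z: "z \<in> gr 1"
  shows "hpart G gr 0 (y \<oplus> z) = y" and "hpart G gr 1 (y \<oplus> z) = z"
proof -
  show "hpart G gr 0 (y \<oplus> z) = y"
    unfolding hpart_def
  proof (rule the_equality)
    show "y \<in> gr 0 \<and> (\<exists>v\<in>gr (0 + 1). y \<oplus> z = y \<oplus> v)" using y z by auto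
  next
    fix u assume "u \<in> gr 0 \<and> (\<exists>v\<in>gr (0 + 1). y \<oplus> z = u \<oplus> v)"
    then obtain v where "u \<in> gr 0" "v \<in> gr 1" "y \<oplus> z = u \<oplus> v" by auto
    then show "u = y" using decompose_unique(1)[OF y z] by simp
  qed
  show "hpart G gr 1 (y \<oplus> z) = z"
    unfolding hpart_def
  proof (rule the_equality)
    show "z \<in> gr 1 \<and> (\<exists>v\<in>gr (1 + 1). y \<oplus> z = z \<oplus> v)"
      using y z gr_closed[OF y] gr_closed[OF z] by (auto intro: a_comm)
  next
    fix u assume "u \<in> gr 1 \<and> (\<exists>v\<in>gr (1 + 1). y \<oplus> z = u \<oplus> v)"
    then obtain v where uv: "u \<in> gr 1" "v \<in> gr 0" "y \<oplus> z = u \<oplus> v" by auto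
    then have "y \<oplus> z = v \<oplus> u" using gr_closed[OF uv(1)] gr_closed[OF uv(2)] by (simp add: a_comm)
    then show "u = z" using decompose_unique(2)[OF y z uv(2,1)] by simp
  qed
qed

lemma hpart_closed: "x \<in> carrier G \<Longrightarrow> hpart G gr i x \<in> gr i"
  by (erule decompose) (cases i; simp add: hpart_sum)

lemma hpart_homogeneous:
  assumes "x \<in> gr i" shows "hpart G gr j x = (if i = j then x else \<zero>)"
  using hpart_sum[of x \<zero>] hpart_sum[of \<zero> x] gr_zero assms gr_closed[OF assms]
  by (cases i; cases j; simp)

lemma hpart_add:
  assumes "x \<in> carrier G" "y \<in> carrier G"
  shows "hpart G gr i (x \<oplus> y) = hpart G gr i x \<oplus> hpart G gr i y"
proof -
  from assms(1) obtain a b where a: "a \<in> gr 0" "b \<in> gr 1" "x = a \<oplus> b" by (rule decompose)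
  from assms(2) obtain c d where c: "c \<in> gr 0" "d \<in> gr 1" "y = c \<oplus> d" by (rule decompose)
  have "x \<oplus> y = (a \<oplus> c) \<oplus> (b \<oplus> d)" using a c by (simp add: gr_closed a_ac)
  then show ?thesis using a c by (cases i; simp add: hpart_sum gr_add)
qed

lemma twist_sum:
  assumes "y \<in> gr 0" "z \<in> gr 1"
  shows "twist G gr (y \<oplus> z) = y \<ominus> z"
  using assms by (simp add: twist_def hpart_sum ksign_def a_minus_def)

lemma twist_homogeneous: "x \<in> gr i \<Longrightarrow> twist G gr x = ksign G i x"
  by (cases i) (simp_all add: twist_def hpart_homogeneous ksign_def gr_closed)

lemma twist_closed: "x \<in> carrier G \<Longrightarrow> twist G gr x \<in> carrier G"
  by (erule decompose) (simp add: twist_sum gr_closed)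

lemma twist_gr: "x \<in> gr i \<Longrightarrow> twist G gr x \<in> gr i"
  by (simp add: twist_homogeneous ksign_gr)

lemma twist_add:
  assumes "x \<in> carrier G" "y \<in> carrier G"
  shows "twist G gr (x \<oplus> y) = twist G gr x \<oplus> twist G gr y"
  using assms gr_closed[OF hpart_closed]
  by (simp add: twist_def hpart_add ksign_def minus_add a_ac)

lemma twist_minus:
  assumes "x \<in> carrier G" shows "twist G gr (\<ominus> x) = \<ominus> twist G gr x"
proof -
  have "twist G gr (\<ominus> x) \<oplus> twist G gr x = twist G gr \<zero>"
    using assms by (simp add: l_neg flip: twist_add)
  then show ?thesis
    using assms by (simp add: minus_equality twist_closed twist_homogeneous[OF gr_zero[of 0]] ksign_def)
qed

lemma twist_twist: "x \<in> carrier G \<Longrightarrow> twist G gr (twist G gr x) = x"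
  by (erule decompose)
    (simp add: twist_sum twist_add twist_minus gr_closed a_minus_def twist_homogeneous ksign_def)

lemma graded_induct [consumes 1, case_names homogeneous add]:
  assumes "x \<in> carrier G"
    and "\<And>i x. x \<in> gr i \<Longrightarrow> P x"
    and "\<And>x y. \<lbrakk>x \<in> carrier G; y \<in> carrier G; P x; P y\<rbrakk> \<Longrightarrow> P (x \<oplus> y)"
  shows "P x"
proof -
  from assms(1) obtain y z where "y \<in> gr 0" "z \<in> gr 1" "x = y \<oplus> z" by (rule decompose)
  then show ?thesis using assms(2)[of y] assms(2)[of z] assms(3)[of y z] gr_closed by auto
qed

end

definition additive_map :: "('m, 'r) ring_scheme \<Rightarrow> ('n, 's) ring_scheme \<Rightarrow> ('m \<Rightarrow> 'n) \<Rightarrow> bool" where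
  "additive_map G H F \<longleftrightarrow> F \<in> carrier G \<rightarrow> carrier H \<and>
     (\<forall>x\<in>carrier G. \<forall>y\<in>carrier G. F (x \<oplus>\<^bsub>G\<^esub> y) = F x \<oplus>\<^bsub>H\<^esub> F y)"

lemma additive_map_closed: "additive_map G H F \<Longrightarrow> x \<in> carrier G \<Longrightarrow> F x \<in> carrier H"
  by (auto simp: additive_map_def)

lemma additive_map_add:
  "\<lbrakk>additive_map G H F; x \<in> carrier G; y \<in> carrier G\<rbrakk> \<Longrightarrow> F (x \<oplus>\<^bsub>G\<^esub> y) = F x \<oplus>\<^bsub>H\<^esub> F y"
  by (auto simp: additive_map_def)

lemma additive_map_comp:
  assumes "additive_map G H F" "additive_map H K F'" shows "additive_map G K (\<lambda>x. F' (F x))"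
  unfolding additive_map_def
  using additive_map_closed[OF assms(1)] additive_map_closed[OF assms(2)]
  by (simp add: additive_map_add[OF assms(1)] additive_map_add[OF assms(2)])

lemma additive_map_zero:
  assumes "abelian_group G" "abelian_group H" "additive_map G H F"
  shows "F \<zero>\<^bsub>G\<^esub> = \<zero>\<^bsub>H\<^esub>"
proof -
  interpret G: abelian_group G by fact
  interpret H: abelian_group H by fact
  have "F \<zero>\<^bsub>G\<^esub> \<oplus>\<^bsub>H\<^esub> F \<zero>\<^bsub>G\<^esub> = F \<zero>\<^bsub>G\<^esub>"
    using additive_map_add[OF assms(3) G.zero_closed G.zero_closed, symmetric] by (simp only: G.l_zero G.zero_closed)
  then show ?thesis using additive_map_closed[OF assms(3) G.zero_closed]
    by (metis H.add.r_cancel_one)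
qed

lemma additive_map_minus:
  assumes "abelian_group G" "abelian_group H" "additive_map G H F" "x \<in> carrier G"
  shows "F (\<ominus>\<^bsub>G\<^esub> x) = \<ominus>\<^bsub>H\<^esub> F x"
proof -
  interpret G: abelian_group G by fact
  interpret H: abelian_group H by fact
  have "F (\<ominus>\<^bsub>G\<^esub> x) \<oplus>\<^bsub>H\<^esub> F x = \<zero>\<^bsub>H\<^esub>"
    using additive_map_add[OF assms(3), of "\<ominus>\<^bsub>G\<^esub> x" x] additive_map_zero[OF assms(1-3)] assms(4)
    by (simp add: G.l_neg)
  then show ?thesis using additive_map_closed[OF assms(3)] assms(4)
    by (simp add: H.minus_equality)
qed

lemma additive_map_ksign:
  assumes "abelian_group G" "abelian_group H" "additive_map G H F" "x \<in> carrier G"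
  shows "F (ksign G e x) = ksign H e (F x)"
  using additive_map_minus[OF assms] by (simp add: ksign_def)

lemma additive_map_hpart:
  assumes "graded_group G gr" "graded_group H gr'" "additive_map G H F"
    and gr: "\<And>i. F ` gr i \<subseteq> gr' i" and x: "x \<in> carrier G"
  shows "hpart H gr' i (F x) = F (hpart G gr i x)"
proof -
  interpret G: graded_group G gr by fact
  interpret H: graded_group H gr' by fact
  from x obtain y z where yz: "y \<in> gr 0" "z \<in> gr 1" "x = y \<oplus>\<^bsub>G\<^esub> z" by (rule G.decompose)
  have "F y \<in> gr' 0" "F z \<in> gr' 1" using gr yz by blast+
  then show ?thesis
    using yz additive_map_add[OF assms(3) G.gr_closed G.gr_closed, OF yz(1,2)]
    by (cases i) (simp_all add: G.hpart_sum H.hpart_sum)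
qed

lemma additive_map_twist:
  assumes "graded_group G gr" "graded_group H gr'" "additive_map G H F"
    and gr: "\<And>i. F ` gr i \<subseteq> gr' i" and x: "x \<in> carrier G"
  shows "twist H gr' (F x) = F (twist G gr x)"
proof -
  interpret G: graded_group G gr by fact
  interpret H: graded_group H gr' by fact
  have "hpart G gr i x \<in> carrier G" for i using G.hpart_closed[OF x] by (rule G.gr_closed)
  then show ?thesis
    by (simp add: twist_def additive_map_hpart[OF assms] additive_map_add[OF assms(3)]
      additive_map_ksign[OF G.abelian_group_axioms H.abelian_group_axioms assms(3)] G.ksign_closed)
qed

section \<open>Supermodules and odd maps\<close>

sublocale superring \<subseteq> RG: graded_group R "grade R"
  by unfold_locales (rule graded)

sublocale super_module \<subseteq> MG: graded_group M "mgrade M"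
  by unfold_locales (rule M_graded)

context super_module
begin

lemma smult_additive: "a \<in> carrier R \<Longrightarrow> additive_map M M ((\<odot>\<^bsub>M\<^esub>) a)"
  by (auto simp: additive_map_def smult_closed smult_r_distr)

lemma smult_left_additive: "x \<in> carrier M \<Longrightarrow> additive_map R M (\<lambda>a. a \<odot>\<^bsub>M\<^esub> x)"
  by (auto simp: additive_map_def smult_closed smult_l_distr)

lemmas smult_r_minus = additive_map_minus[OF M.abelian_group_axioms M.abelian_group_axioms smult_additive]
lemmas smult_l_minus = additive_map_minus[OF R.abelian_group_axioms M.abelian_group_axioms smult_left_additive]
lemmas smult_l_zero = additive_map_zero[OF R.abelian_group_axioms M.abelian_group_axioms smult_left_additive]

lemma twist_smult:
  assumes a: "a \<in> carrier R" and x: "x \<in> carrier M"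
  shows "twist M (mgrade M) (a \<odot>\<^bsub>M\<^esub> x) = twist R (grade R) a \<odot>\<^bsub>M\<^esub> twist M (mgrade M) x"
  using a
proof (induction rule: RG.graded_induct)
  case (homogeneous i a)
  have a: "a \<in> carrier R" using homogeneous by (rule RG.gr_closed)
  show ?case using x
  proof (induction rule: MG.graded_induct)
    case h: (homogeneous j x)
    have x: "x \<in> carrier M" using h by (rule MG.gr_closed)
    show ?case using a x smult_grade[OF homogeneous h]
      by (cases i; cases j; simp add: MG.twist_homogeneous[OF h] MG.twist_homogeneous
          RG.twist_homogeneous[OF homogeneous] ksign_def smult_r_minus smult_l_minus smult_closed)
  next
    case (add x y)
    then show ?case using a
      by (simp add: smult_r_distr MG.twist_add smult_closed RG.twist_closed MG.twist_closed)
  qed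
next
  case (add a b)
  then show ?case using x
    by (simp add: smult_l_distr MG.twist_add RG.twist_add smult_closed RG.twist_closed MG.twist_closed)
qed

lemma rsmult_homogeneous:
  assumes "f \<in> grade R i" "x \<in> carrier M"
  shows "rsmult R M x f = f \<odot>\<^bsub>M\<^esub> (if i = 1 then twist M (mgrade M) x else x)"
  using assms RG.gr_closed[OF assms(1)]
  by (cases i) (simp_all add: rsmult_def RG.hpart_homogeneous smult_l_zero smult_closed MG.twist_closed)

lemma hpart_R_closed: "a \<in> carrier R \<Longrightarrow> hpart R (grade R) i a \<in> carrier R"
  using RG.gr_closed RG.hpart_closed by blast

lemma rsmult_closed: "f \<in> carrier R \<Longrightarrow> x \<in> carrier M \<Longrightarrow> rsmult R M x f \<in> carrier M"
  by (simp add: rsmult_def smult_closed MG.twist_closed hpart_R_closed)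

lemma rsmult_add_left:
  "\<lbrakk>f \<in> carrier R; x \<in> carrier M; y \<in> carrier M\<rbrakk> \<Longrightarrow>
    rsmult R M (x \<oplus>\<^bsub>M\<^esub> y) f = rsmult R M x f \<oplus>\<^bsub>M\<^esub> rsmult R M y f"
  by (simp add: rsmult_def smult_closed MG.twist_closed hpart_R_closed MG.twist_add
      smult_r_distr M.a_ac)

lemma rsmult_add_right:
  "\<lbrakk>f \<in> carrier R; g \<in> carrier R; x \<in> carrier M\<rbrakk> \<Longrightarrow>
    rsmult R M x (f \<oplus> g) = rsmult R M x f \<oplus>\<^bsub>M\<^esub> rsmult R M x g"
  by (simp add: rsmult_def smult_closed MG.twist_closed hpart_R_closed RG.hpart_add
      smult_l_distr M.a_ac)

lemma twist_rsmult:
  assumes f: "f \<in> carrier R" and x: "x \<in> carrier M"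
  shows "twist M (mgrade M) (rsmult R M x f) = rsmult R M (twist M (mgrade M) x) (twist R (grade R) f)"
  using f
proof (induction rule: RG.graded_induct)
  case (homogeneous i f)
  have "f \<in> carrier R" using homogeneous by (rule RG.gr_closed)
  then show ?case using x
    by (simp add: rsmult_homogeneous[OF homogeneous] rsmult_homogeneous[OF RG.twist_gr[OF homogeneous]]
        twist_smult MG.twist_closed)
next
  case (add f g)
  then show ?case using x
    by (simp add: rsmult_add_right RG.twist_add MG.twist_add rsmult_closed MG.twist_closed RG.twist_closed)
qed

lemma smult_commute_homogeneous:
  assumes "f \<in> grade R i" "g \<in> grade R j" "x \<in> carrier M"
  shows "f \<odot>\<^bsub>M\<^esub> (g \<odot>\<^bsub>M\<^esub> x) = ksign M (i * j) (g \<odot>\<^bsub>M\<^esub> (f \<odot>\<^bsub>M\<^esub> x))"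
proof -
  have c: "f \<in> carrier R" "g \<in> carrier R" using assms RG.gr_closed by auto
  then have "f \<odot>\<^bsub>M\<^esub> (g \<odot>\<^bsub>M\<^esub> x) = ksign R (i * j) (g \<otimes> f) \<odot>\<^bsub>M\<^esub> x"
    using assms supercomm[OF assms(1,2)] by (simp flip: smult_assoc)
  also have "\<dots> = ksign M (i * j) (g \<odot>\<^bsub>M\<^esub> (f \<odot>\<^bsub>M\<^esub> x))"
    using c assms by (simp add: ksign_def smult_l_minus smult_assoc)
  finally show ?thesis .
qed

text \<open>
  The two actions commute: moving \<open>f\<close> to the right of \<open>g x\<close> costs the sign \<open>(-1)\<^bsup>|f|(|g| + |x|)\<^esup>\<close>,
  of which supercommutativity of \<open>f\<close> and \<open>g\<close> absorbs the part \<open>(-1)\<^bsup>|f||g|\<^esup>\<close>.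
\<close>

lemma rsmult_smult:
  assumes f: "f \<in> carrier R" and g: "g \<in> carrier R" and x: "x \<in> carrier M"
  shows "rsmult R M (g \<odot>\<^bsub>M\<^esub> x) f = g \<odot>\<^bsub>M\<^esub> rsmult R M x f"
  using f
proof (induction rule: RG.graded_induct)
  case h: (homogeneous i f)
  have f: "f \<in> carrier R" using h by (rule RG.gr_closed)
  show ?case using g
  proof (induction rule: RG.graded_induct)
    case k: (homogeneous j g)
    have g: "g \<in> carrier R" using k by (rule RG.gr_closed)
    show ?case using f g x
      by (cases i; cases j) (simp_all add: rsmult_homogeneous[OF h] smult_closed MG.twist_closed
         twist_smult RG.twist_homogeneous[OF k] smult_commute_homogeneous[OF h k] ksign_def
         smult_l_minus smult_r_minus)
  next
    case (add a b)
    then show ?case using f x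
      by (simp add: smult_l_distr rsmult_add_left rsmult_closed smult_closed)
  qed
next
  case (add a b)
  then show ?case using g x
    by (simp add: smult_r_distr rsmult_add_right rsmult_closed smult_closed)
qed

end

definition odd_map :: "('a, 'r) superring_scheme \<Rightarrow> ('a, 'm, 's) supermodule_scheme \<Rightarrow> ('m \<Rightarrow> 'm) \<Rightarrow> bool"
  where "odd_map R M \<psi> \<longleftrightarrow> additive_map M M \<psi> \<and>
    (\<forall>i. \<forall>f\<in>grade R i. \<forall>s\<in>carrier M. \<psi> (f \<odot>\<^bsub>M\<^esub> s) = ksign M i (f \<odot>\<^bsub>M\<^esub> \<psi> s)) \<and>
    (\<forall>i. \<psi> ` mgrade M i \<subseteq> mgrade M (i + 1))"

context super_module
begin

lemma odd_map_smult:
  assumes "odd_map R M \<psi>" and f: "f \<in> carrier R" and x: "x \<in> carrier M"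
  shows "\<psi> (f \<odot>\<^bsub>M\<^esub> x) = twist R (grade R) f \<odot>\<^bsub>M\<^esub> \<psi> x"
proof -
  have ad: "additive_map M M \<psi>" using assms(1) by (simp add: odd_map_def)
  have cl: "\<psi> x \<in> carrier M" using ad x by (rule additive_map_closed)
  show ?thesis using f
  proof (induction rule: RG.graded_induct)
    case (homogeneous i f)
    then show ?case using assms(1) x cl RG.gr_closed[OF homogeneous]
      by (simp add: odd_map_def RG.twist_homogeneous ksign_def smult_l_minus)
  next
    case (add a b)
    then show ?case using x cl
      by (simp add: smult_l_distr additive_map_add[OF ad] smult_closed RG.twist_add RG.twist_closed)
  qed
qed

lemma odd_map_twist:
  assumes "odd_map R M \<psi>" and x: "x \<in> carrier M"
  shows "\<psi> (twist M (mgrade M) x) = \<ominus>\<^bsub>M\<^esub> twist M (mgrade M) (\<psi> x)"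
proof -
  have ad: "additive_map M M \<psi>" using assms(1) by (simp add: odd_map_def)
  note cl = additive_map_closed[OF ad]
  show ?thesis using x
  proof (induction rule: MG.graded_induct)
    case (homogeneous i x)
    then have "\<psi> x \<in> mgrade M (i + 1)" using assms(1) unfolding odd_map_def by blast
    from MG.twist_homogeneous[OF this] show ?case
      using MG.gr_closed[OF homogeneous] cl
      by (cases i) (simp_all add: MG.twist_homogeneous[OF homogeneous] ksign_def
        additive_map_minus[OF M.abelian_group_axioms M.abelian_group_axioms ad])
  next
    case (add a b)
    then show ?case
      by (simp add: MG.twist_add MG.twist_closed additive_map_add[OF ad] cl M.minus_add)
  qed
qed

text \<open>
  The Koszul sign from moving \<open>f\<close> past \<open>\<psi>\<close> cancels against the change of parity of \<open>x\<close> in the right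
  action. So odd maps are right linear without sign, and \<open>\<psi> \<otimes> 1\<close> respects the relation
  \<open>x f \<otimes> y = x \<otimes> f y\<close>.
\<close>

lemma odd_map_rsmult:
  assumes "odd_map R M \<psi>" and f: "f \<in> carrier R" and x: "x \<in> carrier M"
  shows "\<psi> (rsmult R M x f) = rsmult R M (\<psi> x) f"
proof -
  have ad: "additive_map M M \<psi>" using assms(1) by (simp add: odd_map_def)
  note cl = additive_map_closed[OF ad]
  show ?thesis using f
  proof (induction rule: RG.graded_induct)
    case (homogeneous i f)
    have f: "f \<in> carrier R" using homogeneous by (rule RG.gr_closed)
    then show ?case using x cl
      by (cases i) (simp_all add: rsmult_homogeneous[OF homogeneous] odd_map_smult[OF assms(1)]
        RG.twist_homogeneous[OF homogeneous] odd_map_twist[OF assms(1)] MG.twist_closed ksign_def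
        smult_l_minus smult_r_minus smult_closed)
  next
    case (add a b)
    then show ?case using x cl
      by (simp add: rsmult_add_right additive_map_add[OF ad] rsmult_closed)
  qed
qed

lemma odd_map_scale:
  assumes "odd_map R M \<psi>" and j: "j \<in> grade R 0"
  shows "odd_map R M (\<lambda>x. j \<odot>\<^bsub>M\<^esub> \<psi> x)"
proof -
  have jc: "j \<in> carrier R" using j by (rule RG.gr_closed)
  have ad: "additive_map M M \<psi>" using assms(1) by (simp add: odd_map_def)
  note cl = additive_map_closed[OF ad]
  have "j \<odot>\<^bsub>M\<^esub> \<psi> (f \<odot>\<^bsub>M\<^esub> s) = ksign M i (f \<odot>\<^bsub>M\<^esub> (j \<odot>\<^bsub>M\<^esub> \<psi> s))"
    if f: "f \<in> grade R i" and s: "s \<in> carrier M" for i f s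
  proof -
    have "\<psi> (f \<odot>\<^bsub>M\<^esub> s) = ksign M i (f \<odot>\<^bsub>M\<^esub> \<psi> s)"
      using assms(1) f s by (simp add: odd_map_def)
    moreover have "j \<odot>\<^bsub>M\<^esub> (f \<odot>\<^bsub>M\<^esub> \<psi> s) = f \<odot>\<^bsub>M\<^esub> (j \<odot>\<^bsub>M\<^esub> \<psi> s)"
      using smult_commute_homogeneous[OF j f cl[OF s]] by (simp add: ksign_def)
    ultimately show ?thesis
      using jc RG.gr_closed[OF f] cl[OF s] by (simp add: ksign_def smult_r_minus smult_closed)
  qed
  moreover have "j \<odot>\<^bsub>M\<^esub> \<psi> x \<in> mgrade M (i + 1)" if "x \<in> mgrade M i" for i x
  proof -
    have "\<psi> x \<in> mgrade M (i + 1)" using assms(1) that unfolding odd_map_def by blast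
    from smult_grade[OF j this] show ?thesis by simp
  qed
  moreover have "additive_map M M (\<lambda>x. j \<odot>\<^bsub>M\<^esub> \<psi> x)"
    using jc cl by (auto simp: additive_map_def smult_closed additive_map_add[OF ad] smult_r_distr)
  ultimately show ?thesis unfolding odd_map_def by blast
qed

end

section \<open>Tensor products and the maps between them\<close>

abbreviation pure where
  "pure R M N x y \<equiv> tensor_class R M N (frag_of (x, y))"

locale tensor_pair = S: super_module R M + N: super_module R N
  for R :: "('a, 'r) superring_scheme" and M :: "('a, 'm, 's) supermodule_scheme"
    and N :: "('a, 'n, 't) supermodule_scheme"
begin

abbreviation "T \<equiv> tensor_module R M N"
abbreviation "cls \<equiv> tensor_class R M N"
abbreviation "K \<equiv> tensor_kernel R M N"
abbreviation "free \<equiv> carrier (tensor_free M N)"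

lemma free_iff: "c \<in> free \<longleftrightarrow> Poly_Mapping.keys c \<subseteq> carrier M \<times> carrier N"
  by (simp add: tensor_free_def)

lemma free_zero: "0 \<in> free" and free_frag_of: "frag_of (x, y) \<in> free \<longleftrightarrow> x \<in> carrier M \<and> y \<in> carrier N"
  by (simp_all add: tensor_free_def)

lemma free_add: "c \<in> free \<Longrightarrow> d \<in> free \<Longrightarrow> c + d \<in> free"
  and free_diff: "c \<in> free \<Longrightarrow> d \<in> free \<Longrightarrow> c - d \<in> free"
  and free_minus: "c \<in> free \<Longrightarrow> - c \<in> free"
  using keys_add[of c d] keys_diff[of c d] keys_minus[of c] unfolding free_iff by auto

lemma free_comm_group: "comm_group (tensor_free M N)"
  by (simp add: tensor_free_def abelian_free_Abelian_group)

lemma relations_free: "tensor_relations R M N \<subseteq> free"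
  unfolding tensor_relations_def
  by (auto intro!: free_diff simp: free_frag_of S.rsmult_closed N.smult_closed)

lemma kernel_subgroup: "subgroup K (tensor_free M N)"
  unfolding tensor_kernel_def
  by (intro group.generate_is_subgroup relations_free comm_group.axioms(2) free_comm_group)

lemma kernel_normal: "normal K (tensor_free M N)"
  by (intro comm_group.subgroup_imp_normal free_comm_group kernel_subgroup)

lemma kernel_free: "c \<in> K \<Longrightarrow> c \<in> free"
  using subgroup.subset[OF kernel_subgroup] by auto

lemma kernel_zero: "0 \<in> K"
  using subgroup.one_closed[OF kernel_subgroup] by (simp add: tensor_free_def)

lemma kernel_add: "c \<in> K \<Longrightarrow> d \<in> K \<Longrightarrow> c + d \<in> K"
  using subgroup.m_closed[OF kernel_subgroup, of c d] by (simp add: tensor_free_def)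

lemma kernel_minus: "c \<in> K \<Longrightarrow> - c \<in> K"
  using subgroup.m_inv_closed[OF kernel_subgroup, of c] kernel_free[of c] by (simp add: tensor_free_def)

lemma mem_class: "d \<in> cls c \<longleftrightarrow> d - c \<in> K"
proof -
  have "d \<in> cls c \<longleftrightarrow> (\<exists>k\<in>K. d = k + c)"
    by (simp add: tensor_class_def r_coset_def tensor_free_def)
  also have "\<dots> \<longleftrightarrow> d - c \<in> K" by (force simp: algebra_simps)
  finally show ?thesis .
qed

lemma class_eqI: assumes "c - d \<in> K" shows "cls c = cls d"
proof -
  have "e - c \<in> K \<longleftrightarrow> e - d \<in> K" for e
    using kernel_add[OF assms, of "e - c"] kernel_add[OF kernel_minus[OF assms], of "e - d"]
    by (auto simp: algebra_simps)
  then show ?thesis by (auto simp: mem_class)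
qed

lemma carrier_tensor: "carrier T = cls ` free"
  by (auto simp: tensor_module_def FactGroup_def RCOSETS_def tensor_class_def)

lemma class_closed: "c \<in> free \<Longrightarrow> cls c \<in> carrier T"
  by (simp add: carrier_tensor)

lemma class_add: "c \<in> free \<Longrightarrow> d \<in> free \<Longrightarrow> cls c \<oplus>\<^bsub>T\<^esub> cls d = cls (c + d)"
  using normal.rcos_sum[OF kernel_normal, of c d]
  by (simp add: tensor_module_def FactGroup_def tensor_class_def) (simp add: tensor_free_def)

lemma class_zero: "\<zero>\<^bsub>T\<^esub> = cls 0"
  by (auto simp: tensor_module_def FactGroup_def mem_class)

lemma tensor_abelian_group: "abelian_group T"
proof (rule abelian_groupI)
  fix x assume "x \<in> carrier T"
  then obtain c where "c \<in> free" "x = cls c" by (auto simp: carrier_tensor)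
  then show "\<exists>y\<in>carrier T. y \<oplus>\<^bsub>T\<^esub> x = \<zero>\<^bsub>T\<^esub>"
    by (intro bexI[of _ "cls (- c)"]) (simp_all add: class_add class_zero free_minus class_closed)
qed (auto simp: carrier_tensor class_add class_zero free_add free_zero add_ac)

sublocale T: abelian_group T
  by (rule tensor_abelian_group)

lemma class_minus: "c \<in> free \<Longrightarrow> \<ominus>\<^bsub>T\<^esub> cls c = cls (- c)"
  by (rule T.minus_equality) (simp_all add: class_add class_zero free_minus class_closed)

lemma class_diff: "c \<in> free \<Longrightarrow> d \<in> free \<Longrightarrow> cls c \<ominus>\<^bsub>T\<^esub> cls d = cls (c - d)"
  by (simp add: a_minus_def class_minus class_add free_minus)

lemma pure_closed: "x \<in> carrier M \<Longrightarrow> y \<in> carrier N \<Longrightarrow> pure R M N x y \<in> carrier T"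
  by (simp add: class_closed free_frag_of)

lemma relation_class: "c - d \<in> tensor_relations R M N \<Longrightarrow> cls c = cls d"
  by (intro class_eqI) (simp add: tensor_kernel_def generate.incl)

lemma pure_add_left:
  assumes "x \<in> carrier M" "x' \<in> carrier M" "y \<in> carrier N"
  shows "pure R M N (x \<oplus>\<^bsub>M\<^esub> x') y = pure R M N x y \<oplus>\<^bsub>T\<^esub> pure R M N x' y"
proof -
  have "pure R M N (x \<oplus>\<^bsub>M\<^esub> x') y = cls (frag_of (x, y) + frag_of (x', y))"
    by (rule relation_class) (unfold tensor_relations_def diff_diff_eq[symmetric], use assms in blast)
  then show ?thesis using assms by (simp add: class_add free_frag_of)
qed

lemma pure_add_right:
  assumes "x \<in> carrier M" "y \<in> carrier N" "y' \<in> carrier N"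
  shows "pure R M N x (y \<oplus>\<^bsub>N\<^esub> y') = pure R M N x y \<oplus>\<^bsub>T\<^esub> pure R M N x y'"
proof -
  have "pure R M N x (y \<oplus>\<^bsub>N\<^esub> y') = cls (frag_of (x, y) + frag_of (x, y'))"
    by (rule relation_class) (unfold tensor_relations_def diff_diff_eq[symmetric], use assms in blast)
  then show ?thesis using assms by (simp add: class_add free_frag_of)
qed

lemma pure_balanced:
  assumes "x \<in> carrier M" "f \<in> carrier R" "y \<in> carrier N"
  shows "pure R M N (rsmult R M x f) y = pure R M N x (f \<odot>\<^bsub>N\<^esub> y)"
  by (rule relation_class) (unfold tensor_relations_def, use assms in blast)

lemma pure_left_additive: "y \<in> carrier N \<Longrightarrow> additive_map M T (\<lambda>x. pure R M N x y)"
  and pure_right_additive: "x \<in> carrier M \<Longrightarrow> additive_map N T (\<lambda>y. pure R M N x y)"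
  by (auto simp: additive_map_def pure_closed pure_add_left pure_add_right)

lemmas pure_minus_left = additive_map_minus[OF S.M.abelian_group_axioms T.abelian_group_axioms pure_left_additive]
lemmas pure_minus_right = additive_map_minus[OF N.M.abelian_group_axioms T.abelian_group_axioms pure_right_additive]
lemmas pure_zero_left = additive_map_zero[OF S.M.abelian_group_axioms T.abelian_group_axioms pure_left_additive]

lemma tensor_induct [consumes 1, case_names pure diff]:
  assumes "t \<in> carrier T"
    and pure: "\<And>x y. \<lbrakk>x \<in> carrier M; y \<in> carrier N\<rbrakk> \<Longrightarrow> P (pure R M N x y)"
    and diff: "\<And>s t. \<lbrakk>s \<in> carrier T; t \<in> carrier T; P s; P t\<rbrakk> \<Longrightarrow> P (s \<ominus>\<^bsub>T\<^esub> t)"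
  shows "P t"
proof -
  have 0: "P (cls 0)"
    using pure[OF S.M.zero_closed N.M.zero_closed] by (simp add: pure_zero_left flip: class_zero)
  obtain c where "c \<in> free" "t = cls c" using assms(1) by (auto simp: carrier_tensor)
  moreover have "P (cls c)" if "Poly_Mapping.keys c \<subseteq> carrier M \<times> carrier N" for c
    using that
  proof (induction rule: free_Abelian_group_induct[consumes 1, case_names zero sub of])
    case (sub c d)
    then show ?case using diff[of "cls c" "cls d"] by (simp add: class_diff free_iff class_closed)
  qed (use 0 pure in auto)
  ultimately show ?thesis by (simp add: free_iff)
qed

text \<open>
  The means by which identities between operators on a tensor product are reduced to pure tensors.
\<close>

lemma additive_eqI:
  assumes H: "abelian_group H" and F: "additive_map T H F" and F': "additive_map T H F'"
    and pure: "\<And>x y. \<lbrakk>x \<in> carrier M; y \<in> carrier N\<rbrakk> \<Longrightarrow> F (pure R M N x y) = F' (pure R M N x y)"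
    and t: "t \<in> carrier T"
  shows "F t = F' t"
  using t
proof (induction rule: tensor_induct)
  case (diff s t)
  then show ?case
    using additive_map_add[OF F, of s "\<ominus>\<^bsub>T\<^esub> t"] additive_map_add[OF F', of s "\<ominus>\<^bsub>T\<^esub> t"]
      additive_map_minus[OF T.abelian_group_axioms H F, of t] additive_map_minus[OF T.abelian_group_axioms H F', of t]
    by (simp add: a_minus_def)
qed (rule pure)

end

text \<open>
  If \<open>g\<close> and \<open>h\<close> are semilinear over the same \<open>\<sigma>\<close>, then \<open>x f \<otimes> y\<close> and \<open>x \<otimes> f y\<close> have the same image
  \<open>g x \<otimes> \<sigma>(f) h y\<close>. The map \<open>\<sigma>\<close> is the identity for left and right actions, the parity sign for
  the product of the two parity signs and for operators with an odd right factor, and the restriction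
  of functions for restriction maps.
\<close>

definition semilinear_pair where
  "semilinear_pair R M N R' M' N' \<sigma> g h \<longleftrightarrow>
     additive_map M M' g \<and> additive_map N N' h \<and>
     (\<forall>f\<in>carrier R. \<sigma> f \<in> carrier R' \<and>
       (\<forall>x\<in>carrier M. g (rsmult R M x f) = rsmult R' M' (g x) (\<sigma> f)) \<and>
       (\<forall>y\<in>carrier N. h (f \<odot>\<^bsub>N\<^esub> y) = \<sigma> f \<odot>\<^bsub>N'\<^esub> h y))"

locale tensor_hom = D: tensor_pair R M N + C: tensor_pair R' M' N'
  for R :: "('a, 'r) superring_scheme" and M :: "('a, 'm, 's) supermodule_scheme"
    and N :: "('a, 'n, 't) supermodule_scheme"
    and R' :: "('a1, 'r1) superring_scheme" and M' :: "('a1, 'm1, 's1) supermodule_scheme"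
    and N' :: "('a1, 'n1, 't1) supermodule_scheme" +
  fixes \<sigma> g h
  assumes semilinear: "semilinear_pair R M N R' M' N' \<sigma> g h"
begin

abbreviation "ext \<equiv> frag_extend (\<lambda>(x, y). frag_of (g x, h y))"

lemma g_closed: "x \<in> carrier M \<Longrightarrow> g x \<in> carrier M'"
  and g_add: "x \<in> carrier M \<Longrightarrow> x' \<in> carrier M \<Longrightarrow> g (x \<oplus>\<^bsub>M\<^esub> x') = g x \<oplus>\<^bsub>M'\<^esub> g x'"
  and h_closed: "y \<in> carrier N \<Longrightarrow> h y \<in> carrier N'"
  and h_add: "y \<in> carrier N \<Longrightarrow> y' \<in> carrier N \<Longrightarrow> h (y \<oplus>\<^bsub>N\<^esub> y') = h y \<oplus>\<^bsub>N'\<^esub> h y'"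
  using semilinear by (auto simp: semilinear_pair_def additive_map_def)

lemma ext_free:
  assumes "c \<in> D.free" shows "ext c \<in> C.free"
proof -
  have "Poly_Mapping.keys (case p of (x, y) \<Rightarrow> frag_of (g x, h y)) \<subseteq> carrier M' \<times> carrier N'"
    if "p \<in> Poly_Mapping.keys c" for p
  proof -
    obtain x y where p: "p = (x, y)" by (cases p)
    have "x \<in> carrier M" "y \<in> carrier N"
      using subsetD[OF assms[unfolded D.free_iff] that] unfolding p by blast+
    then show ?thesis unfolding p by (simp add: g_closed h_closed)
  qed
  then show ?thesis
    unfolding C.free_iff by (intro order.trans[OF keys_frag_extend] UN_least)
qed

lemma ext_relations:
  assumes "c \<in> tensor_relations R M N" shows "ext c \<in> tensor_relations R' M' N'"
proof -
  consider (left) x x' y where "x \<in> carrier M" "x' \<in> carrier M" "y \<in> carrier N"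
      "c = frag_of (x \<oplus>\<^bsub>M\<^esub> x', y) - frag_of (x, y) - frag_of (x', y)"
    | (right) x y y' where "x \<in> carrier M" "y \<in> carrier N" "y' \<in> carrier N"
      "c = frag_of (x, y \<oplus>\<^bsub>N\<^esub> y') - frag_of (x, y) - frag_of (x, y')"
    | (mid) x f y where "x \<in> carrier M" "f \<in> carrier R" "y \<in> carrier N"
      "c = frag_of (rsmult R M x f, y) - frag_of (x, f \<odot>\<^bsub>N\<^esub> y)"
    using assms unfolding tensor_relations_def by (elim UnE CollectE exE conjE)
  then show ?thesis
  proof cases
    case left
    then have "ext c = frag_of (g x \<oplus>\<^bsub>M'\<^esub> g x', h y) - frag_of (g x, h y) - frag_of (g x', h y)"
      by (simp add: frag_extend_diff g_add)
    moreover have "g x \<in> carrier M'" "g x' \<in> carrier M'" "h y \<in> carrier N'"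
      using left by (simp_all add: g_closed h_closed)
    ultimately show ?thesis unfolding tensor_relations_def by (rule_tac UnI1, rule_tac UnI1) blast
  next
    case right
    then have "ext c = frag_of (g x, h y \<oplus>\<^bsub>N'\<^esub> h y') - frag_of (g x, h y) - frag_of (g x, h y')"
      by (simp add: frag_extend_diff h_add)
    moreover have "g x \<in> carrier M'" "h y \<in> carrier N'" "h y' \<in> carrier N'"
      using right by (simp_all add: g_closed h_closed)
    ultimately show ?thesis unfolding tensor_relations_def by (rule_tac UnI1, rule_tac UnI2) blast
  next
    case mid
    then have "ext c = frag_of (rsmult R' M' (g x) (\<sigma> f), h y) - frag_of (g x, \<sigma> f \<odot>\<^bsub>N'\<^esub> h y)"
      and "\<sigma> f \<in> carrier R'"
      using semilinear by (simp_all add: frag_extend_diff semilinear_pair_def)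
    moreover have "g x \<in> carrier M'" "h y \<in> carrier N'"
      using mid by (simp_all add: g_closed h_closed)
    ultimately show ?thesis unfolding tensor_relations_def by (rule_tac UnI2) blast
  qed
qed

lemma ext_kernel: "c \<in> D.K \<Longrightarrow> ext c \<in> C.K"
  unfolding tensor_kernel_def[of R M N]
proof (induction rule: generate.induct)
  case one
  show ?case using C.kernel_zero by (simp add: tensor_free_def)
next
  case (incl c)
  then show ?case by (simp add: tensor_kernel_def generate.incl ext_relations)
next
  case (inv c)
  have "inv\<^bsub>tensor_free M N\<^esub> c = - c"
    using subsetD[OF D.relations_free inv] by (simp add: tensor_free_def)
  then show ?case using C.kernel_minus[of "ext c"] inv
    by (simp add: tensor_kernel_def generate.incl ext_relations frag_extend_minus)
next
  case (eng c d)
  then show ?case by (simp add: tensor_free_def frag_extend_add C.kernel_add)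
qed

text \<open>
  The union that defines \<open>tensor_map\<close> runs over equal cosets, because \<open>ext\<close> preserves the kernel.
\<close>

lemma tensor_map_class:
  assumes "c \<in> D.free"
  shows "tensor_map R M N R' M' N' g h (D.cls c) = C.cls (ext c)"
proof -
  have "C.cls (ext d) = C.cls (ext c)" if "d \<in> D.cls c" for d
    using ext_kernel[of "d - c"] that by (intro C.class_eqI) (simp add: D.mem_class frag_extend_diff)
  moreover have "c \<in> D.cls c" by (simp add: D.mem_class D.kernel_zero)
  ultimately show ?thesis
    unfolding tensor_map_def by (intro SUP_eq_const) blast+
qed

lemma tensor_map_pure:
  "x \<in> carrier M \<Longrightarrow> y \<in> carrier N \<Longrightarrow>
    tensor_map R M N R' M' N' g h (pure R M N x y) = pure R' M' N' (g x) (h y)"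
  by (simp add: tensor_map_class D.free_frag_of)

lemma tensor_map_additive: "additive_map D.T C.T (tensor_map R M N R' M' N' g h)"
  by (auto simp: additive_map_def D.carrier_tensor tensor_map_class ext_free C.class_closed
      D.class_add C.class_add D.free_add frag_extend_add)

lemmas tensor_map_minus =
  additive_map_minus[OF D.T.abelian_group_axioms C.T.abelian_group_axioms tensor_map_additive]

end

context tensor_pair
begin

abbreviation "tmap \<equiv> tensor_map R M N R M N"
abbreviation "\<tau>M \<equiv> twist M (mgrade M)"
abbreviation "\<tau>N \<equiv> twist N (mgrade N)"
abbreviation "\<tau>R \<equiv> twist R (grade R)"
abbreviation "semilin \<equiv> semilinear_pair R M N R M N"
abbreviation "tw \<equiv> tmap \<tau>M \<tau>N"

lemma tmap_pure:
  "semilin \<sigma> g h \<Longrightarrow> x \<in> carrier M \<Longrightarrow> y \<in> carrier N \<Longrightarrow> tmap g h (pure R M N x y) = pure R M N (g x) (h y)"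
  by (intro tensor_hom.tensor_map_pure tensor_hom.intro tensor_hom_axioms.intro tensor_pair_axioms)

lemma tmap_additive: "semilin \<sigma> g h \<Longrightarrow> additive_map T T (tmap g h)"
  by (intro tensor_hom.tensor_map_additive tensor_hom.intro tensor_hom_axioms.intro tensor_pair_axioms)

lemma semilin_smult: "f \<in> carrier R \<Longrightarrow> semilin (\<lambda>f. f) (\<lambda>x. f \<odot>\<^bsub>M\<^esub> x) (\<lambda>y. y)"
  by (auto simp: semilinear_pair_def additive_map_def S.smult_closed S.smult_r_distr S.rsmult_smult)

lemma smult_tensor: "f \<odot>\<^bsub>T\<^esub> t = tmap (\<lambda>x. f \<odot>\<^bsub>M\<^esub> x) (\<lambda>y. y) t"
  by (simp add: tensor_module_def)

lemma tensor_smult_additive: "f \<in> carrier R \<Longrightarrow> additive_map T T ((\<odot>\<^bsub>T\<^esub>) f)"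
  using tmap_additive[OF semilin_smult] by (simp add: smult_tensor[abs_def] eta_contract_eq)

lemma smult_pure:
  "f \<in> carrier R \<Longrightarrow> x \<in> carrier M \<Longrightarrow> y \<in> carrier N \<Longrightarrow>
    f \<odot>\<^bsub>T\<^esub> pure R M N x y = pure R M N (f \<odot>\<^bsub>M\<^esub> x) y"
  by (simp add: smult_tensor tmap_pure[OF semilin_smult])

lemma tensor_smult_closed: "f \<in> carrier R \<Longrightarrow> t \<in> carrier T \<Longrightarrow> f \<odot>\<^bsub>T\<^esub> t \<in> carrier T"
  by (rule additive_map_closed[OF tensor_smult_additive])

lemma additive_map_comp_T:
  "additive_map T T F \<Longrightarrow> additive_map T T F' \<Longrightarrow> additive_map T T (\<lambda>t. F (F' t))"
  by (auto simp: additive_map_def)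

lemma additive_map_add_T:
  "additive_map T T F \<Longrightarrow> additive_map T T F' \<Longrightarrow> additive_map T T (\<lambda>t. F t \<oplus>\<^bsub>T\<^esub> F' t)"
  by (auto simp: additive_map_def Pi_iff T.a_ac)

lemma additive_map_minus_T: "additive_map T T F \<Longrightarrow> additive_map T T (\<lambda>t. \<ominus>\<^bsub>T\<^esub> F t)"
  by (auto simp: additive_map_def Pi_iff T.minus_add)

lemma additive_map_id_T: "additive_map T T (\<lambda>t. t)"
  by (auto simp: additive_map_def)

lemmas additive_T_intros = additive_map_comp_T additive_map_add_T additive_map_minus_T additive_map_id_T

lemmas tensor_eqI = additive_eqI[OF T.abelian_group_axioms]

lemma tensor_smult_l_distr:
  assumes "f \<in> carrier R" "g \<in> carrier R" "t \<in> carrier T"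
  shows "(f \<oplus>\<^bsub>R\<^esub> g) \<odot>\<^bsub>T\<^esub> t = f \<odot>\<^bsub>T\<^esub> t \<oplus>\<^bsub>T\<^esub> g \<odot>\<^bsub>T\<^esub> t"
  by (rule tensor_eqI[of "\<lambda>t. (f \<oplus>\<^bsub>R\<^esub> g) \<odot>\<^bsub>T\<^esub> t" "\<lambda>t. f \<odot>\<^bsub>T\<^esub> t \<oplus>\<^bsub>T\<^esub> g \<odot>\<^bsub>T\<^esub> t"])
    (use assms in \<open>simp_all add: additive_map_add_T tensor_smult_additive smult_pure S.smult_l_distr
       pure_add_left S.smult_closed\<close>)

lemma tensor_smult_zero: assumes "t \<in> carrier T" shows "\<zero>\<^bsub>R\<^esub> \<odot>\<^bsub>T\<^esub> t = \<zero>\<^bsub>T\<^esub>"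
  using additive_map_zero[OF S.R.abelian_group_axioms T.abelian_group_axioms, of "\<lambda>f. f \<odot>\<^bsub>T\<^esub> t"] assms
  by (simp add: additive_map_def tensor_smult_l_distr tensor_smult_closed)

lemma tensor_smult_one: assumes "t \<in> carrier T" shows "\<one>\<^bsub>R\<^esub> \<odot>\<^bsub>T\<^esub> t = t"
  by (rule tensor_eqI[of "\<lambda>t. \<one>\<^bsub>R\<^esub> \<odot>\<^bsub>T\<^esub> t" "\<lambda>t. t"])
    (use assms in \<open>simp_all add: additive_map_id_T tensor_smult_additive smult_pure S.smult_one\<close>)

lemma tensor_smult_assoc:
  assumes "f \<in> carrier R" "g \<in> carrier R" "t \<in> carrier T"
  shows "(f \<otimes>\<^bsub>R\<^esub> g) \<odot>\<^bsub>T\<^esub> t = f \<odot>\<^bsub>T\<^esub> (g \<odot>\<^bsub>T\<^esub> t)"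
  by (rule tensor_eqI[of "\<lambda>t. (f \<otimes>\<^bsub>R\<^esub> g) \<odot>\<^bsub>T\<^esub> t" "\<lambda>t. f \<odot>\<^bsub>T\<^esub> (g \<odot>\<^bsub>T\<^esub> t)"])
    (use assms in \<open>simp_all add: additive_map_comp_T tensor_smult_additive smult_pure S.smult_assoc
       S.smult_closed\<close>)

lemma semilin_twist: "semilin \<tau>R \<tau>M \<tau>N"
  by (auto simp: semilinear_pair_def additive_map_def S.MG.twist_closed N.MG.twist_closed
      S.MG.twist_add N.MG.twist_add S.RG.twist_closed S.twist_rsmult N.twist_smult)

lemma tw_additive: "additive_map T T tw"
  by (rule tmap_additive[OF semilin_twist])

lemma tw_pure: "x \<in> carrier M \<Longrightarrow> y \<in> carrier N \<Longrightarrow> tw (pure R M N x y) = pure R M N (\<tau>M x) (\<tau>N y)"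
  by (rule tmap_pure[OF semilin_twist])

lemma tw_pure_homogeneous:
  assumes "x \<in> mgrade M i" "y \<in> mgrade N j"
  shows "tw (pure R M N x y) = ksign T (i + j) (pure R M N x y)"
  using S.MG.gr_closed[OF assms(1)] N.MG.gr_closed[OF assms(2)]
  by (cases i; cases j) (simp_all add: tw_pure S.MG.twist_homogeneous[OF assms(1)]
      N.MG.twist_homogeneous[OF assms(2)] ksign_def pure_minus_left pure_minus_right pure_closed)

definition gens :: "bit \<Rightarrow> ('m \<times> 'n \<Rightarrow>\<^sub>0 int) set" where
  "gens d = {frag_of (x, y) | x y i j. x \<in> mgrade M i \<and> y \<in> mgrade N j \<and> i + j = d}"

lemma tensor_grade: "mgrade T d = cls ` generate (tensor_free M N) (gens d)"
  by (simp only: tensor_module_def supermodule.simps gens_def)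

lemma gens_free: "gens d \<subseteq> free"
  unfolding gens_def using S.MG.gr_closed N.MG.gr_closed free_frag_of by blast

lemma generate_gens_subgroup: "subgroup (generate (tensor_free M N) (gens d)) (tensor_free M N)"
  by (intro group.generate_is_subgroup gens_free comm_group.axioms(2) free_comm_group)

lemma generate_gens_free: "c \<in> generate (tensor_free M N) (gens d) \<Longrightarrow> c \<in> free"
  using subgroup.subset[OF generate_gens_subgroup] by auto

lemma tensor_grade_closed: "t \<in> mgrade T d \<Longrightarrow> t \<in> carrier T"
  unfolding tensor_grade using generate_gens_free class_closed by blast

lemma tensor_grade_pure:
  "x \<in> mgrade M i \<Longrightarrow> y \<in> mgrade N j \<Longrightarrow> pure R M N x y \<in> mgrade T (i + j)"
  unfolding tensor_grade by (intro imageI generate.incl) (unfold gens_def, blast)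

lemma tensor_grade_zero: "\<zero>\<^bsub>T\<^esub> \<in> mgrade T d"
  unfolding tensor_grade class_zero using subgroup.one_closed[OF generate_gens_subgroup]
  by (simp add: tensor_free_def)

lemma tensor_grade_diff:
  assumes "s \<in> mgrade T d" "t \<in> mgrade T d" shows "s \<ominus>\<^bsub>T\<^esub> t \<in> mgrade T d"
proof -
  let ?G = "generate (tensor_free M N) (gens d)"
  obtain a b where ab: "a \<in> ?G" "b \<in> ?G" "s = cls a" "t = cls b"
    using assms unfolding tensor_grade by blast
  then have f: "a \<in> free" "b \<in> free" using generate_gens_free by auto
  have "a \<otimes>\<^bsub>tensor_free M N\<^esub> inv\<^bsub>tensor_free M N\<^esub> b \<in> ?G"
    by (intro subgroup.m_closed[OF generate_gens_subgroup] subgroup.m_inv_closed[OF generate_gens_subgroup] ab)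
  then have "a - b \<in> ?G" using f by (simp add: tensor_free_def)
  then show ?thesis using ab f unfolding tensor_grade by (simp add: class_diff)
qed

lemma tensor_grade_minus: "t \<in> mgrade T d \<Longrightarrow> \<ominus>\<^bsub>T\<^esub> t \<in> mgrade T d"
  using tensor_grade_diff[OF tensor_grade_zero] tensor_grade_closed by (fastforce simp: a_minus_def)

lemma tensor_grade_add: "s \<in> mgrade T d \<Longrightarrow> t \<in> mgrade T d \<Longrightarrow> s \<oplus>\<^bsub>T\<^esub> t \<in> mgrade T d"
  using tensor_grade_diff[OF _ tensor_grade_minus, of s d t] tensor_grade_closed
  by (fastforce simp: a_minus_def)

lemma tensor_grade_induct [consumes 1, case_names pure diff]:
  assumes "t \<in> mgrade T d"
    and pure: "\<And>x y i j. \<lbrakk>x \<in> mgrade M i; y \<in> mgrade N j; i + j = d\<rbrakk> \<Longrightarrow> Q (pure R M N x y)"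
    and diff: "\<And>s t. \<lbrakk>s \<in> carrier T; t \<in> carrier T; Q s; Q t\<rbrakk> \<Longrightarrow> Q (s \<ominus>\<^bsub>T\<^esub> t)"
  shows "Q t"
proof -
  have zero: "Q \<zero>\<^bsub>T\<^esub>"
    using pure[OF S.MG.gr_zero[of 0] N.MG.gr_zero[of d]] by (simp add: pure_zero_left)
  have gen: "Q (cls c)" if "c \<in> gens d" for c
    using that pure unfolding gens_def by blast
  have "Q (cls c)" if "c \<in> generate (tensor_free M N) (gens d)" for c
    using that
  proof (induction rule: generate.induct)
    case one
    then show ?case using zero by (simp add: tensor_free_def class_zero)
  next
    case (incl c)
    then show ?case by (rule gen)
  next
    case (inv c)
    then have "c \<in> free" using gens_free by blast
    then show ?case using diff[OF T.zero_closed class_closed zero gen[OF inv], of]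
      by (simp add: class_zero class_diff free_zero) (simp add: tensor_free_def)
  next
    case (eng a b)
    have f: "a \<in> free" "b \<in> free" using eng generate_gens_free by auto
    have "Q (cls (- b))"
      using diff[OF T.zero_closed class_closed[OF f(2)] zero eng.IH(2)] f
      by (simp add: class_zero class_diff free_zero)
    from diff[OF class_closed[OF f(1)] class_closed[OF free_minus[OF f(2)]] eng.IH(1) this]
    show ?case using f by (simp add: class_diff free_minus) (simp add: tensor_free_def)
  qed
  then show ?thesis using assms(1) unfolding tensor_grade by blast
qed

lemma tw_grade: "t \<in> mgrade T d \<Longrightarrow> tw t = ksign T d t"
proof (induction rule: tensor_grade_induct)
  case (pure x y i j)
  then show ?case using tw_pure_homogeneous[OF pure(1,2)] by simp
next
  case (diff s t)
  then show ?case
    using additive_map_closed[OF tw_additive]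
    by (cases d) (simp_all add: a_minus_def additive_map_add[OF tw_additive] ksign_def T.minus_add
      additive_map_minus[OF T.abelian_group_axioms T.abelian_group_axioms tw_additive])
qed

text \<open>
  As \<open>tw (a + b) = a - b\<close>, the two parts are determined by \<open>t\<close> once \<open>2\<close> is invertible.
\<close>

lemma tensor_decompose:
  assumes "t \<in> carrier T"
  shows "\<exists>a\<in>mgrade T 0. \<exists>b\<in>mgrade T 1. t = a \<oplus>\<^bsub>T\<^esub> b"
  using assms
proof (induction rule: tensor_induct)
  case (pure x y)
  obtain x0 x1 where x: "x0 \<in> mgrade M 0" "x1 \<in> mgrade M 1" "x = x0 \<oplus>\<^bsub>M\<^esub> x1"
    using pure(1) by (rule S.MG.decompose)
  obtain y0 y1 where y: "y0 \<in> mgrade N 0" "y1 \<in> mgrade N 1" "y = y0 \<oplus>\<^bsub>N\<^esub> y1"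
    using pure(2) by (rule N.MG.decompose)
  note c = x(1,2)[THEN S.MG.gr_closed] y(1,2)[THEN N.MG.gr_closed]
  have "pure R M N x y = (pure R M N x0 y0 \<oplus>\<^bsub>T\<^esub> pure R M N x1 y1) \<oplus>\<^bsub>T\<^esub> (pure R M N x0 y1 \<oplus>\<^bsub>T\<^esub> pure R M N x1 y0)"
    using c by (simp add: x y pure_add_left pure_add_right pure_closed T.a_ac)
  moreover have "pure R M N x0 y0 \<oplus>\<^bsub>T\<^esub> pure R M N x1 y1 \<in> mgrade T 0"
    using tensor_grade_pure[OF x(1) y(1)] tensor_grade_pure[OF x(2) y(2)]
    by (intro tensor_grade_add) simp_all
  moreover have "pure R M N x0 y1 \<oplus>\<^bsub>T\<^esub> pure R M N x1 y0 \<in> mgrade T 1"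
    using tensor_grade_pure[OF x(1) y(2)] tensor_grade_pure[OF x(2) y(1)]
    by (intro tensor_grade_add) simp_all
  ultimately show ?case by blast
next
  case (diff s t)
  then obtain a b c d where *: "a \<in> mgrade T 0" "b \<in> mgrade T 1" "s = a \<oplus>\<^bsub>T\<^esub> b"
     "c \<in> mgrade T 0" "d \<in> mgrade T 1" "t = c \<oplus>\<^bsub>T\<^esub> d" by blast
  then have "s \<ominus>\<^bsub>T\<^esub> t = (a \<ominus>\<^bsub>T\<^esub> c) \<oplus>\<^bsub>T\<^esub> (b \<ominus>\<^bsub>T\<^esub> d)"
    by (simp add: a_minus_def T.minus_add tensor_grade_closed T.a_ac)
  with * show ?case using tensor_grade_diff by blast
qed

text \<open>
  With \<open>t = a + b\<close> for \<open>a\<close> even and \<open>b\<close> odd, \<open>tw t = a - b\<close>, so \<open>t \<plusminus> tw t\<close> is \<open>2a\<close> or \<open>2b\<close>. The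
  formula is built from operators that commute with restriction, so it makes sense on sections of the
  sheaf as well.
\<close>

lemma tensor_projection_grade:
  assumes t: "t \<in> carrier T" and h: "h \<in> carrier R" "h \<oplus>\<^bsub>R\<^esub> h = \<one>\<^bsub>R\<^esub>"
  shows "h \<odot>\<^bsub>T\<^esub> (t \<oplus>\<^bsub>T\<^esub> ksign T d (tw t)) \<in> mgrade T d"
proof -
  obtain a b where ab: "a \<in> mgrade T 0" "b \<in> mgrade T 1" "t = a \<oplus>\<^bsub>T\<^esub> b"
    using tensor_decompose[OF t] by blast
  note c = ab(1,2)[THEN tensor_grade_closed]
  have tw: "tw t = a \<ominus>\<^bsub>T\<^esub> b"
    using c by (simp add: ab(3) additive_map_add[OF tw_additive] tw_grade[OF ab(1)] tw_grade[OF ab(2)]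
      ksign_def a_minus_def)
  have half: "h \<odot>\<^bsub>T\<^esub> (u \<oplus>\<^bsub>T\<^esub> u) = u" if "u \<in> carrier T" for u
    using that h tensor_smult_l_distr[of h h u] tensor_smult_one[of u]
    by (simp add: additive_map_add[OF tensor_smult_additive])
  have "t \<oplus>\<^bsub>T\<^esub> ksign T d (tw t) = (if d = 0 then a \<oplus>\<^bsub>T\<^esub> a else b \<oplus>\<^bsub>T\<^esub> b)"
  proof -
    have "(a \<oplus>\<^bsub>T\<^esub> b) \<oplus>\<^bsub>T\<^esub> (a \<oplus>\<^bsub>T\<^esub> \<ominus>\<^bsub>T\<^esub> b) = (a \<oplus>\<^bsub>T\<^esub> a) \<oplus>\<^bsub>T\<^esub> (b \<oplus>\<^bsub>T\<^esub> \<ominus>\<^bsub>T\<^esub> b)"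
      and "(a \<oplus>\<^bsub>T\<^esub> b) \<oplus>\<^bsub>T\<^esub> (\<ominus>\<^bsub>T\<^esub> a \<oplus>\<^bsub>T\<^esub> b) = (b \<oplus>\<^bsub>T\<^esub> b) \<oplus>\<^bsub>T\<^esub> (a \<oplus>\<^bsub>T\<^esub> \<ominus>\<^bsub>T\<^esub> a)"
      using c by (simp_all add: T.a_ac)
    then show ?thesis
      using c unfolding tw unfolding ab(3) by (cases d) (simp_all add: ksign_def a_minus_def T.minus_add T.r_neg)
  qed
  then show ?thesis using half c ab by (cases d) auto
qed

lemma tensor_projection_sum:
  assumes t: "t \<in> carrier T" and h: "h \<in> carrier R" "h \<oplus>\<^bsub>R\<^esub> h = \<one>\<^bsub>R\<^esub>"
  shows "h \<odot>\<^bsub>T\<^esub> (t \<oplus>\<^bsub>T\<^esub> ksign T 0 (tw t)) \<oplus>\<^bsub>T\<^esub> h \<odot>\<^bsub>T\<^esub> (t \<oplus>\<^bsub>T\<^esub> ksign T 1 (tw t)) = t"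
proof -
  have c: "tw t \<in> carrier T" using t by (rule additive_map_closed[OF tw_additive])
  have "(t \<oplus>\<^bsub>T\<^esub> tw t) \<oplus>\<^bsub>T\<^esub> (t \<oplus>\<^bsub>T\<^esub> \<ominus>\<^bsub>T\<^esub> tw t) = t \<oplus>\<^bsub>T\<^esub> t"
    using t c by (simp add: T.a_ac T.r_neg T.r_neg2)
  then show ?thesis
    using t c h tensor_smult_l_distr[of h h t] tensor_smult_one[of t]
    by (simp add: ksign_def flip: additive_map_add[OF tensor_smult_additive])
qed

end

section \<open>Operators on a tensor product defined by odd maps\<close>

context tensor_pair
begin

lemmas tensor_smult_minus =
  additive_map_minus[OF T.abelian_group_axioms T.abelian_group_axioms tensor_smult_additive]

text \<open>
  The operators \<open>\<psi> \<otimes> 1\<close> and \<open>\<tau> \<otimes> \<psi>'\<close>, where \<open>\<tau>\<close> is the parity sign. On an element of degree \<open>d\<close> they are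
  the left action of \<open>\<theta>\<close> and \<open>(-1)\<^sup>d\<close> times its right action, which sends \<open>x \<otimes> y\<close> to
  \<open>(-1)\<^bsup>|y|\<^esup> x \<otimes> \<psi>' y\<close>. Both anticommute with \<open>tw\<close>, and both are semilinear over the parity sign of the
  ring.
\<close>

abbreviation "left_op \<psi> \<equiv> tmap \<psi> (\<lambda>y. y)"
abbreviation "right_op \<psi>' \<equiv> tmap \<tau>M \<psi>'"

context
  fixes \<psi> assumes odd: "odd_map R M \<psi>"
begin

lemma odd_additive: "additive_map M M \<psi>"
  using odd by (simp add: odd_map_def)

lemmas odd_closed = additive_map_closed[OF odd_additive]

lemma semilin_left: "semilin (\<lambda>f. f) \<psi> (\<lambda>y. y)"
  using odd_additive by (auto simp: semilinear_pair_def additive_map_def S.odd_map_rsmult[OF odd])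

lemmas left_op_additive = tmap_additive[OF semilin_left]
lemmas left_op_pure = tmap_pure[OF semilin_left]

lemma left_op_tw:
  assumes "t \<in> carrier T" shows "left_op \<psi> (tw t) = \<ominus>\<^bsub>T\<^esub> tw (left_op \<psi> t)"
  by (rule tensor_eqI[of "\<lambda>t. left_op \<psi> (tw t)" "\<lambda>t. \<ominus>\<^bsub>T\<^esub> tw (left_op \<psi> t)"])
    (use assms in \<open>simp_all add: additive_T_intros left_op_additive tw_additive tw_pure left_op_pure
       S.MG.twist_closed N.MG.twist_closed odd_closed S.odd_map_twist[OF odd] pure_minus_left\<close>)

lemma left_op_smult:
  assumes "t \<in> carrier T" "f \<in> carrier R"
  shows "left_op \<psi> (f \<odot>\<^bsub>T\<^esub> t) = \<tau>R f \<odot>\<^bsub>T\<^esub> left_op \<psi> t"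
  by (rule tensor_eqI[of "\<lambda>t. left_op \<psi> (f \<odot>\<^bsub>T\<^esub> t)" "\<lambda>t. \<tau>R f \<odot>\<^bsub>T\<^esub> left_op \<psi> t"])
    (use assms in \<open>simp_all add: additive_T_intros left_op_additive tensor_smult_additive
       S.RG.twist_closed smult_pure left_op_pure S.smult_closed odd_closed S.odd_map_smult[OF odd]\<close>)

lemma semilin_left_action:
  assumes "f \<in> carrier R" "g \<in> carrier R"
  shows "semilin (\<lambda>f. f) (\<lambda>x. f \<odot>\<^bsub>M\<^esub> x \<oplus>\<^bsub>M\<^esub> \<psi> (g \<odot>\<^bsub>M\<^esub> x)) (\<lambda>y. y)"
  using assms
  by (auto simp: semilinear_pair_def additive_map_def S.smult_closed odd_closed S.smult_r_distr
      additive_map_add[OF odd_additive] S.M.a_ac S.rsmult_smult S.odd_map_rsmult[OF odd]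
      S.rsmult_closed S.rsmult_add_left simp flip: S.rsmult_smult)

lemma left_action_tensor:
  assumes "f \<in> carrier R" "g \<in> carrier R" "t \<in> carrier T"
  shows "tmap (\<lambda>x. f \<odot>\<^bsub>M\<^esub> x \<oplus>\<^bsub>M\<^esub> \<psi> (g \<odot>\<^bsub>M\<^esub> x)) (\<lambda>y. y) t =
    f \<odot>\<^bsub>T\<^esub> t \<oplus>\<^bsub>T\<^esub> \<tau>R g \<odot>\<^bsub>T\<^esub> left_op \<psi> t"
  by (rule tensor_eqI[of "tmap (\<lambda>x. f \<odot>\<^bsub>M\<^esub> x \<oplus>\<^bsub>M\<^esub> \<psi> (g \<odot>\<^bsub>M\<^esub> x)) (\<lambda>y. y)"
        "\<lambda>t. f \<odot>\<^bsub>T\<^esub> t \<oplus>\<^bsub>T\<^esub> \<tau>R g \<odot>\<^bsub>T\<^esub> left_op \<psi> t"])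
    (use assms in \<open>simp_all add: additive_T_intros left_op_additive tensor_smult_additive
       S.RG.twist_closed smult_pure left_op_pure S.smult_closed odd_closed S.odd_map_smult[OF odd]
       tmap_additive[OF semilin_left_action] tmap_pure[OF semilin_left_action] pure_add_left\<close>)

lemma left_op_involution:
  assumes "\<And>x. x \<in> carrier M \<Longrightarrow> \<psi> (\<psi> x) = x" "t \<in> carrier T"
  shows "left_op \<psi> (left_op \<psi> t) = t"
  by (rule tensor_eqI[of "\<lambda>t. left_op \<psi> (left_op \<psi> t)" "\<lambda>t. t"])
    (use assms in \<open>simp_all add: additive_T_intros left_op_additive left_op_pure odd_closed\<close>)

end

context
  fixes \<psi>' assumes odd': "odd_map R N \<psi>'"
begin

lemma odd'_additive: "additive_map N N \<psi>'"
  using odd' by (simp add: odd_map_def)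

lemmas odd'_closed = additive_map_closed[OF odd'_additive]

lemma semilin_right: "semilin \<tau>R \<tau>M \<psi>'"
  using odd'_additive semilin_twist
  by (auto simp: semilinear_pair_def N.odd_map_smult[OF odd'])

lemmas right_op_additive = tmap_additive[OF semilin_right]
lemmas right_op_pure = tmap_pure[OF semilin_right]

lemma right_op_tw:
  assumes "t \<in> carrier T" shows "right_op \<psi>' (tw t) = \<ominus>\<^bsub>T\<^esub> tw (right_op \<psi>' t)"
  by (rule tensor_eqI[of "\<lambda>t. right_op \<psi>' (tw t)" "\<lambda>t. \<ominus>\<^bsub>T\<^esub> tw (right_op \<psi>' t)"])
    (use assms in \<open>simp_all add: additive_T_intros right_op_additive tw_additive tw_pure right_op_pure
       S.MG.twist_closed N.MG.twist_closed odd'_closed N.odd_map_twist[OF odd'] pure_minus_right\<close>)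

lemma right_op_smult:
  assumes "t \<in> carrier T" "f \<in> carrier R"
  shows "right_op \<psi>' (f \<odot>\<^bsub>T\<^esub> t) = \<tau>R f \<odot>\<^bsub>T\<^esub> right_op \<psi>' t"
  by (rule tensor_eqI[of "\<lambda>t. right_op \<psi>' (f \<odot>\<^bsub>T\<^esub> t)" "\<lambda>t. \<tau>R f \<odot>\<^bsub>T\<^esub> right_op \<psi>' t"])
    (use assms in \<open>simp_all add: additive_T_intros right_op_additive tensor_smult_additive
       S.RG.twist_closed smult_pure right_op_pure S.smult_closed odd'_closed S.twist_smult S.MG.twist_closed\<close>)

lemma semilin_right_action:
  assumes "f \<in> carrier R" "g \<in> carrier R"
  shows "semilin (\<lambda>f. f) (\<lambda>x. x) (\<lambda>y. rsmult R N y f \<oplus>\<^bsub>N\<^esub> rsmult R N (\<psi>' (\<tau>N y)) g)"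
  using assms
  by (auto simp: semilinear_pair_def additive_map_def N.rsmult_closed odd'_closed N.smult_r_distr
      N.MG.twist_closed N.MG.twist_add N.rsmult_add_left additive_map_add[OF odd'_additive] N.M.a_ac
      N.twist_smult N.odd_map_smult[OF odd'] S.RG.twist_closed S.RG.twist_twist N.smult_closed N.rsmult_smult)

lemma pure_rsmult_homogeneous:
  assumes "f \<in> grade R e" "x \<in> carrier M" "y \<in> carrier N"
  shows "pure R M N x (rsmult R N y f) =
    pure R M N (f \<odot>\<^bsub>M\<^esub> (if e = 1 then \<tau>M x else x)) (if e = 1 then \<tau>N y else y)"
proof -
  have f: "f \<in> carrier R" using assms(1) by (rule S.RG.gr_closed)
  have y: "(if e = 1 then \<tau>N y else y) \<in> carrier N" using assms(3) by (simp add: N.MG.twist_closed)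
  show ?thesis
    unfolding N.rsmult_homogeneous[OF assms(1,3)]
    by (simp only: pure_balanced[OF assms(2) f y, symmetric] S.rsmult_homogeneous[OF assms(1,2)])
qed

text \<open>
  A homogeneous scalar \<open>f\<close> of parity \<open>e\<close> acting on the right is moved through \<open>y\<close>, then across the tensor
  sign, then through \<open>x\<close>; it arrives on the left at the price of the \<open>e\<close>-th power of \<open>tw\<close>. Thus the right
  action of \<open>f + \<theta> g\<close> is the left one composed with that power, with \<open>right_op \<psi>'\<close> in the place of
  \<open>left_op \<psi>\<close>.
\<close>

lemma right_action_tensor:
  assumes f: "f \<in> grade R e" and g: "g \<in> grade R (e + 1)" and t: "t \<in> carrier T"
  shows "tmap (\<lambda>x. x) (\<lambda>y. rsmult R N y f \<oplus>\<^bsub>N\<^esub> rsmult R N (\<psi>' (\<tau>N y)) g) t =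
    f \<odot>\<^bsub>T\<^esub> (if e = 1 then tw t else t) \<oplus>\<^bsub>T\<^esub> \<tau>R g \<odot>\<^bsub>T\<^esub> right_op \<psi>' (if e = 1 then tw t else t)"
proof -
  have c: "f \<in> carrier R" "g \<in> carrier R" using f g S.RG.gr_closed by auto
  have e: "additive_map T T (\<lambda>t. if e = 1 then tw t else t)"
    using tw_additive additive_map_id_T by (cases e) simp_all
  have "additive_map T T (\<lambda>t. f \<odot>\<^bsub>T\<^esub> (if e = 1 then tw t else t) \<oplus>\<^bsub>T\<^esub> \<tau>R g \<odot>\<^bsub>T\<^esub> right_op \<psi>' (if e = 1 then tw t else t))"
    by (intro additive_map_add_T additive_map_comp_T[OF tensor_smult_additive]
        additive_map_comp_T[OF right_op_additive] e c S.RG.twist_closed)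
  with tmap_additive[OF semilin_right_action[OF c]] show ?thesis
  proof (rule tensor_eqI)
    fix x y assume xy: "x \<in> carrier M" "y \<in> carrier N"
    have 1: "pure R M N x (rsmult R N y f) = f \<odot>\<^bsub>T\<^esub> (if e = 1 then tw (pure R M N x y) else pure R M N x y)"
      using xy c by (simp add: pure_rsmult_homogeneous[OF f] smult_pure tw_pure S.MG.twist_closed N.MG.twist_closed)
    have 2: "pure R M N x (rsmult R N (\<psi>' (\<tau>N y)) g) =
      \<tau>R g \<odot>\<^bsub>T\<^esub> right_op \<psi>' (if e = 1 then tw (pure R M N x y) else pure R M N x y)"
      using xy c g
      by (cases e) (simp_all add: pure_rsmult_homogeneous[OF g] smult_pure right_op_pure tw_pure
        S.MG.twist_closed N.MG.twist_closed odd'_closed S.MG.twist_twist N.MG.twist_twist S.RG.twist_closed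
        S.RG.twist_homogeneous[OF g] ksign_def N.odd_map_twist[OF odd'] S.smult_closed
        S.smult_l_minus pure_minus_left pure_minus_right N.MG.twist_minus pure_closed tensor_smult_minus)
    show "tmap (\<lambda>x. x) (\<lambda>y. rsmult R N y f \<oplus>\<^bsub>N\<^esub> rsmult R N (\<psi>' (\<tau>N y)) g) (pure R M N x y) =
      f \<odot>\<^bsub>T\<^esub> (if e = 1 then tw (pure R M N x y) else pure R M N x y) \<oplus>\<^bsub>T\<^esub>
      \<tau>R g \<odot>\<^bsub>T\<^esub> right_op \<psi>' (if e = 1 then tw (pure R M N x y) else pure R M N x y)"
      using xy c unfolding 1[symmetric] 2[symmetric]
      by (simp add: tmap_pure[OF semilin_right_action] pure_add_right N.rsmult_closed odd'_closed N.MG.twist_closed)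
  qed (rule t)
qed

end

lemma left_op_scale:
  assumes "odd_map R M \<psi>" and j: "j \<in> grade R 0" and t: "t \<in> carrier T"
  shows "left_op (\<lambda>x. j \<odot>\<^bsub>M\<^esub> \<psi> x) t = j \<odot>\<^bsub>T\<^esub> left_op \<psi> t"
  by (rule tensor_eqI[of "left_op (\<lambda>x. j \<odot>\<^bsub>M\<^esub> \<psi> x)" "\<lambda>t. j \<odot>\<^bsub>T\<^esub> left_op \<psi> t"])
    (use t S.RG.gr_closed[OF j] in \<open>simp_all add: additive_T_intros tensor_smult_additive smult_pure
       left_op_additive[OF S.odd_map_scale[OF assms(1) j]] left_op_pure[OF S.odd_map_scale[OF assms(1) j]]
       left_op_additive[OF assms(1)] left_op_pure[OF assms(1)] odd_closed[OF assms(1)]\<close>)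

lemma right_op_scale:
  assumes odd: "odd_map R N \<psi>'" and j: "j \<in> grade R 0" and t: "t \<in> carrier T"
  shows "right_op (\<lambda>y. j \<odot>\<^bsub>N\<^esub> \<psi>' y) t = j \<odot>\<^bsub>T\<^esub> right_op \<psi>' t"
proof -
  have c: "j \<in> carrier R" using j by (rule S.RG.gr_closed)
  have "pure R M N (\<tau>M x) (j \<odot>\<^bsub>N\<^esub> \<psi>' y) = j \<odot>\<^bsub>T\<^esub> pure R M N (\<tau>M x) (\<psi>' y)"
    if "x \<in> carrier M" "y \<in> carrier N" for x y
  proof -
    have xy: "\<tau>M x \<in> carrier M" "\<psi>' y \<in> carrier N"
      using that by (simp_all add: S.MG.twist_closed odd'_closed[OF odd])
    show ?thesis
      unfolding smult_pure[OF c xy] pure_balanced[OF xy(1) c xy(2), symmetric] S.rsmult_homogeneous[OF j xy(1)]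
      by simp
  qed
  note scale = this
  show ?thesis
    by (rule tensor_eqI[of "right_op (\<lambda>y. j \<odot>\<^bsub>N\<^esub> \<psi>' y)" "\<lambda>t. j \<odot>\<^bsub>T\<^esub> right_op \<psi>' t"])
      (use t c scale in \<open>simp_all add: additive_T_intros tensor_smult_additive right_op_additive[OF odd] right_op_pure[OF odd]
        right_op_additive[OF N.odd_map_scale[OF odd j]] right_op_pure[OF N.odd_map_scale[OF odd j]]\<close>)
qed

lemma semilin_endo:
  assumes \<phi>: "odd_map R M \<phi>" and \<phi>': "odd_map R N \<phi>'"
  shows "semilin \<tau>R (\<lambda>x. \<phi> (\<tau>M x)) \<phi>'"
  using semilin_right[OF \<phi>'] semilin_left[OF \<phi>] S.MG.twist_closed
  by (auto simp: semilinear_pair_def additive_map_def S.RG.twist_closed S.MG.twist_add)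

lemma left_op_right_op:
  assumes \<phi>: "odd_map R M \<phi>" and \<phi>': "odd_map R N \<phi>'" and t: "t \<in> carrier T"
  shows "left_op \<phi> (right_op \<phi>' t) = tmap (\<lambda>x. \<phi> (\<tau>M x)) \<phi>' t"
  by (rule tensor_eqI[of "\<lambda>t. left_op \<phi> (right_op \<phi>' t)" "tmap (\<lambda>x. \<phi> (\<tau>M x)) \<phi>'"])
    (use t in \<open>simp_all add: additive_T_intros left_op_additive[OF \<phi>] left_op_pure[OF \<phi>]
       right_op_additive[OF \<phi>'] right_op_pure[OF \<phi>'] tmap_additive[OF semilin_endo[OF \<phi> \<phi>']]
       tmap_pure[OF semilin_endo[OF \<phi> \<phi>']] S.MG.twist_closed odd'_closed[OF \<phi>']\<close>)

end

section \<open>Sheafification\<close>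

locale presheaf_of_groups =
  fixes \<X> :: "('x, 'a) superspace" and P :: "('x, 'a, 'm) msheaf"
  assumes presheaf: "presheaf (topo \<X>) (\<lambda>U. carrier (msec P U)) (mres P)"
    and groups: "openin (topo \<X>) U \<Longrightarrow> abelian_group (msec P U)"
    and res_additive: "\<lbrakk>openin (topo \<X>) U; openin (topo \<X>) V; V \<subseteq> U\<rbrakk> \<Longrightarrow>
      additive_map (msec P U) (msec P V) (mres P U V)"
begin

abbreviation "opn \<equiv> openin (topo \<X>)"
abbreviation "PM \<equiv> msec P"
abbreviation "sections \<equiv> sheafify_sections \<X> P"
abbreviation "SP \<equiv> sheafify \<X> P"

text \<open>
  Sections of the sheafification are functions with germs as values. To say that \<open>t\<close> gives the values of \<open>w\<close> on
  \<open>V\<close> lets all computations take place in the presheaf.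
\<close>

definition represents :: "('x \<Rightarrow> ('x set \<times> 'm) set) \<Rightarrow> 'x set \<Rightarrow> 'm \<Rightarrow> bool" where
  "represents w V t \<longleftrightarrow> opn V \<and> t \<in> carrier (PM V) \<and> (\<forall>y\<in>V. w y = pgerm \<X> P y V t)"

definition natural :: "'x set \<Rightarrow> ('x set \<Rightarrow> 'm \<Rightarrow> 'm) \<Rightarrow> bool" where
  "natural U u \<longleftrightarrow>
     (\<forall>V. opn V \<and> V \<subseteq> U \<longrightarrow> additive_map (PM V) (PM V) (u V)) \<and>
     (\<forall>V W. opn V \<and> opn W \<and> W \<subseteq> V \<and> V \<subseteq> U \<longrightarrow>
        (\<forall>t\<in>carrier (PM V). u W (mres P V W t) = mres P V W (u V t)))"

lemma natural_additive:
  "\<lbrakk>natural U u; opn V; V \<subseteq> U\<rbrakk> \<Longrightarrow> additive_map (PM V) (PM V) (u V)"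
  by (simp add: natural_def)

lemma natural_res:
  "\<lbrakk>natural U u; opn V; opn W; W \<subseteq> V; V \<subseteq> U; t \<in> carrier (PM V)\<rbrakk> \<Longrightarrow>
    u W (mres P V W t) = mres P V W (u V t)"
  by (simp add: natural_def)

lemma res_closed: "\<lbrakk>opn U; opn V; V \<subseteq> U; t \<in> carrier (PM U)\<rbrakk> \<Longrightarrow> mres P U V t \<in> carrier (PM V)"
  by (rule additive_map_closed[OF res_additive])

lemma res_self: "\<lbrakk>opn U; t \<in> carrier (PM U)\<rbrakk> \<Longrightarrow> mres P U U t = t"
  using presheaf by (simp add: presheaf_def)

lemma res_res:
  assumes "opn U" "opn V" "opn W" "W \<subseteq> V" "V \<subseteq> U" "t \<in> carrier (PM U)"
  shows "mres P V W (mres P U V t) = mres P U W t"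
  using presheaf assms unfolding presheaf_def by blast

lemma mem_germ:
  "(V', t') \<in> pgerm \<X> P x V t \<longleftrightarrow> opn V' \<and> x \<in> V' \<and> t' \<in> carrier (PM V') \<and>
    (\<exists>W. opn W \<and> x \<in> W \<and> W \<subseteq> V \<inter> V' \<and> mres P V W t = mres P V' W t')"
  by (simp add: germ_def)

lemma germ_self: "\<lbrakk>opn V; x \<in> V; t \<in> carrier (PM V)\<rbrakk> \<Longrightarrow> (V, t) \<in> pgerm \<X> P x V t"
  unfolding mem_germ by blast

lemma germ_subset:
  assumes V: "opn V" "t \<in> carrier (PM V)" and V': "opn V'" "t' \<in> carrier (PM V')"
    and W: "opn W" "x \<in> W" "W \<subseteq> V" "W \<subseteq> V'" "mres P V W t = mres P V' W t'"
  shows "pgerm \<X> P x V t \<subseteq> pgerm \<X> P x V' t'"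
proof
  fix q assume q: "q \<in> pgerm \<X> P x V t"
  obtain Z s where qs: "q = (Z, s)" by (cases q)
  then obtain Y where Z: "opn Z" "x \<in> Z" "s \<in> carrier (PM Z)"
    and Y: "opn Y" "x \<in> Y" "Y \<subseteq> V" "Y \<subseteq> Z" "mres P V Y t = mres P Z Y s"
    using q mem_germ[of Z s x V t] by auto
  have o: "opn (W \<inter> Y)" using W(1) Y(1) by (rule openin_Int)
  have "mres P V' (W \<inter> Y) t' = mres P W (W \<inter> Y) (mres P V' W t')"
    using res_res[of V' W "W \<inter> Y" t'] V' W o by simp
  also have "\<dots> = mres P W (W \<inter> Y) (mres P V W t)" using W by simp
  also have "\<dots> = mres P V (W \<inter> Y) t"
    using res_res[of V W "W \<inter> Y" t] V W o by simp
  also have "\<dots> = mres P Y (W \<inter> Y) (mres P V Y t)"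
    using res_res[of V Y "W \<inter> Y" t] V Y o by simp
  also have "\<dots> = mres P Y (W \<inter> Y) (mres P Z Y s)" using Y by simp
  also have "\<dots> = mres P Z (W \<inter> Y) s"
    using res_res[of Z Y "W \<inter> Y" s] Z Y o by simp
  finally have "mres P V' (W \<inter> Y) t' = mres P Z (W \<inter> Y) s" .
  moreover have "x \<in> W \<inter> Y" "W \<inter> Y \<subseteq> V' \<inter> Z" using W Y by auto
  ultimately show "q \<in> pgerm \<X> P x V' t'"
    unfolding qs mem_germ using Z o by blast
qed

lemma germ_eqI:
  assumes "opn V" "t \<in> carrier (PM V)" "opn V'" "t' \<in> carrier (PM V')"
    and "opn W" "x \<in> W" "W \<subseteq> V" "W \<subseteq> V'" "mres P V W t = mres P V' W t'"
  shows "pgerm \<X> P x V t = pgerm \<X> P x V' t'"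
  using germ_subset[OF assms] germ_subset[OF assms(3,4,1,2,5,6,8,7) assms(9)[symmetric]] by blast

lemma germ_eqD:
  assumes "pgerm \<X> P x V t = pgerm \<X> P x V' t'" "opn V'" "x \<in> V'" "t' \<in> carrier (PM V')"
  obtains W where "opn W" "x \<in> W" "W \<subseteq> V" "W \<subseteq> V'" "mres P V W t = mres P V' W t'"
proof -
  have "(V', t') \<in> pgerm \<X> P x V t" unfolding assms(1) by (rule germ_self[OF assms(2-4)])
  then show ?thesis using that mem_germ[of V' t' x V t] by auto
qed

lemma germ_res:
  assumes "opn V" "t \<in> carrier (PM V)" "opn W" "x \<in> W" "W \<subseteq> V"
  shows "pgerm \<X> P x W (mres P V W t) = pgerm \<X> P x V t"
  using assms res_closed[of V W t] res_self[of W "mres P V W t"]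
  by (intro germ_eqI[where W = W]) auto

lemma represents_restrict:
  assumes "represents w V t" "opn W" "W \<subseteq> V"
  shows "represents w W (mres P V W t)"
  using assms res_closed germ_res[of V t W] by (auto simp: represents_def)

lemma sections_iff:
  "w \<in> sections U \<longleftrightarrow> w \<in> extensional U \<and> (\<forall>x\<in>U. \<exists>V t. x \<in> V \<and> V \<subseteq> U \<and> represents w V t)"
  unfolding sheafify_sections_def represents_def by blast

lemma sectionsE:
  assumes "w \<in> sections U" "x \<in> U"
  obtains V t where "x \<in> V" "V \<subseteq> U" "represents w V t"
  using assms unfolding sections_iff by blast

lemma sections_pairE:
  assumes "w \<in> sections U" "v \<in> sections U" "x \<in> U"
  obtains V s t where "x \<in> V" "V \<subseteq> U" "represents w V s" "represents v V t"
proof -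
  from assms(1,3) obtain V s where V: "x \<in> V" "V \<subseteq> U" "represents w V s" by (rule sectionsE)
  from assms(2,3) obtain W t where W: "x \<in> W" "W \<subseteq> U" "represents v W t" by (rule sectionsE)
  have o: "opn (V \<inter> W)" using V W by (auto simp: represents_def)
  show ?thesis
    by (rule that[of "V \<inter> W", OF _ _ represents_restrict[OF V(3) o] represents_restrict[OF W(3) o]])
      (use V W in auto)
qed

lemma sections_eqI:
  assumes "w \<in> extensional U" "v \<in> extensional U"
    and "\<And>x. x \<in> U \<Longrightarrow> \<exists>V t. x \<in> V \<and> represents w V t \<and> represents v V t"
  shows "w = v"
  using assms(1,2)
proof (rule extensionalityI)
  fix x assume "x \<in> U"
  then obtain V t where "x \<in> V" "represents w V t" "represents v V t" using assms(3) by blast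
  then show "w x = v x" by (simp add: represents_def)
qed

text \<open>
  An identity between operators on the presheaf carries over to the sheafification: both sides have a
  common representative wherever \<open>w\<close> has one.
\<close>

lemma sections_eqI_rep:
  assumes "w \<in> sections U" "F \<in> extensional U" "G \<in> extensional U"
    and "\<And>V t. \<lbrakk>opn V; V \<subseteq> U; t \<in> carrier (PM V); represents w V t\<rbrakk> \<Longrightarrow>
      \<exists>s. represents F V s \<and> represents G V s"
  shows "F = G"
proof (rule sections_eqI[OF assms(2,3)])
  fix x assume "x \<in> U"
  with assms(1) obtain V t where V: "x \<in> V" "V \<subseteq> U" "represents w V t" by (rule sectionsE)
  then show "\<exists>V t. x \<in> V \<and> represents F V t \<and> represents G V t"
    using assms(4)[of V t] by (auto simp: represents_def)
qed

text \<open>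
  The definition of \<open>sheafify_map\<close> applies \<open>u\<close> to all members of a germ, cut down to \<open>U\<close>; by naturality
  the results agree near the point with \<open>u\<close> applied to the chosen representative.
\<close>

lemma represents_map:
  assumes u: "natural U u" and U: "opn U" and w: "represents w V t" and V: "V \<subseteq> U"
  shows "represents (sheafify_map \<X> P u U w) V (u V t)"
proof -
  have Vo: "opn V" and t: "t \<in> carrier (PM V)" using w by (auto simp: represents_def)
  have nat: "u W (mres P Y W s) = mres P Y W (u Y s)"
    if "opn Y" "opn W" "W \<subseteq> Y" "Y \<subseteq> U" "s \<in> carrier (PM Y)" for W Y s
    using natural_res[OF u that] .
  have clos: "u Y s \<in> carrier (PM Y)" if "opn Y" "Y \<subseteq> U" "s \<in> carrier (PM Y)" for Y s
    using additive_map_closed[OF natural_additive[OF u that(1,2)] that(3)] .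
  have "sheafify_map \<X> P u U w x = pgerm \<X> P x V (u V t)" if x: "x \<in> V" for x
  proof -
    have "pgerm \<X> P x (U \<inter> Z) (u (U \<inter> Z) (mres P Z (U \<inter> Z) s)) = pgerm \<X> P x V (u V t)"
      if "(Z, s) \<in> pgerm \<X> P x V t" for Z s
    proof -
      from that obtain W where Z: "opn Z" "x \<in> Z" "s \<in> carrier (PM Z)"
        and W: "opn W" "x \<in> W" "W \<subseteq> V" "W \<subseteq> Z" "mres P V W t = mres P Z W s"
        using mem_germ[of Z s x V t] by auto
      have o: "opn (U \<inter> Z)" using U Z(1) by (rule openin_Int)
      have WU: "W \<subseteq> U \<inter> Z" using W V by auto
      have c: "mres P Z (U \<inter> Z) s \<in> carrier (PM (U \<inter> Z))"
        using res_closed[OF Z(1) o _ Z(3)] by simp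
      have "mres P (U \<inter> Z) W (u (U \<inter> Z) (mres P Z (U \<inter> Z) s)) = u W (mres P (U \<inter> Z) W (mres P Z (U \<inter> Z) s))"
        using nat[OF o W(1) WU _ c] by simp
      also have "\<dots> = u W (mres P V W t)"
        using res_res[OF Z(1) o W(1) WU _ Z(3)] W(5) by simp
      also have "\<dots> = mres P V W (u V t)"
        using nat[OF Vo W(1) W(3) V t] .
      finally show ?thesis
        by (intro germ_eqI[OF o clos[OF o _ c] Vo clos[OF Vo V t] W(1,2) WU W(3)]) simp_all
    qed
    moreover have "(V, t) \<in> pgerm \<X> P x V t" using Vo x t by (rule germ_self)
    ultimately have "(\<Union>(Z, s)\<in>pgerm \<X> P x V t. pgerm \<X> P x (U \<inter> Z) (u (U \<inter> Z) (mres P Z (U \<inter> Z) s)))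
      = pgerm \<X> P x V (u V t)"
      by (intro SUP_eq_const) auto
    then show ?thesis using w x V by (auto simp: sheafify_map_def represents_def)
  qed
  then show ?thesis using Vo clos[OF Vo V t] by (simp add: represents_def)
qed

lemma sheafify_map_extensional: "sheafify_map \<X> P u U w \<in> extensional U"
  by (simp add: sheafify_map_def)

lemma sheafify_map_closed:
  assumes "natural U u" "opn U" "w \<in> sections U"
  shows "sheafify_map \<X> P u U w \<in> sections U"
  unfolding sections_iff
proof (intro conjI ballI sheafify_map_extensional)
  fix x assume "x \<in> U"
  with assms(3) obtain V t where "x \<in> V" "V \<subseteq> U" "represents w V t" by (rule sectionsE)
  then show "\<exists>V t. x \<in> V \<and> V \<subseteq> U \<and> represents (sheafify_map \<X> P u U w) V t"
    using represents_map[OF assms(1,2)] by blast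
qed

lemma natural_subset: "natural U u \<Longrightarrow> V \<subseteq> U \<Longrightarrow> natural V u"
  unfolding natural_def by (meson order.trans)

lemma carrier_SP: "carrier (msec SP U) = sections U"
  by (simp add: sheafify_def)

lemma mres_SP: "mres SP U V w = restrict w V"
  by (simp add: sheafify_def)

lemma smult_SP: "f \<odot>\<^bsub>msec SP U\<^esub> w = sheafify_map \<X> P (\<lambda>V t. res \<X> U V f \<odot>\<^bsub>PM V\<^esub> t) U w"
  by (simp add: sheafify_def)

lemma represents_restrict_fun: "represents w V t \<Longrightarrow> V \<subseteq> U \<Longrightarrow> represents (restrict w U) V t"
  by (auto simp: represents_def)

lemma restrict_sections:
  assumes "w \<in> sections U" "opn V" "V \<subseteq> U" shows "restrict w V \<in> sections V"
  unfolding sections_iff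
proof (intro conjI ballI)
  fix x assume x: "x \<in> V"
  then have "x \<in> U" using assms by auto
  with assms(1) obtain W t where W: "x \<in> W" "W \<subseteq> U" "represents w W t" by (rule sectionsE)
  have o: "opn (V \<inter> W)" using W assms by (auto simp: represents_def)
  have "represents (restrict w V) (V \<inter> W) (mres P W (V \<inter> W) t)"
    using represents_restrict[OF W(3) o] by (intro represents_restrict_fun) auto
  then show "\<exists>Y t. x \<in> Y \<and> Y \<subseteq> V \<and> represents (restrict w V) Y t"
    using W x by (intro exI[of _ "V \<inter> W"]) auto
qed simp

lemma sheafify_map_restrict:
  assumes u: "natural U u" "natural V u'" and o: "opn U" "opn V" "V \<subseteq> U" and w: "w \<in> sections U"
    and eq: "\<And>W t. \<lbrakk>opn W; W \<subseteq> V; t \<in> carrier (PM W)\<rbrakk> \<Longrightarrow> u' W t = u W t"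
  shows "sheafify_map \<X> P u' V (restrict w V) = restrict (sheafify_map \<X> P u U w) V"
proof (rule sections_eqI[of _ V])
  fix x assume "x \<in> V"
  with restrict_sections[OF w o(2,3)] obtain W t where
    W: "x \<in> W" "W \<subseteq> V" "represents (restrict w V) W t" by (rule sectionsE)
  then have r: "represents w W t" by (simp add: represents_def subset_iff)
  have "u' W t = u W t" using W eq by (auto simp: represents_def)
  then show "\<exists>W t. x \<in> W \<and> represents (sheafify_map \<X> P u' V (restrict w V)) W t \<and>
    represents (restrict (sheafify_map \<X> P u U w) V) W t"
    using represents_map[OF u(2) o(2) W(3,2)] W(1)
      represents_restrict_fun[OF represents_map[OF u(1) o(1) r subset_trans[OF W(2) o(3)]] W(2)] by auto
qed (simp_all add: sheafify_map_extensional)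

lemma represents_add:
  assumes w: "represents w V s" and v: "represents v V t" and V: "V \<subseteq> U"
  shows "represents (w \<oplus>\<^bsub>msec SP U\<^esub> v) V (s \<oplus>\<^bsub>PM V\<^esub> t)"
proof -
  have Vo: "opn V" and s: "s \<in> carrier (PM V)" and t: "t \<in> carrier (PM V)"
    using w v by (auto simp: represents_def)
  have add_closed: "a \<oplus>\<^bsub>PM Y\<^esub> b \<in> carrier (PM Y)"
    if "opn Y" "a \<in> carrier (PM Y)" "b \<in> carrier (PM Y)" for Y a b
    using that groups[of Y] by (simp add: abelian_group.axioms(1) abelian_monoid.a_closed)
  have "germ_binop (topo \<X>) (\<lambda>V. carrier (PM V)) (mres P) x (\<lambda>V. (\<oplus>\<^bsub>PM V\<^esub>)) (pgerm \<X> P x V s) (pgerm \<X> P x V t)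
    = pgerm \<X> P x V (s \<oplus>\<^bsub>PM V\<^esub> t)" if x: "x \<in> V" for x
  proof -
    let ?b = "\<lambda>Y a Z b. pgerm \<X> P x (Y \<inter> Z) (mres P Y (Y \<inter> Z) a \<oplus>\<^bsub>PM (Y \<inter> Z)\<^esub> mres P Z (Y \<inter> Z) b)"
    have eq: "?b Y a Z b = pgerm \<X> P x V (s \<oplus>\<^bsub>PM V\<^esub> t)"
      if "(Y, a) \<in> pgerm \<X> P x V s" "(Z, b) \<in> pgerm \<X> P x V t" for Y a Z b
    proof -
      from that(1) obtain W where Y: "opn Y" "x \<in> Y" "a \<in> carrier (PM Y)"
        and W: "opn W" "x \<in> W" "W \<subseteq> V" "W \<subseteq> Y" "mres P V W s = mres P Y W a"
        using mem_germ[of Y a x V s] by auto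
      from that(2) obtain W' where Z: "opn Z" "x \<in> Z" "b \<in> carrier (PM Z)"
        and W': "opn W'" "x \<in> W'" "W' \<subseteq> V" "W' \<subseteq> Z" "mres P V W' t = mres P Z W' b"
        using mem_germ[of Z b x V t] by auto
      let ?W = "W \<inter> W'"
      have o: "opn ?W" "opn (Y \<inter> Z)" using W W' Y Z by auto
      have sub: "?W \<subseteq> Y \<inter> Z" "?W \<subseteq> V" using W W' by auto
      have c: "mres P Y (Y \<inter> Z) a \<in> carrier (PM (Y \<inter> Z))" "mres P Z (Y \<inter> Z) b \<in> carrier (PM (Y \<inter> Z))"
        using Y Z o res_closed by auto
      have "mres P V ?W s = mres P W ?W (mres P V W s)"
        using res_res[of V W ?W s] Vo s W o by simp
      also have "\<dots> = mres P Y ?W a"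
        using res_res[of Y W ?W a] Y W o by simp
      also have "\<dots> = mres P (Y \<inter> Z) ?W (mres P Y (Y \<inter> Z) a)"
        using res_res[of Y "Y \<inter> Z" ?W a] Y W o sub by simp
      finally have 1: "mres P V ?W s = mres P (Y \<inter> Z) ?W (mres P Y (Y \<inter> Z) a)" .
      have "mres P V ?W t = mres P W' ?W (mres P V W' t)"
        using res_res[of V W' ?W t] Vo t W' o by simp
      also have "\<dots> = mres P Z ?W b"
        using res_res[of Z W' ?W b] Z W' o by simp
      also have "\<dots> = mres P (Y \<inter> Z) ?W (mres P Z (Y \<inter> Z) b)"
        using res_res[of Z "Y \<inter> Z" ?W b] Z W' o sub by simp
      finally have 2: "mres P V ?W t = mres P (Y \<inter> Z) ?W (mres P Z (Y \<inter> Z) b)" .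
      show ?thesis
        using additive_map_add[OF res_additive[OF o(2,1) sub(1)] c]
          additive_map_add[OF res_additive[OF Vo o(1) sub(2)] s t] 1 2 W W'
        by (intro germ_eqI[OF o(2) add_closed[OF o(2) c] Vo add_closed[OF Vo s t] o(1) _ sub]) simp_all
    qed
    have m: "(V, s) \<in> pgerm \<X> P x V s" "(V, t) \<in> pgerm \<X> P x V t"
      using germ_self Vo x s t by auto
    have "(\<Union>(Z, b)\<in>pgerm \<X> P x V t. ?b Y a Z b) = pgerm \<X> P x V (s \<oplus>\<^bsub>PM V\<^esub> t)"
      if "(Y, a) \<in> pgerm \<X> P x V s" for Y a
      using m eq[OF that] by (intro SUP_eq_const) auto
    with m show ?thesis
      unfolding germ_binop_def by (intro SUP_eq_const) auto
  qed
  then show ?thesis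
    using Vo V add_closed[OF Vo s t] w v by (auto simp: represents_def sheafify_def)
qed

lemma represents_zero:
  assumes "opn U" "opn V" "V \<subseteq> U"
  shows "represents \<zero>\<^bsub>msec SP U\<^esub> V \<zero>\<^bsub>PM V\<^esub>"
proof -
  have "mres P U V \<zero>\<^bsub>PM U\<^esub> = \<zero>\<^bsub>PM V\<^esub>"
    using assms by (intro additive_map_zero groups res_additive)
  moreover have "\<zero>\<^bsub>PM Y\<^esub> \<in> carrier (PM Y)" if "opn Y" for Y
    using groups[OF that] by (simp add: abelian_group.axioms(1) abelian_monoid.zero_closed)
  ultimately show ?thesis
    using assms germ_res[of U "\<zero>\<^bsub>PM U\<^esub>" V] by (auto simp: represents_def sheafify_def)
qed

lemma add_SP_extensional: "w \<oplus>\<^bsub>msec SP U\<^esub> v \<in> extensional U"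
  and zero_SP_extensional: "\<zero>\<^bsub>msec SP U\<^esub> \<in> extensional U"
  by (simp_all add: sheafify_def)

lemma add_SP_closed:
  assumes "w \<in> sections U" "v \<in> sections U" shows "w \<oplus>\<^bsub>msec SP U\<^esub> v \<in> sections U"
  unfolding sections_iff using add_SP_extensional sections_pairE[OF assms] represents_add by metis

lemma zero_SP_closed: "opn U \<Longrightarrow> \<zero>\<^bsub>msec SP U\<^esub> \<in> sections U"
  unfolding sections_iff using zero_SP_extensional represents_zero by blast

lemma natural_minus: "natural U (\<lambda>V t. \<ominus>\<^bsub>PM V\<^esub> t)"
  unfolding natural_def
proof (intro conjI allI impI ballI)
  fix V assume "opn V \<and> V \<subseteq> U"
  then interpret abelian_group "PM V" using groups by blast
  show "additive_map (PM V) (PM V) (\<lambda>t. \<ominus>\<^bsub>PM V\<^esub> t)"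
    by (auto simp: additive_map_def minus_add)
next
  fix V W t assume "opn V \<and> opn W \<and> W \<subseteq> V \<and> V \<subseteq> U" "t \<in> carrier (PM V)"
  then show "\<ominus>\<^bsub>PM W\<^esub> mres P V W t = mres P V W (\<ominus>\<^bsub>PM V\<^esub> t)"
    using additive_map_minus groups res_additive by metis
qed

lemma sheafify_minus_add:
  assumes U: "opn U" and w: "w \<in> sections U"
  shows "sheafify_map \<X> P (\<lambda>V t. \<ominus>\<^bsub>PM V\<^esub> t) U w \<oplus>\<^bsub>msec SP U\<^esub> w = \<zero>\<^bsub>msec SP U\<^esub>"
    (is "?m \<oplus>\<^bsub>msec SP U\<^esub> w = _")
proof (rule sections_eqI[OF add_SP_extensional zero_SP_extensional])
  fix x assume "x \<in> U"
  with w obtain V a where V: "x \<in> V" "V \<subseteq> U" "represents w V a" by (rule sectionsE)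
  then interpret abelian_group "PM V" using groups by (simp add: represents_def)
  have o: "opn V" "\<ominus>\<^bsub>PM V\<^esub> a \<oplus>\<^bsub>PM V\<^esub> a = \<zero>\<^bsub>PM V\<^esub>" using V by (auto simp: represents_def l_neg)
  then show "\<exists>V t. x \<in> V \<and> represents (?m \<oplus>\<^bsub>msec SP U\<^esub> w) V t \<and> represents \<zero>\<^bsub>msec SP U\<^esub> V t"
    using V(1) represents_add[OF represents_map[OF natural_minus U V(3,2)] V(3,2)]
      represents_zero[OF U o(1) V(2)] by (metis o(2))
qed

lemma SP_abelian_group:
  assumes U: "opn U" shows "abelian_group (msec SP U)"
proof (rule abelian_groupI; (unfold carrier_SP)?)
  fix w v z assume wv: "w \<in> sections U" "v \<in> sections U" "z \<in> sections U"
  show "w \<oplus>\<^bsub>msec SP U\<^esub> v \<oplus>\<^bsub>msec SP U\<^esub> z = w \<oplus>\<^bsub>msec SP U\<^esub> (v \<oplus>\<^bsub>msec SP U\<^esub> z)"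
  proof (rule sections_eqI[OF add_SP_extensional add_SP_extensional])
    fix x assume "x \<in> U"
    with wv(1,2) obtain V a b where V: "x \<in> V" "V \<subseteq> U" "represents w V a" "represents v V b"
      by (rule sections_pairE)
    from wv(3) \<open>x \<in> U\<close> obtain W c where W: "x \<in> W" "W \<subseteq> U" "represents z W c"
      by (rule sectionsE)
    have o: "opn (V \<inter> W)" using V W by (auto simp: represents_def)
    let ?a = "mres P V (V \<inter> W) a" and ?b = "mres P V (V \<inter> W) b" and ?c = "mres P W (V \<inter> W) c"
    interpret abelian_group "PM (V \<inter> W)" using o by (rule groups)
    have r: "represents w (V \<inter> W) ?a" "represents v (V \<inter> W) ?b" "represents z (V \<inter> W) ?c"
      using represents_restrict V W o by auto
    have s: "V \<inter> W \<subseteq> U" using V by auto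
    have "?a \<oplus>\<^bsub>PM (V \<inter> W)\<^esub> ?b \<oplus>\<^bsub>PM (V \<inter> W)\<^esub> ?c = ?a \<oplus>\<^bsub>PM (V \<inter> W)\<^esub> (?b \<oplus>\<^bsub>PM (V \<inter> W)\<^esub> ?c)"
      using r by (simp add: represents_def a_assoc)
    then show "\<exists>V t. x \<in> V \<and> represents (w \<oplus>\<^bsub>msec SP U\<^esub> v \<oplus>\<^bsub>msec SP U\<^esub> z) V t \<and>
      represents (w \<oplus>\<^bsub>msec SP U\<^esub> (v \<oplus>\<^bsub>msec SP U\<^esub> z)) V t"
      using V(1) W(1) represents_add[OF represents_add[OF r(1,2) s] r(3) s]
        represents_add[OF r(1) represents_add[OF r(2,3) s] s] by (metis IntI)
  qed
next
  fix w v assume wv: "w \<in> sections U" "v \<in> sections U"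
  show "w \<oplus>\<^bsub>msec SP U\<^esub> v \<in> sections U" using wv by (rule add_SP_closed)
  show "w \<oplus>\<^bsub>msec SP U\<^esub> v = v \<oplus>\<^bsub>msec SP U\<^esub> w"
  proof (rule sections_eqI[OF add_SP_extensional add_SP_extensional])
    fix x assume "x \<in> U"
    with wv obtain V a b where V: "x \<in> V" "V \<subseteq> U" "represents w V a" "represents v V b"
      by (rule sections_pairE)
    then interpret abelian_group "PM V" using groups by (simp add: represents_def)
    have "a \<oplus>\<^bsub>PM V\<^esub> b = b \<oplus>\<^bsub>PM V\<^esub> a" using V by (simp add: represents_def a_comm)
    then show "\<exists>V t. x \<in> V \<and> represents (w \<oplus>\<^bsub>msec SP U\<^esub> v) V t \<and> represents (v \<oplus>\<^bsub>msec SP U\<^esub> w) V t"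
      using V(1) represents_add[OF V(3,4,2)] represents_add[OF V(4,3,2)] by metis
  qed
next
  show "\<zero>\<^bsub>msec SP U\<^esub> \<in> sections U" using U by (rule zero_SP_closed)
next
  fix w assume w: "w \<in> sections U"
  show "\<zero>\<^bsub>msec SP U\<^esub> \<oplus>\<^bsub>msec SP U\<^esub> w = w"
  proof (rule sections_eqI[OF add_SP_extensional])
    show "w \<in> extensional U" using w by (simp add: sections_iff)
    fix x assume "x \<in> U"
    with w obtain V a where V: "x \<in> V" "V \<subseteq> U" "represents w V a" by (rule sectionsE)
    then interpret abelian_group "PM V" using groups by (simp add: represents_def)
    have o: "opn V" "\<zero>\<^bsub>PM V\<^esub> \<oplus>\<^bsub>PM V\<^esub> a = a" using V by (auto simp: represents_def)
    then show "\<exists>V t. x \<in> V \<and> represents (\<zero>\<^bsub>msec SP U\<^esub> \<oplus>\<^bsub>msec SP U\<^esub> w) V t \<and> represents w V t"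
      using V represents_add[OF represents_zero[OF U o(1) V(2)] V(3,2)] by (metis o(2))
  qed
  show "\<exists>v\<in>sections U. v \<oplus>\<^bsub>msec SP U\<^esub> w = \<zero>\<^bsub>msec SP U\<^esub>"
    using sheafify_minus_add[OF U w] sheafify_map_closed[OF natural_minus U w] by blast
qed

lemma represents_minus:
  assumes U: "opn U" and w: "w \<in> sections U" and V: "V \<subseteq> U" "represents w V t"
  shows "represents (\<ominus>\<^bsub>msec SP U\<^esub> w) V (\<ominus>\<^bsub>PM V\<^esub> t)"
proof -
  interpret G: abelian_group "msec SP U" using U by (rule SP_abelian_group)
  let ?m = "sheafify_map \<X> P (\<lambda>V t. \<ominus>\<^bsub>PM V\<^esub> t) U w"
  have "\<ominus>\<^bsub>msec SP U\<^esub> w = ?m"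
    using sheafify_minus_add[OF U w] w sheafify_map_closed[OF natural_minus U w] by (intro G.minus_equality) (simp_all add: carrier_SP)
  then show ?thesis using represents_map[OF natural_minus U V(2,1)] by simp
qed

lemma represents_ksign:
  assumes "opn U" "w \<in> sections U" "V \<subseteq> U" "represents w V t"
  shows "represents (ksign (msec SP U) e w) V (ksign (PM V) e t)"
  using represents_minus[OF assms] assms(4) by (simp add: ksign_def)

lemma sheafify_map_additive:
  assumes u: "natural U u" and U: "opn U"
  shows "additive_map (msec SP U) (msec SP U) (sheafify_map \<X> P u U)"
  unfolding additive_map_def carrier_SP
proof (intro conjI ballI)
  show "sheafify_map \<X> P u U \<in> sections U \<rightarrow> sections U" using sheafify_map_closed[OF u U] by blast
  fix w v assume wv: "w \<in> sections U" "v \<in> sections U"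
  show "sheafify_map \<X> P u U (w \<oplus>\<^bsub>msec SP U\<^esub> v) = sheafify_map \<X> P u U w \<oplus>\<^bsub>msec SP U\<^esub> sheafify_map \<X> P u U v"
  proof (rule sections_eqI[OF sheafify_map_extensional add_SP_extensional])
    fix x assume "x \<in> U"
    with wv obtain V a b where V: "x \<in> V" "V \<subseteq> U" "represents w V a" "represents v V b"
      by (rule sections_pairE)
    have "u V (a \<oplus>\<^bsub>PM V\<^esub> b) = u V a \<oplus>\<^bsub>PM V\<^esub> u V b"
      using V additive_map_add[OF natural_additive[OF u _ V(2)]] by (simp add: represents_def)
    then show "\<exists>V t. x \<in> V \<and> represents (sheafify_map \<X> P u U (w \<oplus>\<^bsub>msec SP U\<^esub> v)) V t \<and>
        represents (sheafify_map \<X> P u U w \<oplus>\<^bsub>msec SP U\<^esub> sheafify_map \<X> P u U v) V t"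
      using V(1) represents_map[OF u U represents_add[OF V(3,4,2)] V(2)]
        represents_add[OF represents_map[OF u U V(3,2)] represents_map[OF u U V(4,2)] V(2)] by metis
  qed
qed

text \<open>
  A germ of degree \<open>d\<close> has a homogeneous member over some neighbourhood, which agrees there with a given
  representative of \<open>w\<close> after shrinking.
\<close>

lemma mgrade_SP:
  assumes grade: "\<And>V d. opn V \<Longrightarrow> mgrade (PM V) d \<subseteq> carrier (PM V)"
    and res_grade: "\<And>V W d. \<lbrakk>opn V; opn W; W \<subseteq> V\<rbrakk> \<Longrightarrow> mres P V W ` mgrade (PM V) d \<subseteq> mgrade (PM W) d"
    and U: "opn U"
  shows "w \<in> mgrade (msec SP U) d \<longleftrightarrow> w \<in> extensional U \<and>
    (\<forall>x\<in>U. \<exists>V. x \<in> V \<and> V \<subseteq> U \<and> (\<exists>t\<in>mgrade (PM V) d. represents w V t))"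
proof -
  have 1: "w \<in> mgrade (msec SP U) d \<longleftrightarrow> w \<in> sections U \<and>
     (\<forall>x\<in>U. \<exists>V t. w x = pgerm \<X> P x V t \<and> opn V \<and> x \<in> V \<and> t \<in> mgrade (PM V) d)"
    by (simp add: sheafify_def germs_at_def)
  have germ_rep: "\<exists>V. x \<in> V \<and> V \<subseteq> U \<and> (\<exists>t\<in>mgrade (PM V) d. represents w V t)"
    if w: "w \<in> sections U" and x: "x \<in> U" and t: "w x = pgerm \<X> P x V t" "opn V" "x \<in> V" "t \<in> mgrade (PM V) d"
    for x V t
  proof -
    from w x obtain Z s where Z: "x \<in> Z" "Z \<subseteq> U" "represents w Z s" by (rule sectionsE)
    then have Zo: "opn Z" "s \<in> carrier (PM Z)" by (auto simp: represents_def)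
    have "pgerm \<X> P x V t = pgerm \<X> P x Z s" using Z t by (simp add: represents_def)
    then obtain W where W: "opn W" "x \<in> W" "W \<subseteq> V" "W \<subseteq> Z" "mres P V W t = mres P Z W s"
      using Z(1) Zo by (elim germ_eqD)
    have "mres P V W t \<in> mgrade (PM W) d" using res_grade W t by blast
    moreover have "represents w W (mres P V W t)" using represents_restrict[OF Z(3) W(1,4)] W(5) by simp
    ultimately show ?thesis using W Z by blast
  qed
  have "w \<in> mgrade (msec SP U) d"
    if "w \<in> extensional U" and
      r: "\<forall>x\<in>U. \<exists>V. x \<in> V \<and> V \<subseteq> U \<and> (\<exists>t\<in>mgrade (PM V) d. represents w V t)"
    unfolding 1
  proof (intro conjI ballI)
    show "w \<in> sections U" using that unfolding sections_iff by blast
    fix x assume "x \<in> U"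
    with r obtain V t where "x \<in> V" "t \<in> mgrade (PM V) d" "represents w V t" by blast
    then show "\<exists>V t. w x = pgerm \<X> P x V t \<and> opn V \<and> x \<in> V \<and> t \<in> mgrade (PM V) d"
      by (auto simp: represents_def)
  qed
  moreover have "w \<in> extensional U \<and> (\<forall>x\<in>U. \<exists>V. x \<in> V \<and> V \<subseteq> U \<and> (\<exists>t\<in>mgrade (PM V) d. represents w V t))"
    if "w \<in> mgrade (msec SP U) d"
  proof (intro conjI ballI)
    have w: "w \<in> sections U" using that unfolding 1 by blast
    then show "w \<in> extensional U" unfolding sections_iff by blast
    fix x assume x: "x \<in> U"
    with that obtain V t where "w x = pgerm \<X> P x V t" "opn V" "x \<in> V" "t \<in> mgrade (PM V) d"
      unfolding 1 by blast
    with w x show "\<exists>V. x \<in> V \<and> V \<subseteq> U \<and> (\<exists>t\<in>mgrade (PM V) d. represents w V t)"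
      by (rule germ_rep)
  qed
  ultimately show ?thesis by (intro iffI) simp_all
qed

end

section \<open>The tensor product sheaf\<close>

lemma odd_endomorphism_odd_map:
  "odd_endomorphism \<X> S \<psi> \<Longrightarrow> openin (topo \<X>) U \<Longrightarrow> odd_map (sec \<X> U) (msec S U) (\<psi> U)"
  by (auto simp: odd_endomorphism_def odd_map_def additive_map_def)

lemma odd_endomorphism_res:
  "\<lbrakk>odd_endomorphism \<X> S \<psi>; openin (topo \<X>) U; openin (topo \<X>) V; V \<subseteq> U; s \<in> carrier (msec S U)\<rbrakk> \<Longrightarrow>
    \<psi> V (mres S U V s) = mres S U V (\<psi> U s)"
  by (auto simp: odd_endomorphism_def)

lemma presheaf_res:
  "\<lbrakk>presheaf T F r; openin T U; openin T V; openin T W; W \<subseteq> V; V \<subseteq> U; s \<in> F U\<rbrakk> \<Longrightarrow>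
    r V W (r U V s) = r U W s"
  by (simp add: presheaf_def)

lemma presheaf_self: "\<lbrakk>presheaf T F r; openin T U; s \<in> F U\<rbrakk> \<Longrightarrow> r U U s = s"
  by (simp add: presheaf_def)

lemma sheaf_of_modules_res:
  assumes "sheaf_of_modules \<X> S" "openin (topo \<X>) U" "openin (topo \<X>) V" "V \<subseteq> U"
  shows "additive_map (msec S U) (msec S V) (mres S U V)"
    "\<And>f s. f \<in> carrier (sec \<X> U) \<Longrightarrow> s \<in> carrier (msec S U) \<Longrightarrow>
      mres S U V (f \<odot>\<^bsub>msec S U\<^esub> s) = res \<X> U V f \<odot>\<^bsub>msec S V\<^esub> mres S U V s"
    "\<And>i. mres S U V ` mgrade (msec S U) i \<subseteq> mgrade (msec S V) i"
  using assms by (simp_all add: sheaf_of_modules_def sheaf_def presheaf_def additive_map_def)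

locale sheaf_pair =
  fixes \<X> :: "('x, 'a) superspace" and S :: "('x, 'a, 'm) msheaf" and S' :: "('x, 'a, 'n) msheaf"
  assumes locally_superringed: "locally_superringed \<X>"
    and sheaf_left: "sheaf_of_modules \<X> S" and sheaf_right: "sheaf_of_modules \<X> S'"
begin

abbreviation "op \<equiv> openin (topo \<X>)"
abbreviation "Xtop \<equiv> topspace (topo \<X>)"
abbreviation "P \<equiv> tensor_presheaf \<X> S S'"
abbreviation "TS \<equiv> tensor_sheaf \<X> S S'"
abbreviation "PM \<equiv> msec P"
abbreviation "TM \<equiv> msec TS"
abbreviation "lift_op \<equiv> tensor_op \<X> S S'"
abbreviation "\<tau>S V \<equiv> twist (msec S V) (mgrade (msec S V))"
abbreviation "\<tau>S' V \<equiv> twist (msec S' V) (mgrade (msec S' V))"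
abbreviation "\<tau>O V \<equiv> twist (sec \<X> V) (grade (sec \<X> V))"
abbreviation "semi V \<equiv> semilinear_pair (sec \<X> V) (msec S V) (msec S' V) (sec \<X> V) (msec S V) (msec S' V)"
abbreviation "lift V \<equiv> tensor_map (sec \<X> V) (msec S V) (msec S' V) (sec \<X> V) (msec S V) (msec S' V)"

lemma tensor_pair: "op V \<Longrightarrow> tensor_pair (sec \<X> V) (msec S V) (msec S' V)"
  using sheaf_left sheaf_right by (simp add: sheaf_of_modules_def tensor_pair_def)

lemma module_left: "op V \<Longrightarrow> super_module (sec \<X> V) (msec S V)"
  and module_right: "op V \<Longrightarrow> super_module (sec \<X> V) (msec S' V)"
  using sheaf_left sheaf_right by (simp_all add: sheaf_of_modules_def)

lemma ring_sec: "op V \<Longrightarrow> superring (sec \<X> V)"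
  using locally_superringed by (simp add: locally_superringed_def sheaf_of_superrings_def)

lemma res_hom: "\<lbrakk>op U; op V; V \<subseteq> U\<rbrakk> \<Longrightarrow> res \<X> U V \<in> superring_hom (sec \<X> U) (sec \<X> V)"
  using locally_superringed by (simp add: locally_superringed_def sheaf_of_superrings_def)

lemma res_additive: "\<lbrakk>op U; op V; V \<subseteq> U\<rbrakk> \<Longrightarrow> additive_map (sec \<X> U) (sec \<X> V) (res \<X> U V)"
  using res_hom[of U V] by (auto simp: superring_hom_def additive_map_def ring_hom_def)

lemma res_grade: "\<lbrakk>op U; op V; V \<subseteq> U; f \<in> grade (sec \<X> U) i\<rbrakk> \<Longrightarrow> res \<X> U V f \<in> grade (sec \<X> V) i"
  using res_hom[of U V] by (auto simp: superring_hom_def)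

lemmas res_closed = additive_map_closed[OF res_additive]

lemma presheaf_sec: "presheaf (topo \<X>) (\<lambda>U. carrier (sec \<X> U)) (res \<X>)"
  using locally_superringed by (simp add: locally_superringed_def sheaf_of_superrings_def sheaf_def)

lemma presheaf_left: "presheaf (topo \<X>) (\<lambda>U. carrier (msec S U)) (mres S)"
  and presheaf_right: "presheaf (topo \<X>) (\<lambda>U. carrier (msec S' U)) (mres S')"
  using sheaf_left sheaf_right by (simp_all add: sheaf_of_modules_def sheaf_def)

lemma res_res:
  assumes "op U" "op V" "op W" "W \<subseteq> V" "V \<subseteq> U" "f \<in> carrier (sec \<X> U)"
  shows "res \<X> V W (res \<X> U V f) = res \<X> U W f"
  by (rule presheaf_res[OF presheaf_sec assms])

lemma res_self: "op U \<Longrightarrow> f \<in> carrier (sec \<X> U) \<Longrightarrow> res \<X> U U f = f"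
  by (rule presheaf_self[OF presheaf_sec])

lemma res_one: "\<lbrakk>op U; op V; V \<subseteq> U\<rbrakk> \<Longrightarrow> res \<X> U V \<one>\<^bsub>sec \<X> U\<^esub> = \<one>\<^bsub>sec \<X> V\<^esub>"
  and res_mult: "\<lbrakk>op U; op V; V \<subseteq> U; f \<in> carrier (sec \<X> U); g \<in> carrier (sec \<X> U)\<rbrakk> \<Longrightarrow>
    res \<X> U V (f \<otimes>\<^bsub>sec \<X> U\<^esub> g) = res \<X> U V f \<otimes>\<^bsub>sec \<X> V\<^esub> res \<X> U V g"
  using res_hom[of U V] by (auto simp: superring_hom_def ring_hom_def)

lemma res_zero: "\<lbrakk>op U; op V; V \<subseteq> U\<rbrakk> \<Longrightarrow> res \<X> U V \<zero>\<^bsub>sec \<X> U\<^esub> = \<zero>\<^bsub>sec \<X> V\<^esub>"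
  by (intro additive_map_zero res_additive ring.is_abelian_group superring.axioms(1) ring_sec)

lemma graded_sec: "op V \<Longrightarrow> graded_group (sec \<X> V) (grade (sec \<X> V))"
proof -
  assume "op V" then interpret superring "sec \<X> V" by (rule ring_sec)
  show ?thesis by unfold_locales
qed

lemma graded_left: "op V \<Longrightarrow> graded_group (msec S V) (mgrade (msec S V))"
proof -
  assume "op V" then interpret super_module "sec \<X> V" "msec S V" by (rule module_left)
  show ?thesis by unfold_locales
qed

lemma graded_right: "op V \<Longrightarrow> graded_group (msec S' V) (mgrade (msec S' V))"
proof -
  assume "op V" then interpret super_module "sec \<X> V" "msec S' V" by (rule module_right)
  show ?thesis by unfold_locales
qed

lemma res_twist:
  "\<lbrakk>op U; op V; V \<subseteq> U; f \<in> carrier (sec \<X> U)\<rbrakk> \<Longrightarrow> \<tau>O V (res \<X> U V f) = res \<X> U V (\<tau>O U f)"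
  by (rule additive_map_twist[OF graded_sec graded_sec res_additive]) (auto simp: res_grade)

end

locale sheaf_pair_res = sheaf_pair +
  fixes U V
  assumes U: "op U" and V: "op V" and sub: "V \<subseteq> U"
begin

lemmas mres_left = sheaf_of_modules_res[OF sheaf_left U V sub]
lemmas mres_right = sheaf_of_modules_res[OF sheaf_right U V sub]

lemma mres_left_twist: "s \<in> carrier (msec S U) \<Longrightarrow> \<tau>S V (mres S U V s) = mres S U V (\<tau>S U s)"
  by (rule additive_map_twist[OF graded_left[OF U] graded_left[OF V] mres_left(1,3)])

lemma mres_right_twist: "s \<in> carrier (msec S' U) \<Longrightarrow> \<tau>S' V (mres S' U V s) = mres S' U V (\<tau>S' U s)"
  by (rule additive_map_twist[OF graded_right[OF U] graded_right[OF V] mres_right(1,3)])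

sublocale LU: super_module "sec \<X> U" "msec S U" by (rule module_left[OF U])
sublocale RU: super_module "sec \<X> U" "msec S' U" by (rule module_right[OF U])

lemma res_hpart:
  "f \<in> carrier (sec \<X> U) \<Longrightarrow> hpart (sec \<X> V) (grade (sec \<X> V)) i (res \<X> U V f) = res \<X> U V (hpart (sec \<X> U) (grade (sec \<X> U)) i f)"
  by (rule additive_map_hpart[OF graded_sec[OF U] graded_sec[OF V] res_additive[OF U V sub]])
    (auto simp: res_grade U V sub)

text \<open>
  Restriction preserves degrees, hence commutes with the signs in the right action.
\<close>

lemma mres_left_rsmult:
  assumes "f \<in> carrier (sec \<X> U)" "s \<in> carrier (msec S U)"
  shows "mres S U V (rsmult (sec \<X> U) (msec S U) s f) = rsmult (sec \<X> V) (msec S V) (mres S U V s) (res \<X> U V f)"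
  using assms LU.hpart_R_closed LU.MG.twist_closed
  by (simp add: rsmult_def additive_map_add[OF mres_left(1)] LU.smult_closed mres_left(2)
      res_hpart mres_left_twist)

lemma mres_right_rsmult:
  assumes "f \<in> carrier (sec \<X> U)" "s \<in> carrier (msec S' U)"
  shows "mres S' U V (rsmult (sec \<X> U) (msec S' U) s f) = rsmult (sec \<X> V) (msec S' V) (mres S' U V s) (res \<X> U V f)"
  using assms RU.hpart_R_closed RU.MG.twist_closed
  by (simp add: rsmult_def additive_map_add[OF mres_right(1)] RU.smult_closed mres_right(2)
      res_hpart mres_right_twist)

lemma semilinear_res:
  "semilinear_pair (sec \<X> U) (msec S U) (msec S' U) (sec \<X> V) (msec S V) (msec S' V)
    (res \<X> U V) (mres S U V) (mres S' U V)"
  using U V sub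
  by (auto simp: semilinear_pair_def mres_left(1) mres_right(1) mres_left_rsmult mres_right(2) res_closed)

sublocale hom: tensor_hom "sec \<X> U" "msec S U" "msec S' U" "sec \<X> V" "msec S V" "msec S' V"
    "res \<X> U V" "mres S U V" "mres S' U V"
  by (intro tensor_hom.intro tensor_hom_axioms.intro tensor_pair U V semilinear_res)

lemma mres_P: "mres P U V = tensor_map (sec \<X> U) (msec S U) (msec S' U) (sec \<X> V) (msec S V) (msec S' V)
    (mres S U V) (mres S' U V)"
  by (simp add: tensor_presheaf_def)

lemma mres_P_grade:
  assumes "t \<in> mgrade (tensor_module (sec \<X> U) (msec S U) (msec S' U)) d"
  shows "mres P U V t \<in> mgrade (tensor_module (sec \<X> V) (msec S V) (msec S' V)) d"
  using assms
proof (induction rule: hom.D.tensor_grade_induct)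
  case (pure x y i j)
  then have "mres S U V x \<in> mgrade (msec S V) i" "mres S' U V y \<in> mgrade (msec S' V) j"
    using mres_left(3) mres_right(3) by blast+
  from hom.C.tensor_grade_pure[OF this] show ?case
    using pure hom.tensor_map_pure[OF LU.MG.gr_closed RU.MG.gr_closed, OF pure(1,2)] by (simp add: mres_P)
next
  case (diff s t)
  then show ?case
    using hom.C.tensor_grade_diff[of "mres P U V s" d "mres P U V t"]
    by (simp add: a_minus_def mres_P additive_map_add[OF hom.tensor_map_additive] hom.tensor_map_minus)
qed

end

context sheaf_pair
begin

lemma sheaf_pair_res: "op U \<Longrightarrow> op V \<Longrightarrow> V \<subseteq> U \<Longrightarrow> sheaf_pair_res \<X> S S' U V"
  by (simp add: sheaf_pair_res_def sheaf_pair_res_axioms_def sheaf_pair_axioms)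

lemma msec_P: "PM V = tensor_module (sec \<X> V) (msec S V) (msec S' V)"
  by (simp add: tensor_presheaf_def)

lemmas mres_self = presheaf_self[OF presheaf_left] presheaf_self[OF presheaf_right]
lemmas mres_left_mres = presheaf_res[OF presheaf_left]
lemmas mres_right_mres = presheaf_res[OF presheaf_right]

lemma mres_P_additive: "op U \<Longrightarrow> op V \<Longrightarrow> V \<subseteq> U \<Longrightarrow> additive_map (PM U) (PM V) (mres P U V)"
proof -
  assume "op U" "op V" "V \<subseteq> U" then interpret sheaf_pair_res \<X> S S' U V by (rule sheaf_pair_res)
  show ?thesis unfolding mres_P msec_P by (rule hom.tensor_map_additive)
qed

lemma mres_P_pure:
  assumes "op U" "op V" "V \<subseteq> U" "x \<in> carrier (msec S U)" "y \<in> carrier (msec S' U)"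
  shows "mres P U V (pure (sec \<X> U) (msec S U) (msec S' U) x y) =
    pure (sec \<X> V) (msec S V) (msec S' V) (mres S U V x) (mres S' U V y)"
proof -
  interpret sheaf_pair_res \<X> S S' U V using assms(1-3) by (rule sheaf_pair_res)
  show ?thesis unfolding mres_P using assms by (intro hom.tensor_map_pure)
qed

lemma presheaf_P: "presheaf (topo \<X>) (\<lambda>U. carrier (PM U)) (mres P)"
  unfolding presheaf_def
proof (intro conjI allI impI ballI)
  fix U V assume "op U \<and> op V \<and> V \<subseteq> U"
  then show "mres P U V \<in> carrier (PM U) \<rightarrow> carrier (PM V)"
    using additive_map_closed[OF mres_P_additive, of U V] by blast
next
  fix U t assume U: "op U" and t: "t \<in> carrier (PM U)"
  interpret tensor_pair "sec \<X> U" "msec S U" "msec S' U" using U by (rule tensor_pair)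
  show "mres P U U t = t"
    by (rule tensor_eqI[of "mres P U U" "\<lambda>t. t"])
      (use U t mres_P_additive[OF U U] in \<open>simp_all add: msec_P additive_map_id_T mres_P_pure mres_self\<close>)
next
  fix U V W t assume "op U \<and> op V \<and> op W \<and> W \<subseteq> V \<and> V \<subseteq> U" and t: "t \<in> carrier (PM U)"
  then have o: "op U" "op V" "op W" "W \<subseteq> V" "V \<subseteq> U" "W \<subseteq> U" by auto
  interpret D: tensor_pair "sec \<X> U" "msec S U" "msec S' U" using o(1) by (rule tensor_pair)
  interpret C: tensor_pair "sec \<X> W" "msec S W" "msec S' W" using o(3) by (rule tensor_pair)
  interpret UV: sheaf_pair_res \<X> S S' U V using o(1,2,5) by (rule sheaf_pair_res)
  have comp: "additive_map (PM U) (PM W) (\<lambda>t. mres P V W (mres P U V t))"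
    by (rule additive_map_comp[OF mres_P_additive[OF o(1,2,5)] mres_P_additive[OF o(2,3,4)]])
  show "mres P V W (mres P U V t) = mres P U W t"
    by (rule D.additive_eqI[OF C.T.abelian_group_axioms, of "\<lambda>t. mres P V W (mres P U V t)" "mres P U W"])
      (use o t comp mres_P_additive[OF o(1,3,6)] additive_map_closed[OF UV.mres_left(1)]
        additive_map_closed[OF UV.mres_right(1)] in
        \<open>simp_all add: msec_P mres_P_pure mres_left_mres mres_right_mres\<close>)
qed

sublocale PS: presheaf_of_groups \<X> P
proof (rule presheaf_of_groups.intro)
  fix U assume "op U"
  then interpret tensor_pair "sec \<X> U" "msec S U" "msec S' U" by (rule tensor_pair)
  show "abelian_group (PM U)" unfolding msec_P by (rule tensor_abelian_group)
qed (rule presheaf_P, rule mres_P_additive)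

abbreviation "represents \<equiv> PS.represents"
abbreviation "sections \<equiv> PS.sections"

lemma TS_grade:
  "op U \<Longrightarrow> w \<in> mgrade (TM U) d \<longleftrightarrow> w \<in> extensional U \<and>
    (\<forall>x\<in>U. \<exists>V. x \<in> V \<and> V \<subseteq> U \<and> (\<exists>t\<in>mgrade (PM V) d. represents w V t))"
  unfolding tensor_sheaf_def
proof (rule PS.mgrade_SP)
  fix V d assume "op V"
  then interpret tensor_pair "sec \<X> V" "msec S V" "msec S' V" by (rule tensor_pair)
  show "mgrade (PM V) d \<subseteq> carrier (PM V)" unfolding msec_P using tensor_grade_closed by blast
next
  fix V W d assume "op V" "op W" "W \<subseteq> V"
  then interpret sheaf_pair_res \<X> S S' V W by (rule sheaf_pair_res)
  show "mres P V W ` mgrade (PM V) d \<subseteq> mgrade (PM W) d"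
    unfolding msec_P using mres_P_grade by blast
qed

text \<open>
  Semilinear pairs of operators over the open subsets of \<open>U\<close>, compatible with restriction: the data that
  induce an operator on the sections of the tensor product sheaf over \<open>U\<close>.
\<close>

definition family where
  "family U \<sigma> g h \<longleftrightarrow>
    (\<forall>V. op V \<and> V \<subseteq> U \<longrightarrow> semi V (\<sigma> V) (g V) (h V)) \<and>
    (\<forall>V W. op V \<and> op W \<and> W \<subseteq> V \<and> V \<subseteq> U \<longrightarrow>
      (\<forall>s\<in>carrier (msec S V). g W (mres S V W s) = mres S V W (g V s)) \<and>
      (\<forall>s\<in>carrier (msec S' V). h W (mres S' V W s) = mres S' V W (h V s)))"

lemma family_natural:
  assumes fam: "family U \<sigma> g h"
  shows "PS.natural U (\<lambda>V. lift V (g V) (h V))"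
  unfolding PS.natural_def
proof (intro conjI allI impI ballI)
  fix V assume V: "op V \<and> V \<subseteq> U"
  then interpret tensor_pair "sec \<X> V" "msec S V" "msec S' V" by (simp add: tensor_pair)
  show "additive_map (PM V) (PM V) (lift V (g V) (h V))"
    unfolding msec_P using fam V by (intro tmap_additive[of "\<sigma> V"]) (simp add: family_def)
next
  fix V W t assume "op V \<and> op W \<and> W \<subseteq> V \<and> V \<subseteq> U" and t: "t \<in> carrier (PM V)"
  then have o: "op V" "op W" "W \<subseteq> V" "V \<subseteq> U" "W \<subseteq> U" by auto
  have s: "semi V (\<sigma> V) (g V) (h V)" "semi W (\<sigma> W) (g W) (h W)" using fam o by (auto simp: family_def)
  interpret VW: sheaf_pair_res \<X> S S' V W using o(1-3) by (rule sheaf_pair_res)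
  have ad: "additive_map (PM V) (PM V) (lift V (g V) (h V))" "additive_map (PM W) (PM W) (lift W (g W) (h W))"
    unfolding msec_P by (rule VW.hom.D.tmap_additive[OF s(1)], rule VW.hom.C.tmap_additive[OF s(2)])
  have ad2: "additive_map (PM V) (PM W) (\<lambda>t. lift W (g W) (h W) (mres P V W t))"
    "additive_map (PM V) (PM W) (\<lambda>t. mres P V W (lift V (g V) (h V) t))"
    using additive_map_comp[OF mres_P_additive[OF o(1-3)] ad(2)]
      additive_map_comp[OF ad(1) mres_P_additive[OF o(1-3)]] .
  have clos: "g V x \<in> carrier (msec S V)" "h V y \<in> carrier (msec S' V)"
    "g W (mres S V W x) = mres S V W (g V x)" "h W (mres S' V W y) = mres S' V W (h V y)"
    if "x \<in> carrier (msec S V)" "y \<in> carrier (msec S' V)" for x y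
    using that s(1) fam o by (auto simp: family_def semilinear_pair_def additive_map_def)
  show "lift W (g W) (h W) (mres P V W t) = mres P V W (lift V (g V) (h V) t)"
    by (rule VW.hom.D.additive_eqI[OF VW.hom.C.T.abelian_group_axioms, of "\<lambda>t. lift W (g W) (h W) (mres P V W t)"
          "\<lambda>t. mres P V W (lift V (g V) (h V) t)"])
      (use ad2 t o clos additive_map_closed[OF VW.mres_left(1)] additive_map_closed[OF VW.mres_right(1)] in
       \<open>simp_all add: msec_P mres_P_pure VW.hom.D.tmap_pure[OF s(1)] VW.hom.C.tmap_pure[OF s(2)]\<close>)
qed

end

context sheaf_pair
begin

lemma carrier_TS: "carrier (TM U) = sections U"
  by (simp add: tensor_sheaf_def PS.carrier_SP)

lemma mres_TS: "mres TS U V w = restrict w V"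
  by (simp add: tensor_sheaf_def PS.mres_SP)

lemma TS_abelian_group: "op U \<Longrightarrow> abelian_group (TM U)"
  unfolding tensor_sheaf_def by (rule PS.SP_abelian_group)

lemmas represents_add = PS.represents_add[folded tensor_sheaf_def]
lemmas represents_minus = PS.represents_minus[folded tensor_sheaf_def]
lemmas represents_ksign = PS.represents_ksign[folded tensor_sheaf_def]
lemmas represents_zero = PS.represents_zero[folded tensor_sheaf_def]

lemma represents_closed: "represents w V t \<Longrightarrow> op V" "represents w V t \<Longrightarrow> t \<in> carrier (PM V)"
  by (simp_all add: PS.represents_def)

lemma tensor_op_rep:
  "\<lbrakk>family U \<sigma> g h; op U; represents w V t; V \<subseteq> U\<rbrakk> \<Longrightarrow>
    represents (lift_op g h U w) V (lift V (g V) (h V) t)"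
  unfolding tensor_op_def by (rule PS.represents_map[OF family_natural])

lemma tensor_op_additive:
  "family U \<sigma> g h \<Longrightarrow> op U \<Longrightarrow> additive_map (TM U) (TM U) (lift_op g h U)"
  unfolding tensor_op_def tensor_sheaf_def by (rule PS.sheafify_map_additive[OF family_natural])

lemma tensor_op_closed: "\<lbrakk>family U \<sigma> g h; op U; w \<in> sections U\<rbrakk> \<Longrightarrow> lift_op g h U w \<in> sections U"
  unfolding tensor_op_def by (rule PS.sheafify_map_closed[OF family_natural])

lemma tensor_op_restrict:
  assumes fam: "family U \<sigma> g h" and o: "op U" "op V" "V \<subseteq> U" and w: "w \<in> sections U"
  shows "lift_op g h V (restrict w V) = restrict (lift_op g h U w) V"
  unfolding tensor_op_def
  by (rule PS.sheafify_map_restrict[OF family_natural[OF fam] PS.natural_subset[OF family_natural[OF fam] o(3)] o w refl])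

lemma sections_extensional: "w \<in> sections U \<Longrightarrow> w \<in> extensional U"
  by (simp add: PS.sections_iff)

lemma family_smult:
  assumes U: "op U" and f: "f \<in> carrier (sec \<X> U)"
  shows "family U (\<lambda>V f. f) (\<lambda>V x. res \<X> U V f \<odot>\<^bsub>msec S V\<^esub> x) (\<lambda>V y. y)"
  unfolding family_def
proof (intro conjI allI impI ballI)
  fix V assume V: "op V \<and> V \<subseteq> U"
  then interpret tensor_pair "sec \<X> V" "msec S V" "msec S' V" by (simp add: tensor_pair)
  show "semi V (\<lambda>f. f) (\<lambda>x. res \<X> U V f \<odot>\<^bsub>msec S V\<^esub> x) (\<lambda>y. y)"
    using V U f by (intro semilin_smult res_closed) auto
next
  fix V W s assume "op V \<and> op W \<and> W \<subseteq> V \<and> V \<subseteq> U" and s: "s \<in> carrier (msec S V)"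
  then have o: "op V" "op W" "W \<subseteq> V" "V \<subseteq> U" by auto
  then interpret sheaf_pair_res \<X> S S' V W by (intro sheaf_pair_res)
  show "res \<X> U W f \<odot>\<^bsub>msec S W\<^esub> mres S V W s = mres S V W (res \<X> U V f \<odot>\<^bsub>msec S V\<^esub> s)"
    using mres_left(2)[OF res_closed[OF assms(1) o(1,4) f] s] res_res[OF assms(1) o(1-4) f] by simp
qed simp

lemma smult_TS: "f \<odot>\<^bsub>TM U\<^esub> w = lift_op (\<lambda>V x. res \<X> U V f \<odot>\<^bsub>msec S V\<^esub> x) (\<lambda>V y. y) U w"
  by (simp add: tensor_sheaf_def PS.smult_SP tensor_op_def msec_P tensor_module_def[of "sec \<X> V" for V])

lemma smult_lift: "f \<odot>\<^bsub>PM V\<^esub> t = lift V (\<lambda>x. f \<odot>\<^bsub>msec S V\<^esub> x) (\<lambda>y. y) t"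
  by (simp add: msec_P tensor_module_def)

lemma smult_rep:
  "\<lbrakk>op U; f \<in> carrier (sec \<X> U); represents w V t; V \<subseteq> U\<rbrakk> \<Longrightarrow>
    represents (f \<odot>\<^bsub>TM U\<^esub> w) V (res \<X> U V f \<odot>\<^bsub>PM V\<^esub> t)"
  unfolding smult_TS smult_lift by (rule tensor_op_rep[OF family_smult])

lemma smult_additive:
  "\<lbrakk>op U; f \<in> carrier (sec \<X> U)\<rbrakk> \<Longrightarrow> additive_map (TM U) (TM U) ((\<odot>\<^bsub>TM U\<^esub>) f)"
  unfolding smult_TS[abs_def] by (rule tensor_op_additive[OF family_smult])

lemma smult_closed:
  "\<lbrakk>op U; f \<in> carrier (sec \<X> U); w \<in> sections U\<rbrakk> \<Longrightarrow> f \<odot>\<^bsub>TM U\<^esub> w \<in> sections U"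
  unfolding smult_TS by (rule tensor_op_closed[OF family_smult])

lemma smult_extensional: "f \<odot>\<^bsub>TM U\<^esub> w \<in> extensional U"
  and add_extensional: "w \<oplus>\<^bsub>TM U\<^esub> v \<in> extensional U"
  and zero_extensional: "\<zero>\<^bsub>TM U\<^esub> \<in> extensional U"
  and op_extensional: "lift_op g h U w \<in> extensional U"
  unfolding smult_TS tensor_op_def unfolding tensor_sheaf_def
  by (simp_all only: PS.sheafify_map_extensional PS.add_SP_extensional PS.zero_SP_extensional)

lemma TS_smult_one: "op U \<Longrightarrow> w \<in> sections U \<Longrightarrow> \<one>\<^bsub>sec \<X> U\<^esub> \<odot>\<^bsub>TM U\<^esub> w = w"
proof (rule PS.sections_eqI_rep[OF _ smult_extensional sections_extensional])
  assume U: "op U"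
  fix V t assume V: "op V" "V \<subseteq> U" "t \<in> carrier (PM V)" "represents w V t"
  interpret V: tensor_pair "sec \<X> V" "msec S V" "msec S' V" using V(1) by (rule tensor_pair)
  interpret RU: superring "sec \<X> U" using U by (rule ring_sec)
  have "\<one>\<^bsub>sec \<X> V\<^esub> \<odot>\<^bsub>PM V\<^esub> t = t" using V(3) by (simp add: msec_P V.tensor_smult_one)
  then show "\<exists>s. represents (\<one>\<^bsub>sec \<X> U\<^esub> \<odot>\<^bsub>TM U\<^esub> w) V s \<and> represents w V s"
    using smult_rep[OF U RU.one_closed V(4,2)] V res_one[OF U V(1,2)] by auto
qed

lemma TS_smult_zero: "op U \<Longrightarrow> w \<in> sections U \<Longrightarrow> \<zero>\<^bsub>sec \<X> U\<^esub> \<odot>\<^bsub>TM U\<^esub> w = \<zero>\<^bsub>TM U\<^esub>"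
proof (rule PS.sections_eqI_rep[OF _ smult_extensional zero_extensional])
  assume U: "op U"
  fix V t assume V: "op V" "V \<subseteq> U" "t \<in> carrier (PM V)" "represents w V t"
  interpret V: tensor_pair "sec \<X> V" "msec S V" "msec S' V" using V(1) by (rule tensor_pair)
  interpret RU: superring "sec \<X> U" using U by (rule ring_sec)
  have "\<zero>\<^bsub>sec \<X> V\<^esub> \<odot>\<^bsub>PM V\<^esub> t = \<zero>\<^bsub>PM V\<^esub>" using V(3) by (simp add: msec_P V.tensor_smult_zero)
  then show "\<exists>s. represents (\<zero>\<^bsub>sec \<X> U\<^esub> \<odot>\<^bsub>TM U\<^esub> w) V s \<and> represents \<zero>\<^bsub>TM U\<^esub> V s"
    using smult_rep[OF U RU.zero_closed V(4,2)] represents_zero[OF U V(1,2)] res_zero[OF U V(1,2)] by auto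
qed

lemma TS_smult_assoc:
  assumes U: "op U" and f: "f \<in> carrier (sec \<X> U)" and g: "g \<in> carrier (sec \<X> U)" and w: "w \<in> sections U"
  shows "(f \<otimes>\<^bsub>sec \<X> U\<^esub> g) \<odot>\<^bsub>TM U\<^esub> w = f \<odot>\<^bsub>TM U\<^esub> (g \<odot>\<^bsub>TM U\<^esub> w)"
proof (rule PS.sections_eqI_rep[OF w smult_extensional smult_extensional])
  fix V t assume V: "op V" "V \<subseteq> U" "t \<in> carrier (PM V)" "represents w V t"
  interpret V: tensor_pair "sec \<X> V" "msec S V" "msec S' V" using V(1) by (rule tensor_pair)
  interpret RU: superring "sec \<X> U" using U by (rule ring_sec)
  have "res \<X> U V (f \<otimes>\<^bsub>sec \<X> U\<^esub> g) \<odot>\<^bsub>PM V\<^esub> t = res \<X> U V f \<odot>\<^bsub>PM V\<^esub> (res \<X> U V g \<odot>\<^bsub>PM V\<^esub> t)"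
    using U V f g by (simp add: msec_P V.tensor_smult_assoc res_mult res_closed)
  then show "\<exists>s. represents ((f \<otimes>\<^bsub>sec \<X> U\<^esub> g) \<odot>\<^bsub>TM U\<^esub> w) V s \<and>
      represents (f \<odot>\<^bsub>TM U\<^esub> (g \<odot>\<^bsub>TM U\<^esub> w)) V s"
    using smult_rep[OF U RU.m_closed[OF f g] V(4,2)] smult_rep[OF U f smult_rep[OF U g V(4,2)] V(2)] by auto
qed

text \<open>
  The grading operator: \<open>(-1)\<^sup>d\<close> on sections of degree \<open>d\<close> (lemma \<open>parity_grade\<close>).
\<close>

definition parity :: "'x set \<Rightarrow> ('x \<Rightarrow> ('x set \<times> ('m \<times> 'n \<Rightarrow>\<^sub>0 int) set) set) \<Rightarrow> ('x \<Rightarrow> ('x set \<times> ('m \<times> 'n \<Rightarrow>\<^sub>0 int) set) set)"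
  where "parity = lift_op (\<lambda>V. \<tau>S V) (\<lambda>V. \<tau>S' V)"

lemma family_twist: "family U (\<lambda>V. \<tau>O V) (\<lambda>V. \<tau>S V) (\<lambda>V. \<tau>S' V)"
  unfolding family_def
proof (intro conjI allI impI ballI)
  fix V assume "op V \<and> V \<subseteq> U"
  then interpret tensor_pair "sec \<X> V" "msec S V" "msec S' V" by (simp add: tensor_pair)
  show "semi V (\<tau>O V) (\<tau>S V) (\<tau>S' V)" by (rule semilin_twist)
next
  fix V W assume o: "op V \<and> op W \<and> W \<subseteq> V \<and> V \<subseteq> U"
  then interpret sheaf_pair_res \<X> S S' V W by (intro sheaf_pair_res) auto
  show "\<tau>S W (mres S V W s) = mres S V W (\<tau>S V s)" if "s \<in> carrier (msec S V)" for s
    using that by (rule mres_left_twist)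
  show "\<tau>S' W (mres S' V W s) = mres S' V W (\<tau>S' V s)" if "s \<in> carrier (msec S' V)" for s
    using that by (rule mres_right_twist)
qed

lemma parity_rep:
  "\<lbrakk>op U; represents w V t; V \<subseteq> U\<rbrakk> \<Longrightarrow> represents (parity U w) V (lift V (\<tau>S V) (\<tau>S' V) t)"
  unfolding parity_def by (rule tensor_op_rep[OF family_twist])

lemma parity_closed: "op U \<Longrightarrow> w \<in> sections U \<Longrightarrow> parity U w \<in> sections U"
  unfolding parity_def by (rule tensor_op_closed[OF family_twist])

lemma parity_extensional: "parity U w \<in> extensional U"
  unfolding parity_def by (rule op_extensional)

lemma grade_closed: "op U \<Longrightarrow> w \<in> mgrade (TM U) d \<Longrightarrow> w \<in> sections U"
  unfolding PS.sections_iff by (simp add: TS_grade) blast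

lemma TS_minus_closed: "op U \<Longrightarrow> w \<in> sections U \<Longrightarrow> \<ominus>\<^bsub>TM U\<^esub> w \<in> sections U"
  using abelian_group.a_inv_closed[OF TS_abelian_group] by (simp add: carrier_TS)

lemma TS_ksign_closed: "op U \<Longrightarrow> w \<in> sections U \<Longrightarrow> ksign (TM U) e w \<in> sections U"
  by (simp add: ksign_def TS_minus_closed)

lemma parity_grade:
  assumes U: "op U" and w: "w \<in> mgrade (TM U) d"
  shows "parity U w = ksign (TM U) d w"
proof (rule PS.sections_eqI)
  show "ksign (TM U) d w \<in> extensional U"
    using U w grade_closed TS_ksign_closed sections_extensional by blast
  fix x assume "x \<in> U"
  with w U obtain V t where V: "x \<in> V" "V \<subseteq> U" "t \<in> mgrade (PM V) d" "represents w V t"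
    unfolding TS_grade[OF U] by blast
  interpret V: tensor_pair "sec \<X> V" "msec S V" "msec S' V"
    using represents_closed(1)[OF V(4)] by (rule tensor_pair)
  have "lift V (\<tau>S V) (\<tau>S' V) t = ksign (PM V) d t"
    using V(3) unfolding msec_P by (rule V.tw_grade)
  then show "\<exists>V t. x \<in> V \<and> represents (parity U w) V t \<and> represents (ksign (TM U) d w) V t"
    using V(1) parity_rep[OF U V(4,2)] represents_ksign[OF U grade_closed[OF U w] V(2,4)] by metis
qed (rule parity_extensional)

definition projection where
  "projection h U d w = res \<X> Xtop U h \<odot>\<^bsub>TM U\<^esub> (w \<oplus>\<^bsub>TM U\<^esub> ksign (TM U) d (parity U w))"

context
  fixes h assumes h: "h \<in> carrier (sec \<X> Xtop)"
    and half: "h \<oplus>\<^bsub>sec \<X> Xtop\<^esub> h = \<one>\<^bsub>sec \<X> Xtop\<^esub>"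
begin

lemma half_res:
  assumes "op U"
  shows "res \<X> Xtop U h \<in> carrier (sec \<X> U)"
    and "res \<X> Xtop U h \<oplus>\<^bsub>sec \<X> U\<^esub> res \<X> Xtop U h = \<one>\<^bsub>sec \<X> U\<^esub>"
  using assms h half openin_subset[OF assms] additive_map_add[OF res_additive[OF _ assms], of "Xtop" h h]
    res_closed[OF _ assms, of "Xtop" h]
  by (simp_all add: res_one)

lemma projection_rep:
  assumes U: "op U" and w: "w \<in> sections U" and V: "V \<subseteq> U" "represents w V t"
  shows "represents (projection h U d w) V (res \<X> Xtop V h \<odot>\<^bsub>PM V\<^esub>
    (t \<oplus>\<^bsub>PM V\<^esub> ksign (PM V) d (lift V (\<tau>S V) (\<tau>S' V) t)))"
proof -
  have Vo: "op V" using V(2) by (rule represents_closed)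
  have "res \<X> U V (res \<X> Xtop U h) = res \<X> Xtop V h"
    using res_res[of "Xtop" U V h] U Vo V(1) openin_subset[OF U] h by simp
  then show ?thesis
    unfolding projection_def
    using smult_rep[OF U half_res(1)[OF U] represents_add[OF V(2) represents_ksign[OF U parity_closed[OF U w] V(1)
      parity_rep[OF U V(2,1)]] V(1)] V(1), of d] by simp
qed

lemma projection_grade:
  assumes U: "op U" and w: "w \<in> sections U"
  shows "projection h U d w \<in> mgrade (TM U) d"
  unfolding TS_grade[OF U]
proof (intro conjI ballI)
  show "projection h U d w \<in> extensional U" unfolding projection_def by (rule smult_extensional)
  fix x assume "x \<in> U"
  with w obtain V t where V: "x \<in> V" "V \<subseteq> U" "represents w V t" by (rule PS.sectionsE)
  have Vo: "op V" "t \<in> carrier (PM V)" using represents_closed[OF V(3)] by auto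
  interpret V: tensor_pair "sec \<X> V" "msec S V" "msec S' V" using Vo(1) by (rule tensor_pair)
  have "res \<X> Xtop V h \<odot>\<^bsub>PM V\<^esub> (t \<oplus>\<^bsub>PM V\<^esub> ksign (PM V) d (lift V (\<tau>S V) (\<tau>S' V) t))
    \<in> mgrade (PM V) d"
    using Vo half_res[OF Vo(1)] unfolding msec_P by (intro V.tensor_projection_grade)
  then show "\<exists>V. x \<in> V \<and> V \<subseteq> U \<and> (\<exists>t\<in>mgrade (PM V) d. represents (projection h U d w) V t)"
    using V projection_rep[OF U w V(2,3)] by blast
qed

lemma projection_sum:
  assumes U: "op U" and w: "w \<in> sections U"
  shows "projection h U 0 w \<oplus>\<^bsub>TM U\<^esub> projection h U 1 w = w"
proof (rule PS.sections_eqI_rep[OF w add_extensional sections_extensional[OF w]])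
  fix V t assume V: "op V" "V \<subseteq> U" "t \<in> carrier (PM V)" "represents w V t"
  interpret V: tensor_pair "sec \<X> V" "msec S V" "msec S' V" using V(1) by (rule tensor_pair)
  show "\<exists>s. represents (projection h U 0 w \<oplus>\<^bsub>TM U\<^esub> projection h U 1 w) V s \<and> represents w V s"
    using represents_add[OF projection_rep[OF U w V(2,4), of 0] projection_rep[OF U w V(2,4), of 1] V(2)]
      V.tensor_projection_sum[OF V(3)[unfolded msec_P] half_res[OF V(1)]] V(4) unfolding msec_P by metis
qed

end

end

section \<open>The equalizer defined by two odd endomorphisms\<close>

locale odd_pair = sheaf_pair +
  fixes \<psi> \<psi>'
  assumes odd_left: "odd_endomorphism \<X> S \<psi>" and odd_right: "odd_endomorphism \<X> S' \<psi>'"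
begin

definition "left_apply = lift_op \<psi> (\<lambda>V s'. s')"
definition "right_apply = lift_op (\<lambda>V. \<tau>S V) \<psi>'"
definition "equalizer U = {w \<in> sections U. left_apply U w = right_apply U w}"

lemma odd_map_left: "op V \<Longrightarrow> odd_map (sec \<X> V) (msec S V) (\<psi> V)"
  by (rule odd_endomorphism_odd_map[OF odd_left])

lemma odd_map_right: "op V \<Longrightarrow> odd_map (sec \<X> V) (msec S' V) (\<psi>' V)"
  by (rule odd_endomorphism_odd_map[OF odd_right])

lemma left_closed: "op V \<Longrightarrow> s \<in> carrier (msec S V) \<Longrightarrow> \<psi> V s \<in> carrier (msec S V)"
  using odd_map_left[of V] additive_map_closed[of "msec S V" "msec S V" "\<psi> V"] unfolding odd_map_def by blast

lemma right_closed: "op V \<Longrightarrow> s \<in> carrier (msec S' V) \<Longrightarrow> \<psi>' V s \<in> carrier (msec S' V)"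
  using odd_map_right[of V] additive_map_closed[of "msec S' V" "msec S' V" "\<psi>' V"] unfolding odd_map_def by blast

lemma family_left: "family U (\<lambda>V f. f) \<psi> (\<lambda>V s'. s')"
  unfolding family_def
proof (intro conjI allI impI ballI)
  fix V assume V: "op V \<and> V \<subseteq> U"
  then interpret tensor_pair "sec \<X> V" "msec S V" "msec S' V" by (simp add: tensor_pair)
  show "semi V (\<lambda>f. f) (\<psi> V) (\<lambda>s'. s')" using V by (intro semilin_left odd_map_left) simp
qed (use odd_endomorphism_res[OF odd_left] in auto)

lemma family_right: "family U (\<lambda>V. \<tau>O V) (\<lambda>V. \<tau>S V) \<psi>'"
  unfolding family_def
proof (intro conjI allI impI ballI)
  fix V assume V: "op V \<and> V \<subseteq> U"
  then interpret tensor_pair "sec \<X> V" "msec S V" "msec S' V" by (simp add: tensor_pair)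
  show "semi V (\<tau>O V) (\<tau>S V) (\<psi>' V)" using V by (intro semilin_right odd_map_right) simp
next
  fix V W s assume o: "op V \<and> op W \<and> W \<subseteq> V \<and> V \<subseteq> U" and s: "s \<in> carrier (msec S V)"
  then interpret sheaf_pair_res \<X> S S' V W by (intro sheaf_pair_res) auto
  show "\<tau>S W (mres S V W s) = mres S V W (\<tau>S V s)" using s by (rule mres_left_twist)
qed (use odd_endomorphism_res[OF odd_right] in auto)

lemma left_rep:
  "\<lbrakk>op U; represents w V t; V \<subseteq> U\<rbrakk> \<Longrightarrow> represents (left_apply U w) V (lift V (\<psi> V) (\<lambda>s'. s') t)"
  unfolding left_apply_def by (rule tensor_op_rep[OF family_left])

lemma right_rep:
  "\<lbrakk>op U; represents w V t; V \<subseteq> U\<rbrakk> \<Longrightarrow> represents (right_apply U w) V (lift V (\<tau>S V) (\<psi>' V) t)"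
  unfolding right_apply_def by (rule tensor_op_rep[OF family_right])

lemma left_apply_closed: "op U \<Longrightarrow> w \<in> sections U \<Longrightarrow> left_apply U w \<in> sections U"
  unfolding left_apply_def by (rule tensor_op_closed[OF family_left])

lemma right_apply_closed: "op U \<Longrightarrow> w \<in> sections U \<Longrightarrow> right_apply U w \<in> sections U"
  unfolding right_apply_def by (rule tensor_op_closed[OF family_right])

lemma left_apply_additive: "op U \<Longrightarrow> additive_map (TM U) (TM U) (left_apply U)"
  unfolding left_apply_def by (rule tensor_op_additive[OF family_left])

lemma right_apply_additive: "op U \<Longrightarrow> additive_map (TM U) (TM U) (right_apply U)"
  unfolding right_apply_def by (rule tensor_op_additive[OF family_right])

lemma apply_extensional: "left_apply U w \<in> extensional U" "right_apply U w \<in> extensional U"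
  by (simp_all add: left_apply_def right_apply_def op_extensional)

lemma twist_sec_closed: "op U \<Longrightarrow> f \<in> carrier (sec \<X> U) \<Longrightarrow> \<tau>O U f \<in> carrier (sec \<X> U)"
  by (rule graded_group.twist_closed[OF graded_sec])

text \<open>
  Both operators are semilinear over the same sign automorphism of the structure sheaf, which makes
  their equalizer a submodule.
\<close>

lemma apply_smult:
  assumes U: "op U" and f: "f \<in> carrier (sec \<X> U)" and w: "w \<in> sections U"
  shows "left_apply U (f \<odot>\<^bsub>TM U\<^esub> w) = \<tau>O U f \<odot>\<^bsub>TM U\<^esub> left_apply U w"
    and "right_apply U (f \<odot>\<^bsub>TM U\<^esub> w) = \<tau>O U f \<odot>\<^bsub>TM U\<^esub> right_apply U w"
proof -
  have rep: "\<exists>s. represents (left_apply U (f \<odot>\<^bsub>TM U\<^esub> w)) V s \<and>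
        represents (\<tau>O U f \<odot>\<^bsub>TM U\<^esub> left_apply U w) V s"
      "\<exists>s. represents (right_apply U (f \<odot>\<^bsub>TM U\<^esub> w)) V s \<and>
        represents (\<tau>O U f \<odot>\<^bsub>TM U\<^esub> right_apply U w) V s"
    if V: "op V" "V \<subseteq> U" "t \<in> carrier (PM V)" "represents w V t" for V t
  proof -
    interpret V: tensor_pair "sec \<X> V" "msec S V" "msec S' V" using V(1) by (rule tensor_pair)
    have c: "res \<X> U V f \<in> carrier (sec \<X> V)" using U V f by (intro res_closed)
    note tw = res_twist[OF U V(1,2) f]
    show "\<exists>s. represents (left_apply U (f \<odot>\<^bsub>TM U\<^esub> w)) V s \<and>
        represents (\<tau>O U f \<odot>\<^bsub>TM U\<^esub> left_apply U w) V s"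
      using left_rep[OF U smult_rep[OF U f V(4,2)] V(2)]
        smult_rep[OF U twist_sec_closed[OF U f] left_rep[OF U V(4,2)] V(2)]
        V.left_op_smult[OF odd_map_left[OF V(1)] V(3)[unfolded msec_P] c]
      unfolding tw msec_P by auto
    show "\<exists>s. represents (right_apply U (f \<odot>\<^bsub>TM U\<^esub> w)) V s \<and>
        represents (\<tau>O U f \<odot>\<^bsub>TM U\<^esub> right_apply U w) V s"
      using right_rep[OF U smult_rep[OF U f V(4,2)] V(2)]
        smult_rep[OF U twist_sec_closed[OF U f] right_rep[OF U V(4,2)] V(2)]
        V.right_op_smult[OF odd_map_right[OF V(1)] V(3)[unfolded msec_P] c]
      unfolding tw msec_P by auto
  qed
  show "left_apply U (f \<odot>\<^bsub>TM U\<^esub> w) = \<tau>O U f \<odot>\<^bsub>TM U\<^esub> left_apply U w"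
    by (rule PS.sections_eqI_rep[OF w apply_extensional(1) smult_extensional rep(1)])
  show "right_apply U (f \<odot>\<^bsub>TM U\<^esub> w) = \<tau>O U f \<odot>\<^bsub>TM U\<^esub> right_apply U w"
    by (rule PS.sections_eqI_rep[OF w apply_extensional(2) smult_extensional rep(2)])
qed

lemma minus_extensional: "op U \<Longrightarrow> w \<in> sections U \<Longrightarrow> \<ominus>\<^bsub>TM U\<^esub> w \<in> extensional U"
  by (intro sections_extensional TS_minus_closed)

lemma apply_parity:
  assumes U: "op U" and w: "w \<in> sections U"
  shows "left_apply U (parity U w) = \<ominus>\<^bsub>TM U\<^esub> parity U (left_apply U w)"
    and "right_apply U (parity U w) = \<ominus>\<^bsub>TM U\<^esub> parity U (right_apply U w)"
proof -
  note cl = parity_closed[OF U left_apply_closed[OF U w]] parity_closed[OF U right_apply_closed[OF U w]]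
  have rep: "\<exists>s. represents (left_apply U (parity U w)) V s \<and>
        represents (\<ominus>\<^bsub>TM U\<^esub> parity U (left_apply U w)) V s"
      "\<exists>s. represents (right_apply U (parity U w)) V s \<and>
        represents (\<ominus>\<^bsub>TM U\<^esub> parity U (right_apply U w)) V s"
    if V: "op V" "V \<subseteq> U" "t \<in> carrier (PM V)" "represents w V t" for V t
  proof -
    interpret V: tensor_pair "sec \<X> V" "msec S V" "msec S' V" using V(1) by (rule tensor_pair)
    show "\<exists>s. represents (left_apply U (parity U w)) V s \<and>
        represents (\<ominus>\<^bsub>TM U\<^esub> parity U (left_apply U w)) V s"
      using left_rep[OF U parity_rep[OF U V(4,2)] V(2)]
        represents_minus[OF U cl(1) V(2) parity_rep[OF U left_rep[OF U V(4,2)] V(2)]]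
        V.left_op_tw[OF odd_map_left[OF V(1)] V(3)[unfolded msec_P]]
      unfolding msec_P by auto
    show "\<exists>s. represents (right_apply U (parity U w)) V s \<and>
        represents (\<ominus>\<^bsub>TM U\<^esub> parity U (right_apply U w)) V s"
      using right_rep[OF U parity_rep[OF U V(4,2)] V(2)]
        represents_minus[OF U cl(2) V(2) parity_rep[OF U right_rep[OF U V(4,2)] V(2)]]
        V.right_op_tw[OF odd_map_right[OF V(1)] V(3)[unfolded msec_P]]
      unfolding msec_P by auto
  qed
  show "left_apply U (parity U w) = \<ominus>\<^bsub>TM U\<^esub> parity U (left_apply U w)"
    by (rule PS.sections_eqI_rep[OF w apply_extensional(1) minus_extensional[OF U cl(1)] rep(1)])
  show "right_apply U (parity U w) = \<ominus>\<^bsub>TM U\<^esub> parity U (right_apply U w)"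
    by (rule PS.sections_eqI_rep[OF w apply_extensional(2) minus_extensional[OF U cl(2)] rep(2)])
qed

lemma apply_restrict:
  assumes o: "op U" "op V" "V \<subseteq> U" and w: "w \<in> sections U"
  shows "left_apply V (restrict w V) = restrict (left_apply U w) V"
    and "right_apply V (restrict w V) = restrict (right_apply U w) V"
  unfolding left_apply_def right_apply_def
  by (rule tensor_op_restrict[OF family_left o w], rule tensor_op_restrict[OF family_right o w])

lemma equalizer_restrict:
  "\<lbrakk>op U; op V; V \<subseteq> U; w \<in> equalizer U\<rbrakk> \<Longrightarrow> restrict w V \<in> equalizer V"
  using PS.restrict_sections[of w U V] by (simp add: equalizer_def apply_restrict)

lemma equalizer_local:
  assumes \<V>: "\<forall>V\<in>\<V>. op V" and w: "w \<in> sections (\<Union>\<V>)"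
    and loc: "\<forall>V\<in>\<V>. restrict w V \<in> equalizer V"
  shows "w \<in> equalizer (\<Union>\<V>)"
proof -
  have U: "op (\<Union>\<V>)" using \<V> by blast
  have "left_apply (\<Union>\<V>) w = right_apply (\<Union>\<V>) w"
  proof (rule extensionalityI[OF apply_extensional])
    fix x assume "x \<in> \<Union>\<V>"
    then obtain V where V: "V \<in> \<V>" "x \<in> V" by blast
    have "restrict (left_apply (\<Union>\<V>) w) V = restrict (right_apply (\<Union>\<V>) w) V"
      using loc V \<V> apply_restrict[OF U _ Union_upper[OF V(1)] w] by (simp add: equalizer_def)
    then show "left_apply (\<Union>\<V>) w x = right_apply (\<Union>\<V>) w x"
      using V(2) by (metis restrict_apply')
  qed
  then show ?thesis using w by (simp add: equalizer_def)
qed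

lemma equalizer_submodule:
  assumes U: "op U" shows "submodule (equalizer U) (sec \<X> U) (TM U)"
proof -
  interpret G: abelian_group "TM U" using U by (rule TS_abelian_group)
  note ad = additive_map_add[OF left_apply_additive[OF U]] additive_map_add[OF right_apply_additive[OF U]]
  note mi = additive_map_minus[OF G.abelian_group_axioms G.abelian_group_axioms left_apply_additive[OF U]]
     additive_map_minus[OF G.abelian_group_axioms G.abelian_group_axioms right_apply_additive[OF U]]
  note ze = additive_map_zero[OF G.abelian_group_axioms G.abelian_group_axioms left_apply_additive[OF U]]
     additive_map_zero[OF G.abelian_group_axioms G.abelian_group_axioms right_apply_additive[OF U]]
  show ?thesis
  proof (intro submodule.intro submodule_axioms.intro group.subgroupI G.a_group)
    show "equalizer U \<subseteq> carrier (add_monoid (TM U))"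
      by (auto simp: equalizer_def carrier_TS)
    show "equalizer U \<noteq> {}"
      using G.zero_closed ze unfolding equalizer_def carrier_TS by auto
  next
    fix a assume "a \<in> equalizer U"
    then have "\<ominus>\<^bsub>TM U\<^esub> a \<in> equalizer U"
      using mi[of a] TS_minus_closed[OF U, of a] by (simp add: equalizer_def carrier_TS)
    then show "inv\<^bsub>add_monoid (TM U)\<^esub> a \<in> equalizer U" by (simp add: a_inv_def)
  next
    fix a b assume "a \<in> equalizer U" "b \<in> equalizer U"
    then show "a \<otimes>\<^bsub>add_monoid (TM U)\<^esub> b \<in> equalizer U"
      using ad[of a b] G.a_closed[of a b] by (simp add: equalizer_def carrier_TS)
  next
    fix f w assume "f \<in> carrier (sec \<X> U)" "w \<in> equalizer U"
    then show "f \<odot>\<^bsub>TM U\<^esub> w \<in> equalizer U"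
      using apply_smult[OF U, of f w] smult_closed[OF U] by (simp add: equalizer_def)
  qed
qed

lemma equalizer_submodule_sheaf: "submodule_sheaf \<X> TS equalizer"
  unfolding submodule_sheaf_def carrier_TS mres_TS
  using equalizer_submodule equalizer_restrict equalizer_local by (auto simp: image_subset_iff)

text \<open>
  Both operators anticommute with \<open>parity\<close>, so their equalizer contains the homogeneous parts of its
  sections.
\<close>

lemma equalizer_parity:
  "op U \<Longrightarrow> w \<in> equalizer U \<Longrightarrow> parity U w \<in> equalizer U"
  using apply_parity[of U w] parity_closed[of U w] by (simp add: equalizer_def)

lemma equalizer_projection:
  assumes h: "h \<in> carrier (sec \<X> Xtop)"
    "h \<oplus>\<^bsub>sec \<X> Xtop\<^esub> h = \<one>\<^bsub>sec \<X> Xtop\<^esub>"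
    and U: "op U" and w: "w \<in> equalizer U"
  shows "projection h U d w \<in> equalizer U"
proof -
  interpret submodule "equalizer U" "sec \<X> U" "TM U" using U by (rule equalizer_submodule)
  interpret G: abelian_group "TM U" using U by (rule TS_abelian_group)
  have "\<ominus>\<^bsub>TM U\<^esub> v \<in> equalizer U" if "v \<in> equalizer U" for v
    using m_inv_closed[OF that] by (simp add: a_inv_def)
  then have "ksign (TM U) d (parity U w) \<in> equalizer U"
    using equalizer_parity[OF U w] by (simp add: ksign_def)
  from m_closed[OF w this] show ?thesis
    unfolding projection_def using half_res(1)[OF h U] by (intro smult_closed) simp_all
qed

lemma left_action_eq:
  assumes U: "op U" and f: "f \<in> carrier (sec \<X> U)" and g: "g \<in> carrier (sec \<X> U)" and w: "w \<in> sections U"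
  shows "tensor_left_action \<X> S S' \<psi> U (f, g) w =
    f \<odot>\<^bsub>TM U\<^esub> w \<oplus>\<^bsub>TM U\<^esub> \<tau>O U g \<odot>\<^bsub>TM U\<^esub> left_apply U w"
proof -
  have act: "left_action S \<psi> V (res (D_sheaf \<X>) U V (f, g)) =
    (\<lambda>x. res \<X> U V f \<odot>\<^bsub>msec S V\<^esub> x \<oplus>\<^bsub>msec S V\<^esub> \<psi> V (res \<X> U V g \<odot>\<^bsub>msec S V\<^esub> x))" for V
    by (simp add: left_action_def D_sheaf_def fun_eq_iff)
  have fam: "family U (\<lambda>V f. f) (\<lambda>V. left_action S \<psi> V (res (D_sheaf \<X>) U V (f, g))) (\<lambda>V s'. s')"
    unfolding family_def act
  proof (intro conjI allI impI ballI)
    fix V assume V: "op V \<and> V \<subseteq> U"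
    then interpret tensor_pair "sec \<X> V" "msec S V" "msec S' V" by (simp add: tensor_pair)
    show "semi V (\<lambda>f. f) (\<lambda>x. res \<X> U V f \<odot>\<^bsub>msec S V\<^esub> x \<oplus>\<^bsub>msec S V\<^esub> \<psi> V (res \<X> U V g \<odot>\<^bsub>msec S V\<^esub> x)) (\<lambda>s'. s')"
      using V U f g by (intro semilin_left_action odd_map_left res_closed) auto
  next
    fix V W s assume "op V \<and> op W \<and> W \<subseteq> V \<and> V \<subseteq> U" and s: "s \<in> carrier (msec S V)"
    then have o: "op V" "op W" "W \<subseteq> V" "V \<subseteq> U" by auto
    interpret VW: sheaf_pair_res \<X> S S' V W using o(1-3) by (rule sheaf_pair_res)
    have c: "res \<X> U V f \<odot>\<^bsub>msec S V\<^esub> s \<in> carrier (msec S V)" "res \<X> U V g \<odot>\<^bsub>msec S V\<^esub> s \<in> carrier (msec S V)"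
      using U o f g s by (auto intro!: VW.LU.smult_closed res_closed)
    have r: "res \<X> U W a \<odot>\<^bsub>msec S W\<^esub> mres S V W s = mres S V W (res \<X> U V a \<odot>\<^bsub>msec S V\<^esub> s)"
      if "a \<in> carrier (sec \<X> U)" for a
      using VW.mres_left(2)[OF res_closed[OF U o(1,4) that] s] res_res[OF U o(1-4) that] by simp
    show "res \<X> U W f \<odot>\<^bsub>msec S W\<^esub> mres S V W s \<oplus>\<^bsub>msec S W\<^esub> \<psi> W (res \<X> U W g \<odot>\<^bsub>msec S W\<^esub> mres S V W s) =
      mres S V W (res \<X> U V f \<odot>\<^bsub>msec S V\<^esub> s \<oplus>\<^bsub>msec S V\<^esub> \<psi> V (res \<X> U V g \<odot>\<^bsub>msec S V\<^esub> s))"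
      using c left_closed[OF o(1) c(2)]
      by (simp add: r f g odd_endomorphism_res[OF odd_left o(1-3)] additive_map_add[OF VW.mres_left(1)])
  qed simp
  show ?thesis
    unfolding tensor_left_action_def
  proof (rule PS.sections_eqI_rep[OF w op_extensional add_extensional])
    fix V t assume V: "op V" "V \<subseteq> U" "t \<in> carrier (PM V)" "represents w V t"
    interpret V: tensor_pair "sec \<X> V" "msec S V" "msec S' V" using V(1) by (rule tensor_pair)
    have c: "res \<X> U V f \<in> carrier (sec \<X> V)" "res \<X> U V g \<in> carrier (sec \<X> V)"
      using U V f g by (auto intro: res_closed)
    show "\<exists>s. represents (lift_op (\<lambda>V. left_action S \<psi> V (res (D_sheaf \<X>) U V (f, g))) (\<lambda>V s'. s') U w) V s \<and>
       represents (f \<odot>\<^bsub>TM U\<^esub> w \<oplus>\<^bsub>TM U\<^esub> \<tau>O U g \<odot>\<^bsub>TM U\<^esub> left_apply U w) V s"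
      using tensor_op_rep[OF fam U V(4,2)]
        represents_add[OF smult_rep[OF U f V(4,2)]
          smult_rep[OF U twist_sec_closed[OF U g] left_rep[OF U V(4,2)] V(2)] V(2)]
        V.left_action_tensor[OF odd_map_left[OF V(1)] c V(3)[unfolded msec_P]]
      unfolding act msec_P res_twist[OF U V(1,2) g] by auto
  qed
qed

lemma right_action_eq:
  assumes U: "op U" and f: "f \<in> grade (sec \<X> U) e" and g: "g \<in> grade (sec \<X> U) (e + 1)"
    and w: "w \<in> sections U"
  defines "v \<equiv> if e = 1 then parity U w else w"
  shows "tensor_right_action \<X> S S' \<psi>' U w (f, g) =
    f \<odot>\<^bsub>TM U\<^esub> v \<oplus>\<^bsub>TM U\<^esub> \<tau>O U g \<odot>\<^bsub>TM U\<^esub> right_apply U v"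
proof -
  have fg: "f \<in> carrier (sec \<X> U)" "g \<in> carrier (sec \<X> U)"
    using f g graded_group.gr_closed[OF graded_sec[OF U]] by auto
  have act: "(\<lambda>s'. right_action \<X> S' \<psi>' V s' (res (D_sheaf \<X>) U V (f, g))) =
    (\<lambda>y. rsmult (sec \<X> V) (msec S' V) y (res \<X> U V f) \<oplus>\<^bsub>msec S' V\<^esub>
      rsmult (sec \<X> V) (msec S' V) (\<psi>' V (\<tau>S' V y)) (res \<X> U V g))" for V
    by (simp add: right_action_def D_sheaf_def fun_eq_iff)
  have fam: "family U (\<lambda>V f. f) (\<lambda>V s. s) (\<lambda>V s'. right_action \<X> S' \<psi>' V s' (res (D_sheaf \<X>) U V (f, g)))"
    unfolding family_def act
  proof (intro conjI allI impI ballI)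
    fix V assume V: "op V \<and> V \<subseteq> U"
    then interpret tensor_pair "sec \<X> V" "msec S V" "msec S' V" by (simp add: tensor_pair)
    show "semi V (\<lambda>f. f) (\<lambda>s. s) (\<lambda>y. rsmult (sec \<X> V) (msec S' V) y (res \<X> U V f) \<oplus>\<^bsub>msec S' V\<^esub>
      rsmult (sec \<X> V) (msec S' V) (\<psi>' V (\<tau>S' V y)) (res \<X> U V g))"
      using V U fg by (intro semilin_right_action odd_map_right res_closed) auto
  next
    fix V W s assume "op V \<and> op W \<and> W \<subseteq> V \<and> V \<subseteq> U" and s: "s \<in> carrier (msec S' V)"
    then have o: "op V" "op W" "W \<subseteq> V" "V \<subseteq> U" by auto
    interpret VW: sheaf_pair_res \<X> S S' V W using o(1-3) by (rule sheaf_pair_res)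
    have t: "\<tau>S' V s \<in> carrier (msec S' V)" using s by (rule VW.RU.MG.twist_closed)
    have p: "\<psi>' V (\<tau>S' V s) \<in> carrier (msec S' V)" using o(1) t by (rule right_closed)
    have r: "rsmult (sec \<X> W) (msec S' W) (mres S' V W y) (res \<X> U W a) =
        mres S' V W (rsmult (sec \<X> V) (msec S' V) y (res \<X> U V a))"
      if "a \<in> carrier (sec \<X> U)" "y \<in> carrier (msec S' V)" for a y
      using VW.mres_right_rsmult[OF res_closed[OF U o(1,4) that(1)] that(2)] res_res[OF U o(1-4) that(1)] by simp
    have c: "rsmult (sec \<X> V) (msec S' V) s (res \<X> U V f) \<in> carrier (msec S' V)"
      "rsmult (sec \<X> V) (msec S' V) (\<psi>' V (\<tau>S' V s)) (res \<X> U V g) \<in> carrier (msec S' V)"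
      using U o fg s p by (auto intro!: VW.RU.rsmult_closed res_closed)
    show "rsmult (sec \<X> W) (msec S' W) (mres S' V W s) (res \<X> U W f) \<oplus>\<^bsub>msec S' W\<^esub>
        rsmult (sec \<X> W) (msec S' W) (\<psi>' W (\<tau>S' W (mres S' V W s))) (res \<X> U W g) =
      mres S' V W (rsmult (sec \<X> V) (msec S' V) s (res \<X> U V f) \<oplus>\<^bsub>msec S' V\<^esub>
        rsmult (sec \<X> V) (msec S' V) (\<psi>' V (\<tau>S' V s)) (res \<X> U V g))"
      unfolding VW.mres_right_twist[OF s] odd_endomorphism_res[OF odd_right o(1-3) t]
        r[OF fg(1) s] r[OF fg(2) p] additive_map_add[OF VW.mres_right(1) c] ..
  qed simp
  have v: "v \<in> sections U" unfolding v_def using w parity_closed[OF U w] by simp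
  show ?thesis
    unfolding tensor_right_action_def
  proof (rule PS.sections_eqI_rep[OF w op_extensional add_extensional])
    fix V t assume V: "op V" "V \<subseteq> U" "t \<in> carrier (PM V)" "represents w V t"
    interpret V: tensor_pair "sec \<X> V" "msec S V" "msec S' V" using V(1) by (rule tensor_pair)
    let ?t = "if e = 1 then lift V (\<tau>S V) (\<tau>S' V) t else t"
    have v_rep: "represents v V ?t" unfolding v_def using V(4) parity_rep[OF U V(4,2)] by simp
    have c: "res \<X> U V f \<in> grade (sec \<X> V) e" "res \<X> U V g \<in> grade (sec \<X> V) (e + 1)"
      using res_grade[OF U V(1,2) f] res_grade[OF U V(1,2) g] .
    show "\<exists>s. represents (lift_op (\<lambda>V s. s)
          (\<lambda>V s'. right_action \<X> S' \<psi>' V s' (res (D_sheaf \<X>) U V (f, g))) U w) V s \<and>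
       represents (f \<odot>\<^bsub>TM U\<^esub> v \<oplus>\<^bsub>TM U\<^esub> \<tau>O U g \<odot>\<^bsub>TM U\<^esub> right_apply U v) V s"
      using tensor_op_rep[OF fam U V(4,2)]
        represents_add[OF smult_rep[OF U fg(1) v_rep V(2)]
          smult_rep[OF U twist_sec_closed[OF U fg(2)] right_rep[OF U v_rep V(2)] V(2)] V(2)]
        V.right_action_tensor[OF odd_map_right[OF V(1)] c V(3)[unfolded msec_P]]
      unfolding act msec_P res_twist[OF U V(1,2) fg(2)] by (intro exI conjI) (assumption, simp only:)
  qed
qed

end

section \<open>Supercommutants\<close>

lemma (in sheaf_pair) grade_restrict:
  assumes o: "op U" "op V" "V \<subseteq> U" and p: "p \<in> mgrade (TM U) d"
  shows "restrict p V \<in> mgrade (TM V) d"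
  unfolding TS_grade[OF o(2)]
proof (intro conjI ballI)
  fix x assume x: "x \<in> V"
  then obtain W t where W: "x \<in> W" "W \<subseteq> U" "t \<in> mgrade (PM W) d" "represents p W t"
    using p o unfolding TS_grade[OF o(1)] by blast
  have Wo: "op W" "op (V \<inter> W)" using represents_closed(1)[OF W(4)] o by auto
  interpret sheaf_pair_res \<X> S S' W "V \<inter> W" using Wo by (intro sheaf_pair_res) auto
  have "mres P W (V \<inter> W) t \<in> mgrade (PM (V \<inter> W)) d"
    using W(3) unfolding msec_P by (rule mres_P_grade)
  moreover have "represents (restrict p V) (V \<inter> W) (mres P W (V \<inter> W) t)"
    using PS.represents_restrict[OF W(4) Wo(2)] by (intro PS.represents_restrict_fun) auto
  ultimately show "\<exists>Y. x \<in> Y \<and> Y \<subseteq> V \<and> (\<exists>t\<in>mgrade (PM Y) d. represents (restrict p V) Y t)"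
    using W x by (intro exI[of _ "V \<inter> W"]) auto
qed simp

context odd_pair
begin

text \<open>
  On a section of degree \<open>d\<close> the \<open>e\<close>-th power of \<open>parity\<close> is the scalar \<open>(-1)\<^bsup>ed\<^esup>\<close>, exactly the sign in
  the definition of the supercommutant. What remains differs from the left action only in the operator
  attached to \<open>\<theta>\<close>.
\<close>

lemma right_action_homogeneous:
  assumes U: "op U" and p: "p \<in> mgrade (TM U) d"
    and f: "f \<in> grade (sec \<X> U) e" and g: "g \<in> grade (sec \<X> U) (e + 1)"
  shows "ksign (TM U) (e * d) (tensor_right_action \<X> S S' \<psi>' U p (f, g)) =
    f \<odot>\<^bsub>TM U\<^esub> p \<oplus>\<^bsub>TM U\<^esub> \<tau>O U g \<odot>\<^bsub>TM U\<^esub> right_apply U p"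
proof -
  interpret G: abelian_group "TM U" using U by (rule TS_abelian_group)
  have ps: "p \<in> sections U" using U p by (rule grade_closed)
  have fg: "f \<in> carrier (sec \<X> U)" "g \<in> carrier (sec \<X> U)"
    using f g graded_group.gr_closed[OF graded_sec[OF U]] by auto
  let ?F = "\<lambda>x. f \<odot>\<^bsub>TM U\<^esub> x \<oplus>\<^bsub>TM U\<^esub> \<tau>O U g \<odot>\<^bsub>TM U\<^esub> right_apply U x"
  note ad1 = smult_additive[OF U fg(1)]
  note ad2 = additive_map_comp[OF right_apply_additive[OF U] smult_additive[OF U twist_sec_closed[OF U fg(2)]]]
  have F: "additive_map (TM U) (TM U) ?F"
    unfolding additive_map_def
    using additive_map_closed[OF ad1] additive_map_closed[OF ad2]
    by (simp add: additive_map_add[OF ad1] additive_map_add[OF ad2] G.a_ac)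
  have v: "(if e = 1 then parity U p else p) = ksign (TM U) (e * d) p"
    using parity_grade[OF U p] by (cases e) (simp_all add: ksign_def)
  have pc: "p \<in> carrier (TM U)" using ps by (simp add: carrier_TS)
  have "tensor_right_action \<X> S S' \<psi>' U p (f, g) = ?F (ksign (TM U) (e * d) p)"
    using right_action_eq[OF U f g ps] unfolding v .
  also have "\<dots> = ksign (TM U) (e * d) (?F p)"
    by (rule additive_map_ksign[OF G.abelian_group_axioms G.abelian_group_axioms F pc])
  finally show ?thesis
    using additive_map_closed[OF F pc] by (simp add: ksign_def)
qed

text \<open>
  The \<open>\<O>\<close>-part of a scalar \<open>f + \<theta> g\<close> imposes no condition, and the \<open>\<theta>\<close>-part is a multiple of the
  condition for \<open>\<theta>\<close> itself. The condition refers to the acting algebra through its graded pieces,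
  which \<open>\<D>\<close> and its opposite share.
\<close>

lemma homogeneous_supercommutes_iff:
  assumes \<A>: "topo \<A> = topo \<X>"
      "\<And>V e. op V \<Longrightarrow> grade (sec \<A> V) e = grade (sec \<X> V) e \<times> grade (sec \<X> V) (e + 1)"
    and U: "op U" and p: "p \<in> mgrade (TM U) d"
  shows "(\<forall>V. openin (topo \<A>) V \<and> V \<subseteq> U \<longrightarrow> (\<forall>e. \<forall>a\<in>grade (sec \<A> V) e.
        tensor_left_action \<X> S S' \<psi> V a (mres TS U V p) =
        ksign (TM V) (e * d) (tensor_right_action \<X> S S' \<psi>' V (mres TS U V p) a)))
    \<longleftrightarrow> p \<in> equalizer U" (is "?comm \<longleftrightarrow> _")
proof
  have ps: "p \<in> sections U" using U p by (rule grade_closed)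
  interpret RU: superring "sec \<X> U" using U by (rule ring_sec)
  interpret G: abelian_group "TM U" using U by (rule TS_abelian_group)
  {
    assume ?comm
    \<comment> \<open>The pair is \<open>\<theta>\<close>; its second entry lies in degree \<open>1 + 1 = 0\<close>.\<close>
    moreover have "(\<zero>\<^bsub>sec \<X> U\<^esub>, \<one>\<^bsub>sec \<X> U\<^esub>) \<in> grade (sec \<A> U) 1"
      using \<A>(2)[OF U, of 1] RU.RG.gr_zero RU.one_even by simp
    moreover have "mres TS U U p = p"
      using sections_extensional[OF ps] by (simp add: mres_TS extensional_restrict)
    ultimately have eq: "tensor_left_action \<X> S S' \<psi> U (\<zero>\<^bsub>sec \<X> U\<^esub>, \<one>\<^bsub>sec \<X> U\<^esub>) p =
        ksign (TM U) (1 * d) (tensor_right_action \<X> S S' \<psi>' U p (\<zero>\<^bsub>sec \<X> U\<^esub>, \<one>\<^bsub>sec \<X> U\<^esub>))"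
      using U \<A>(1) by (metis subset_refl)
    have tw: "\<tau>O U \<one>\<^bsub>sec \<X> U\<^esub> = \<one>\<^bsub>sec \<X> U\<^esub>"
      using RU.RG.twist_homogeneous[OF RU.one_even] by (simp add: ksign_def)
    have one: "\<one>\<^bsub>sec \<X> U\<^esub> \<in> grade (sec \<X> U) (1 + 1)" using RU.one_even by simp
    have "\<zero>\<^bsub>TM U\<^esub> \<oplus>\<^bsub>TM U\<^esub> left_apply U p = \<zero>\<^bsub>TM U\<^esub> \<oplus>\<^bsub>TM U\<^esub> right_apply U p"
      using eq unfolding left_action_eq[OF U RU.zero_closed RU.one_closed ps]
        right_action_homogeneous[OF U p RU.RG.gr_zero one] tw
      by (simp add: TS_smult_zero[OF U ps] TS_smult_one[OF U left_apply_closed[OF U ps]]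
          TS_smult_one[OF U right_apply_closed[OF U ps]])
    then have "left_apply U p = right_apply U p"
      using left_apply_closed[OF U ps] right_apply_closed[OF U ps] by (simp add: carrier_TS)
    then show "p \<in> equalizer U" using ps by (simp add: equalizer_def)
  next
    assume eq: "p \<in> equalizer U"
    show ?comm
    proof (intro allI impI ballI)
      fix V e a assume V: "openin (topo \<A>) V \<and> V \<subseteq> U" and a: "a \<in> grade (sec \<A> V) e"
      then have Vo: "op V" "V \<subseteq> U" using \<A>(1) by auto
      obtain f g where fg: "a = (f, g)" "f \<in> grade (sec \<X> V) e" "g \<in> grade (sec \<X> V) (e + 1)"
        using a unfolding \<A>(2)[OF Vo(1)] by blast
      have fgc: "f \<in> carrier (sec \<X> V)" "g \<in> carrier (sec \<X> V)"
        using fg graded_group.gr_closed[OF graded_sec[OF Vo(1)]] by auto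
      have pV: "restrict p V \<in> equalizer V" using U Vo eq by (rule equalizer_restrict)
      then have pVs: "restrict p V \<in> sections V" by (simp add: equalizer_def)
      have "restrict p V \<in> mgrade (TM V) d"
        using p grade_restrict[OF U Vo] by blast
      then show "tensor_left_action \<X> S S' \<psi> V a (mres TS U V p) =
        ksign (TM V) (e * d) (tensor_right_action \<X> S S' \<psi>' V (mres TS U V p) a)"
        unfolding fg(1) mres_TS
        using pV left_action_eq[OF Vo(1) fgc pVs] right_action_homogeneous[OF Vo(1) _ fg(2,3)]
        by (simp add: equalizer_def)
    qed
  }
qed

text \<open>
  The equalizer is a sheaf of submodules whose homogeneous sections are the supercommuting ones, and
  each of its sections is the sum of two homogeneous ones. It is therefore the sheaf of submodules that
  the supercommuting sections generate.
\<close>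

theorem supercommutant_eq_equalizer:
  assumes \<A>: "topo \<A> = topo \<X>"
      "\<And>V e. op V \<Longrightarrow> grade (sec \<A> V) e = grade (sec \<X> V) e \<times> grade (sec \<X> V) (e + 1)"
    and h: "h \<in> carrier (sec \<X> Xtop)"
      "h \<oplus>\<^bsub>sec \<X> Xtop\<^esub> h = \<one>\<^bsub>sec \<X> Xtop\<^esub>"
    and U: "op U"
  shows "supercommutant \<X> \<A> TS (tensor_left_action \<X> S S' \<psi>) (tensor_right_action \<X> S S' \<psi>') U = equalizer U"
    (is "?C = _")
proof
  let ?G = "supercommuting \<A> TS (tensor_left_action \<X> S S' \<psi>) (tensor_right_action \<X> S S' \<psi>')"
  have G: "p \<in> ?G V \<longleftrightarrow> (\<exists>d. p \<in> mgrade (TM V) d) \<and> p \<in> equalizer V" if "op V" for V p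
    using homogeneous_supercommutes_iff[OF \<A> that, of p] unfolding supercommuting_def by blast
  show "?C \<subseteq> equalizer U"
    unfolding supercommutant_def generated_submodule_sheaf_def
    using equalizer_submodule_sheaf G by blast
  show "equalizer U \<subseteq> ?C"
    unfolding supercommutant_def generated_submodule_sheaf_def
  proof (intro subsetI InterI)
    fix w Z assume w: "w \<in> equalizer U"
      and "Z \<in> {N U | N. submodule_sheaf \<X> TS N \<and> (\<forall>V. op V \<longrightarrow> ?G V \<subseteq> N V)}"
    then obtain N where N: "Z = N U" "submodule_sheaf \<X> TS N" "\<forall>V. op V \<longrightarrow> ?G V \<subseteq> N V" by blast
    have ws: "w \<in> sections U" using w by (simp add: equalizer_def)
    interpret submodule "N U" "sec \<X> U" "TM U"
      using N(2) U by (simp add: submodule_sheaf_def)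
    have "projection h U d w \<in> N U" for d
      using N(3) U G[OF U] projection_grade[OF h U ws] equalizer_projection[OF h U w] by blast
    then have "projection h U 0 w \<oplus>\<^bsub>TM U\<^esub> projection h U 1 w \<in> N U"
      using m_closed by simp
    then show "w \<in> Z" unfolding N(1) projection_sum[OF h U ws] .
  qed
qed

end

section \<open>Eigensheaves\<close>

lemma (in sheaf_pair) sec_abelian_group: "op V \<Longrightarrow> abelian_group (sec \<X> V)"
  by (intro ring.is_abelian_group superring.axioms(1) ring_sec)

lemma (in sheaf_pair) TS_smult_minus:
  assumes U: "op U" and f: "f \<in> carrier (sec \<X> U)" and w: "w \<in> sections U"
  shows "(\<ominus>\<^bsub>sec \<X> U\<^esub> f) \<odot>\<^bsub>TM U\<^esub> w = \<ominus>\<^bsub>TM U\<^esub> (f \<odot>\<^bsub>TM U\<^esub> w)"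
proof (rule PS.sections_eqI_rep[OF w smult_extensional])
  interpret RU: superring "sec \<X> U" using U by (rule ring_sec)
  note fw = smult_closed[OF U f w]
  show "\<ominus>\<^bsub>TM U\<^esub> (f \<odot>\<^bsub>TM U\<^esub> w) \<in> extensional U"
    using TS_minus_closed[OF U fw] by (rule sections_extensional)
  fix V t assume V: "op V" "V \<subseteq> U" "t \<in> carrier (PM V)" "represents w V t"
  interpret V: tensor_pair "sec \<X> V" "msec S V" "msec S' V" using V(1) by (rule tensor_pair)
  have c: "res \<X> U V f \<in> carrier (sec \<X> V)" using U V(1,2) f by (rule res_closed)
  have "additive_map (sec \<X> V) (PM V) (\<lambda>a. a \<odot>\<^bsub>PM V\<^esub> t)"
    using V(3) by (simp add: msec_P additive_map_def V.tensor_smult_l_distr V.tensor_smult_closed)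
  then have "(\<ominus>\<^bsub>sec \<X> V\<^esub> res \<X> U V f) \<odot>\<^bsub>PM V\<^esub> t = \<ominus>\<^bsub>PM V\<^esub> (res \<X> U V f \<odot>\<^bsub>PM V\<^esub> t)"
    using additive_map_minus[OF sec_abelian_group[OF V(1)] PS.groups[OF V(1)] _ c] by blast
  moreover have "res \<X> U V (\<ominus>\<^bsub>sec \<X> U\<^esub> f) = \<ominus>\<^bsub>sec \<X> V\<^esub> res \<X> U V f"
    by (rule additive_map_minus[OF sec_abelian_group[OF U] sec_abelian_group[OF V(1)] res_additive[OF U V(1,2)] f])
  ultimately show "\<exists>s. represents ((\<ominus>\<^bsub>sec \<X> U\<^esub> f) \<odot>\<^bsub>TM U\<^esub> w) V s \<and>
      represents (\<ominus>\<^bsub>TM U\<^esub> (f \<odot>\<^bsub>TM U\<^esub> w)) V s"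
    using smult_rep[OF U RU.a_inv_closed[OF f] V(4,2)]
      represents_minus[OF U fw V(2) smult_rep[OF U f V(4,2)]] by auto
qed

lemma odd_endomorphism_scale:
  assumes X: "locally_superringed \<X>" and S: "sheaf_of_modules \<X> S" and \<phi>: "odd_endomorphism \<X> S \<phi>"
    and j: "j \<in> grade (sec \<X> (topspace (topo \<X>))) 0"
  shows "odd_endomorphism \<X> S (scaled_endo \<X> S j \<phi>)"
proof -
  interpret sheaf_pair \<X> S S using X S by (simp add: sheaf_pair_def)
  have jV: "res \<X> Xtop V j \<in> grade (sec \<X> V) 0" if "op V" for V
    using res_grade[OF _ that openin_subset[OF that] j] by simp
  have j': "j \<in> carrier (sec \<X> Xtop)"
    using graded_group.gr_closed[OF graded_sec j] by simp
  have "odd_map (sec \<X> V) (msec S V) (scaled_endo \<X> S j \<phi> V)" if V: "op V" for V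
  proof -
    interpret super_module "sec \<X> V" "msec S V" using V by (rule module_left)
    show ?thesis
      using odd_map_scale[OF odd_endomorphism_odd_map[OF \<phi> V] jV[OF V]]
      by (simp add: scaled_endo_def[abs_def])
  qed
  moreover have "scaled_endo \<X> S j \<phi> W (mres S V W s) = mres S V W (scaled_endo \<X> S j \<phi> V s)"
    if o: "op V" "op W" "W \<subseteq> V" and s: "s \<in> carrier (msec S V)" for V W s
  proof -
    interpret sheaf_pair_res \<X> S S V W using o by (rule sheaf_pair_res)
    have c: "\<phi> V s \<in> carrier (msec S V)"
      using additive_map_closed[of "msec S V" "msec S V" "\<phi> V"] odd_endomorphism_odd_map[OF \<phi> o(1)] s
      unfolding odd_map_def by blast
    have jc: "res \<X> Xtop V j \<in> carrier (sec \<X> V)"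
      using LU.RG.gr_closed[OF jV[OF o(1)]] .
    show ?thesis
      unfolding scaled_endo_def odd_endomorphism_res[OF \<phi> o s] mres_left(2)[OF jc c]
      using res_res[OF _ o openin_subset[OF o(1)] j'] by simp
  qed
  ultimately show ?thesis
    by (simp add: odd_endomorphism_def odd_map_def additive_map_def)
qed

context odd_pair
begin

lemma res_top_even:
  assumes U: "op U" and j: "j \<in> grade (sec \<X> Xtop) 0"
  shows "res \<X> Xtop U j \<in> grade (sec \<X> U) 0"
    and "res \<X> Xtop U j \<in> carrier (sec \<X> U)"
    and "\<tau>O U (res \<X> Xtop U j) = res \<X> Xtop U j"
proof -
  show 1: "res \<X> Xtop U j \<in> grade (sec \<X> U) 0"
    using res_grade[OF _ U openin_subset[OF U] j] by simp
  show "res \<X> Xtop U j \<in> carrier (sec \<X> U)"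
    and "\<tau>O U (res \<X> Xtop U j) = res \<X> Xtop U j"
    using graded_group.gr_closed[OF graded_sec[OF U] 1] graded_group.twist_homogeneous[OF graded_sec[OF U] 1]
    by (simp_all add: ksign_def)
qed

lemma res_top_res:
  assumes "op U" "op V" "V \<subseteq> U" "j \<in> grade (sec \<X> Xtop) 0"
  shows "res \<X> U V (res \<X> Xtop U j) = res \<X> Xtop V j"
  using res_res[OF openin_topspace assms(1,2,3) openin_subset[OF assms(1)]]
    graded_group.gr_closed[OF graded_sec[OF openin_topspace] assms(4)] by blast

lemma left_apply_scale:
  assumes U: "op U" and w: "w \<in> sections U" and j: "j \<in> grade (sec \<X> Xtop) 0"
  shows "lift_op (scaled_endo \<X> S j \<psi>) (\<lambda>V s'. s') U w =
    res \<X> Xtop U j \<odot>\<^bsub>TM U\<^esub> left_apply U w"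
proof -
  interpret J: odd_pair \<X> S S' "scaled_endo \<X> S j \<psi>" \<psi>'
    by unfold_locales (rule odd_endomorphism_scale[OF locally_superringed sheaf_left odd_left j], rule odd_right)
  show ?thesis
    unfolding J.left_apply_def[symmetric]
  proof (rule PS.sections_eqI_rep[OF w J.apply_extensional(1) smult_extensional])
    fix V t assume V: "op V" "V \<subseteq> U" "t \<in> carrier (PM V)" "represents w V t"
    interpret V: tensor_pair "sec \<X> V" "msec S V" "msec S' V" using V(1) by (rule tensor_pair)
    have "scaled_endo \<X> S j \<psi> V = (\<lambda>x. res \<X> Xtop V j \<odot>\<^bsub>msec S V\<^esub> \<psi> V x)"
      by (simp add: scaled_endo_def fun_eq_iff)
    then show "\<exists>s. represents (J.left_apply U w) V s \<and>
        represents (res \<X> Xtop U j \<odot>\<^bsub>TM U\<^esub> left_apply U w) V s"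
      using J.left_rep[OF U V(4,2)] smult_rep[OF U res_top_even(2)[OF U j] left_rep[OF U V(4,2)] V(2)]
        V.left_op_scale[OF odd_map_left[OF V(1)] res_top_even(1)[OF V(1) j] V(3)[unfolded msec_P]]
      unfolding res_top_res[OF U V(1,2) j] msec_P by auto
  qed
qed

lemma right_apply_scale:
  assumes U: "op U" and w: "w \<in> sections U" and j: "j \<in> grade (sec \<X> Xtop) 0"
  shows "lift_op (\<lambda>V. \<tau>S V) (scaled_endo \<X> S' j \<psi>') U w =
    res \<X> Xtop U j \<odot>\<^bsub>TM U\<^esub> right_apply U w"
proof -
  interpret J: odd_pair \<X> S S' \<psi> "scaled_endo \<X> S' j \<psi>'"
    by unfold_locales (rule odd_left, rule odd_endomorphism_scale[OF locally_superringed sheaf_right odd_right j])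
  show ?thesis
    unfolding J.right_apply_def[symmetric]
  proof (rule PS.sections_eqI_rep[OF w J.apply_extensional(2) smult_extensional])
    fix V t assume V: "op V" "V \<subseteq> U" "t \<in> carrier (PM V)" "represents w V t"
    interpret V: tensor_pair "sec \<X> V" "msec S V" "msec S' V" using V(1) by (rule tensor_pair)
    have "scaled_endo \<X> S' j \<psi>' V = (\<lambda>x. res \<X> Xtop V j \<odot>\<^bsub>msec S' V\<^esub> \<psi>' V x)"
      by (simp add: scaled_endo_def fun_eq_iff)
    then show "\<exists>s. represents (J.right_apply U w) V s \<and>
        represents (res \<X> Xtop U j \<odot>\<^bsub>TM U\<^esub> right_apply U w) V s"
      using J.right_rep[OF U V(4,2)] smult_rep[OF U res_top_even(2)[OF U j] right_rep[OF U V(4,2)] V(2)]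
        V.right_op_scale[OF odd_map_right[OF V(1)] res_top_even(1)[OF V(1) j] V(3)[unfolded msec_P]]
      unfolding res_top_res[OF U V(1,2) j] msec_P by auto
  qed
qed

text \<open>
  The sign \<open>(-1)\<^bsup>|s|\<^esup>\<close> in \<open>\<tau> \<otimes> \<psi>'\<close> is the Koszul sign of \<open>\<psi> \<otimes> \<psi>'\<close>.
\<close>

lemma left_apply_right_apply:
  assumes U: "op U" and w: "w \<in> sections U"
  shows "left_apply U (right_apply U w) = tensor_endo \<X> S S' \<psi> \<psi>' U w"
proof -
  have fam: "family U (\<lambda>V. \<tau>O V) (\<lambda>V s. \<psi> V (\<tau>S V s)) \<psi>'"
    unfolding family_def
  proof (intro conjI allI impI ballI)
    fix V assume V: "op V \<and> V \<subseteq> U"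
    then interpret tensor_pair "sec \<X> V" "msec S V" "msec S' V" by (simp add: tensor_pair)
    show "semi V (\<tau>O V) (\<lambda>s. \<psi> V (\<tau>S V s)) (\<psi>' V)"
      using V by (intro semilin_endo odd_map_left odd_map_right) auto
  next
    fix V W s assume "op V \<and> op W \<and> W \<subseteq> V \<and> V \<subseteq> U" and s: "s \<in> carrier (msec S V)"
    then have o: "op V" "op W" "W \<subseteq> V" by auto
    interpret sheaf_pair_res \<X> S S' V W using o by (rule sheaf_pair_res)
    show "\<psi> W (\<tau>S W (mres S V W s)) = mres S V W (\<psi> V (\<tau>S V s))"
      unfolding mres_left_twist[OF s] by (rule odd_endomorphism_res[OF odd_left o LU.MG.twist_closed[OF s]])
  qed (use odd_endomorphism_res[OF odd_right] in auto)
  show ?thesis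
    unfolding tensor_endo_def
  proof (rule PS.sections_eqI_rep[OF w apply_extensional(1) op_extensional])
    fix V t assume V: "op V" "V \<subseteq> U" "t \<in> carrier (PM V)" "represents w V t"
    interpret V: tensor_pair "sec \<X> V" "msec S V" "msec S' V" using V(1) by (rule tensor_pair)
    show "\<exists>s. represents (left_apply U (right_apply U w)) V s \<and>
      represents (lift_op (\<lambda>V s. \<psi> V (\<tau>S V s)) \<psi>' U w) V s"
      using left_rep[OF U right_rep[OF U V(4,2)] V(2)] tensor_op_rep[OF fam U V(4,2)]
        V.left_op_right_op[OF odd_map_left[OF V(1)] odd_map_right[OF V(1)] V(3)[unfolded msec_P]]
      by auto
  qed
qed

lemma left_apply_involution:
  assumes U: "op U" and w: "w \<in> sections U"
    and inv: "\<And>V s. op V \<Longrightarrow> s \<in> carrier (msec S V) \<Longrightarrow> \<psi> V (\<psi> V s) = s"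
  shows "left_apply U (left_apply U w) = w"
proof (rule PS.sections_eqI_rep[OF w apply_extensional(1) sections_extensional[OF w]])
  fix V t assume V: "op V" "V \<subseteq> U" "t \<in> carrier (PM V)" "represents w V t"
  interpret V: tensor_pair "sec \<X> V" "msec S V" "msec S' V" using V(1) by (rule tensor_pair)
  show "\<exists>s. represents (left_apply U (left_apply U w)) V s \<and> represents w V s"
    using left_rep[OF U left_rep[OF U V(4,2)] V(2)] V(4)
      V.left_op_involution[OF odd_map_left[OF V(1)] inv[OF V(1)] V(3)[unfolded msec_P]] by auto
qed

text \<open>
  Let \<open>A = \<psi> \<otimes> 1\<close> and \<open>B = \<tau> \<otimes> \<psi>'\<close>, so \<open>A\<^sup>2 = 1\<close> and \<open>A B = \<psi> \<otimes> \<psi>'\<close>. The even scalar \<open>j\<close>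
  commutes with both. The first product is \<open>j A w = B w\<close>, which \<open>A\<close> transforms into
  \<open>j w = (\<psi> \<otimes> \<psi>') w\<close>; the second is \<open>A w = j B w\<close>, which \<open>A\<close> transforms into
  \<open>w = j (\<psi> \<otimes> \<psi>') w\<close>, and \<open>j\<^sup>-\<^sup>1 = -j\<close>.
\<close>

theorem box_products_eq_eigensheaves:
  assumes inv: "\<And>V s. op V \<Longrightarrow> s \<in> carrier (msec S V) \<Longrightarrow> \<psi> V (\<psi> V s) = s"
    and j: "j \<in> grade (sec \<X> Xtop) 0"
      "j \<otimes>\<^bsub>sec \<X> Xtop\<^esub> j = \<ominus>\<^bsub>sec \<X> Xtop\<^esub> \<one>\<^bsub>sec \<X> Xtop\<^esub>"
    and h: "h \<in> carrier (sec \<X> Xtop)"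
      "h \<oplus>\<^bsub>sec \<X> Xtop\<^esub> h = \<one>\<^bsub>sec \<X> Xtop\<^esub>"
    and U: "op U"
  shows "box_product \<X> j S \<psi> S' \<psi>' U = eigensheaf \<X> TS (tensor_endo \<X> S S' \<psi> \<psi>') j U"
    and "box_product_o \<X> j S \<psi> S' \<psi>' U =
      eigensheaf \<X> TS (tensor_endo \<X> S S' \<psi> \<psi>') (\<ominus>\<^bsub>sec \<X> Xtop\<^esub> j) U"
proof -
  let ?j = "res \<X> Xtop U j"
  interpret L: odd_pair \<X> S S' "scaled_endo \<X> S j \<psi>" \<psi>'
    by unfold_locales (rule odd_endomorphism_scale[OF locally_superringed sheaf_left odd_left j(1)], rule odd_right)
  interpret R: odd_pair \<X> S S' \<psi> "scaled_endo \<X> S' j \<psi>'"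
    by unfold_locales (rule odd_left, rule odd_endomorphism_scale[OF locally_superringed sheaf_right odd_right j(1)])
  interpret G: abelian_group "TM U" using U by (rule TS_abelian_group)
  interpret RU: superring "sec \<X> U" using U by (rule ring_sec)
  interpret RT: superring "sec \<X> Xtop" by (rule ring_sec) simp
  note top = openin_topspace[of "topo \<X>"] openin_subset[OF U]
  have jc: "j \<in> carrier (sec \<X> Xtop)" using j(1) by (rule RT.RG.gr_closed)
  have jU: "?j \<in> carrier (sec \<X> U)" "\<tau>O U ?j = ?j" using res_top_even[OF U j(1)] by auto
  have minus: "res \<X> Xtop U (\<ominus>\<^bsub>sec \<X> Xtop\<^esub> a) = \<ominus>\<^bsub>sec \<X> U\<^esub> res \<X> Xtop U a" if "a \<in> carrier (sec \<X> Xtop)" for a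
    using additive_map_minus[OF RT.abelian_group_axioms RU.abelian_group_axioms res_additive[OF top(1) U top(2)] that] .
  have smult_minus: "(\<ominus>\<^bsub>sec \<X> U\<^esub> a) \<odot>\<^bsub>TM U\<^esub> w = \<ominus>\<^bsub>TM U\<^esub> (a \<odot>\<^bsub>TM U\<^esub> w)"
    if "a \<in> carrier (sec \<X> U)" "w \<in> sections U" for a w
    using TS_smult_minus[OF U that] .
  have smult_r_minus: "a \<odot>\<^bsub>TM U\<^esub> \<ominus>\<^bsub>TM U\<^esub> w = \<ominus>\<^bsub>TM U\<^esub> (a \<odot>\<^bsub>TM U\<^esub> w)"
    if "a \<in> carrier (sec \<X> U)" "w \<in> sections U" for a w
    using additive_map_minus[OF G.abelian_group_axioms G.abelian_group_axioms smult_additive[OF U that(1)]] that(2)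
    by (simp add: carrier_TS)
  have left_minus: "left_apply U (\<ominus>\<^bsub>TM U\<^esub> w) = \<ominus>\<^bsub>TM U\<^esub> left_apply U w" if "w \<in> sections U" for w
    using additive_map_minus[OF G.abelian_group_axioms G.abelian_group_axioms left_apply_additive[OF U]] that
    by (simp add: carrier_TS)
  have neg_neg: "\<ominus>\<^bsub>TM U\<^esub> (\<ominus>\<^bsub>TM U\<^esub> w) = w" if "w \<in> sections U" for w
    using that by (simp add: carrier_TS)
  have jj: "?j \<odot>\<^bsub>TM U\<^esub> (?j \<odot>\<^bsub>TM U\<^esub> w) = \<ominus>\<^bsub>TM U\<^esub> w" if w: "w \<in> sections U" for w
  proof -
    have "?j \<otimes>\<^bsub>sec \<X> U\<^esub> ?j = \<ominus>\<^bsub>sec \<X> U\<^esub> \<one>\<^bsub>sec \<X> U\<^esub>"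
      using res_mult[OF top(1) U top(2) jc jc] j(2) minus[OF RT.one_closed] res_one[OF top(1) U top(2)] by simp
    then show ?thesis
      using TS_smult_assoc[OF U jU(1) jU(1) w] smult_minus[OF RU.one_closed w] TS_smult_one[OF U w] by simp
  qed
  note invol = left_apply_involution[OF U _ inv]
  note lc = left_apply_closed[OF U] and rc = right_apply_closed[OF U] and sc = smult_closed[OF U jU(1)]
  note lj = apply_smult(1)[OF U jU(1), unfolded jU(2)]
  have "box_product \<X> j S \<psi> S' \<psi>' U = L.equalizer U"
    unfolding box_product_def
    by (rule L.supercommutant_eq_equalizer[OF _ _ h U]) (simp_all add: D_sheaf_def adjoin_theta_def)
  also have "\<dots> = {w \<in> sections U. ?j \<odot>\<^bsub>TM U\<^esub> left_apply U w = right_apply U w}"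
    unfolding L.equalizer_def L.left_apply_def right_apply_def[symmetric]
    using left_apply_scale[OF U _ j(1)] by auto
  also have "\<dots> = eigensheaf \<X> TS (tensor_endo \<X> S S' \<psi> \<psi>') j U"
  proof -
    have "?j \<odot>\<^bsub>TM U\<^esub> left_apply U w = right_apply U w \<longleftrightarrow>
        left_apply U (right_apply U w) = ?j \<odot>\<^bsub>TM U\<^esub> w" if w: "w \<in> sections U" for w
      using lj[OF lc[OF w]] lj[OF w] invol[OF w] invol[OF rc[OF w]] by metis
    then show ?thesis
      unfolding eigensheaf_def carrier_TS using left_apply_right_apply[OF U] by auto
  qed
  finally show "box_product \<X> j S \<psi> S' \<psi>' U = eigensheaf \<X> TS (tensor_endo \<X> S S' \<psi> \<psi>') j U" .
  have "box_product_o \<X> j S \<psi> S' \<psi>' U = R.equalizer U"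
    unfolding box_product_o_def
    by (rule R.supercommutant_eq_equalizer[OF _ _ h U]) (simp_all add: D_op_sheaf_def D_sheaf_def opposite_def adjoin_theta_def)
  also have "\<dots> = {w \<in> sections U. left_apply U w = ?j \<odot>\<^bsub>TM U\<^esub> right_apply U w}"
    unfolding R.equalizer_def R.right_apply_def left_apply_def[symmetric]
    using right_apply_scale[OF U _ j(1)] by auto
  also have "\<dots> = eigensheaf \<X> TS (tensor_endo \<X> S S' \<psi> \<psi>') (\<ominus>\<^bsub>sec \<X> Xtop\<^esub> j) U"
  proof -
    have "left_apply U w = ?j \<odot>\<^bsub>TM U\<^esub> right_apply U w \<longleftrightarrow>
        left_apply U (right_apply U w) = res \<X> Xtop U (\<ominus>\<^bsub>sec \<X> Xtop\<^esub> j) \<odot>\<^bsub>TM U\<^esub> w"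
      (is "?l \<longleftrightarrow> ?r") if w: "w \<in> sections U" for w
    proof -
      have r: "?r \<longleftrightarrow> left_apply U (right_apply U w) = \<ominus>\<^bsub>TM U\<^esub> (?j \<odot>\<^bsub>TM U\<^esub> w)"
        unfolding minus[OF jc] smult_minus[OF jU(1) w] ..
      show ?thesis
        unfolding r
      proof
        assume ?l
        then have "w = ?j \<odot>\<^bsub>TM U\<^esub> left_apply U (right_apply U w)"
          using lj[OF rc[OF w]] invol[OF w] by simp
        then have "?j \<odot>\<^bsub>TM U\<^esub> w = \<ominus>\<^bsub>TM U\<^esub> left_apply U (right_apply U w)"
          using jj[OF lc[OF rc[OF w]]] by simp
        then show "left_apply U (right_apply U w) = \<ominus>\<^bsub>TM U\<^esub> (?j \<odot>\<^bsub>TM U\<^esub> w)"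
          using neg_neg[OF lc[OF rc[OF w]]] by simp
      next
        assume "left_apply U (right_apply U w) = \<ominus>\<^bsub>TM U\<^esub> (?j \<odot>\<^bsub>TM U\<^esub> w)"
        then have "right_apply U w = \<ominus>\<^bsub>TM U\<^esub> (?j \<odot>\<^bsub>TM U\<^esub> left_apply U w)"
          using invol[OF rc[OF w]] left_minus[OF sc[OF w]] lj[OF w] by simp
        then show ?l
          using smult_r_minus[OF jU(1) sc[OF lc[OF w]]] jj[OF lc[OF w]] neg_neg[OF lc[OF w]] by simp
      qed
    qed
    then show ?thesis
      unfolding eigensheaf_def carrier_TS using left_apply_right_apply[OF U] by auto
  qed
  finally show "box_product_o \<X> j S \<psi> S' \<psi>' U =
      eigensheaf \<X> TS (tensor_endo \<X> S S' \<psi> \<psi>') (\<ominus>\<^bsub>sec \<X> Xtop\<^esub> j) U" .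
qed

end

theorem mainTheorem7:
  fixes k :: "'k ring" and i :: 'k
    and B :: "('y, 'b) superspace" and \<iota> :: "'k \<Rightarrow> 'b"
    and \<X> :: "('x, 'a) superspace" and \<pi> :: "'x \<Rightarrow> 'y" and c :: "'y set \<Rightarrow> 'b \<Rightarrow> 'a"
    and S :: "('x, 'a, 'm) msheaf" and \<phi> :: "'x set \<Rightarrow> 'm \<Rightarrow> 'm"
    and S' :: "('x, 'a, 'n) msheaf" and \<phi>' :: "'x set \<Rightarrow> 'n \<Rightarrow> 'n"
    and \<kappa> :: "'k \<Rightarrow> 'a"
  assumes "algebraically_closed k" and "\<one>\<^bsub>k\<^esub> \<oplus>\<^bsub>k\<^esub> \<one>\<^bsub>k\<^esub> \<noteq> \<zero>\<^bsub>k\<^esub>"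
    and "i \<in> carrier k" and "i \<otimes>\<^bsub>k\<^esub> i = \<ominus>\<^bsub>k\<^esub> \<one>\<^bsub>k\<^esub>"
    and "superscheme_over_field k B \<iota>"
    and "superscheme \<X>" and "superscheme_morphism \<X> B \<pi> c"
    and "Pi_invertible \<X> S \<phi>" and "Pi_invertible \<X> S' \<phi>'"
  defines "\<kappa> \<equiv> \<lambda>a. c (topspace (topo B)) (\<iota> a)"
  shows "\<forall>U. openin (topo \<X>) U \<longrightarrow>
      box_product \<X> (\<kappa> i) S \<phi> S' \<phi>' U =
        eigensheaf \<X> (tensor_sheaf \<X> S S') (tensor_endo \<X> S S' \<phi> \<phi>') (\<kappa> i) U \<and>
      box_product_o \<X> (\<kappa> i) S \<phi> S' \<phi>' U =
        eigensheaf \<X> (tensor_sheaf \<X> S S') (tensor_endo \<X> S S' \<phi> \<phi>') (\<kappa> (\<ominus>\<^bsub>k\<^esub> i)) U"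
proof -
  interpret k: algebraically_closed k by fact
  let ?top = "topspace (topo \<X>)" and ?topB = "topspace (topo B)"
  let ?O = "sec \<X> ?top"
  interpret odd_pair \<X> S S' \<phi> \<phi>'
    using assms(6,8,9)
    by (simp add: odd_pair_def odd_pair_axioms_def sheaf_pair_def superscheme_def Pi_invertible_def locally_free_1_1_def)
  have mor: "superspace_morphism \<X> B \<pi> c" using assms(7) by (simp add: superscheme_morphism_def)
  \<comment> \<open>The comorphism over all of \<open>B\<close> lands in the functions on \<open>\<pi>\<^sup>-\<^sup>1(B)\<close>.\<close>
  then have "preimage \<X> \<pi> ?topB = ?top"
    by (auto simp: superspace_morphism_def preimage_def continuous_map_def)
  with mor have c: "c ?topB \<in> superring_hom (sec B ?topB) ?O"
    by (auto simp: superspace_morphism_def)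
  have \<iota>: "\<iota> \<in> ring_hom k (sec B ?topB)" "\<iota> ` carrier k \<subseteq> grade (sec B ?topB) 0"
    using assms(5) by (auto simp: superscheme_over_field_def)
  have \<kappa>: "\<kappa> \<in> ring_hom k ?O"
    using ring_hom_trans[OF \<iota>(1), of "c ?topB" ?O] c by (simp add: \<kappa>_def superring_hom_def comp_def)
  have even: "\<kappa> a \<in> grade ?O 0" if "a \<in> carrier k" for a
    using c \<iota>(2) that by (auto simp: \<kappa>_def superring_hom_def)
  interpret O: superring ?O by (rule ring_sec) simp
  have ad: "additive_map k ?O \<kappa>" using \<kappa> by (auto simp: additive_map_def ring_hom_def)
  have minus: "\<kappa> (\<ominus>\<^bsub>k\<^esub> a) = \<ominus>\<^bsub>?O\<^esub> \<kappa> a" if "a \<in> carrier k" for a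
    by (rule additive_map_minus[OF k.abelian_group_axioms O.abelian_group_axioms ad that])
  have jj: "\<kappa> i \<otimes>\<^bsub>?O\<^esub> \<kappa> i = \<ominus>\<^bsub>?O\<^esub> \<one>\<^bsub>?O\<^esub>"
    using ring_hom_mult[OF \<kappa> assms(3,3)] minus[OF k.one_closed] ring_hom_one[OF \<kappa>] assms(4) by simp
  \<comment> \<open>This is where the characteristic enters: \<open>1/2\<close> separates even and odd parts.\<close>
  let ?h = "inv\<^bsub>k\<^esub> (\<one>\<^bsub>k\<^esub> \<oplus>\<^bsub>k\<^esub> \<one>\<^bsub>k\<^esub>)"
  have "\<one>\<^bsub>k\<^esub> \<oplus>\<^bsub>k\<^esub> \<one>\<^bsub>k\<^esub> \<in> Units k" using assms(2) by (simp add: k.field_Units)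
  then have h: "?h \<in> carrier k" "?h \<otimes>\<^bsub>k\<^esub> (\<one>\<^bsub>k\<^esub> \<oplus>\<^bsub>k\<^esub> \<one>\<^bsub>k\<^esub>) = \<one>\<^bsub>k\<^esub>"
    by (simp_all add: k.Units_l_inv)
  then have "?h \<oplus>\<^bsub>k\<^esub> ?h = \<one>\<^bsub>k\<^esub>" by (simp add: k.r_distr)
  then have half: "\<kappa> ?h \<oplus>\<^bsub>?O\<^esub> \<kappa> ?h = \<one>\<^bsub>?O\<^esub>"
    using additive_map_add[OF ad h(1) h(1)] ring_hom_one[OF \<kappa>] by simp
  have inv: "\<phi> V (\<phi> V s) = s" if "openin (topo \<X>) V" "s \<in> carrier (msec S V)" for V s
    using assms(8) that by (simp add: Pi_invertible_def)
  show ?thesis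
    unfolding minus[OF assms(3)]
    using box_products_eq_eigensheaves[OF inv even[OF assms(3)] jj additive_map_closed[OF ad h(1)] half] by blast
qed

end
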